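(* Let $\eta_t$ and $\bar\eta_t$ be the exclusion processes with simple, translation invariant rates $$p(x,y;\eta)=a(y-x)\,\eta(x)(1-\eta(y)),\qquad \bar p(x,y;\eta)=\bar a(y-x)\,\eta(x)(1-\eta(y)),\qquad x,y\in\mathbb{Z},$$ respectively, both satisfying the standing assumptions on rates. Suppose that $$a(x)\ge \bar a(y)\quad\text{for all integers } 0<x\le y,$$ $$a(y)\le \bar a(x)\quad\text{for all integers } y\le x<0.$$ Then if $\bar\eta_t$ has a blocking invariant measure, so does $\eta_t$.
   Context: Exclusion process. For $\eta\in\{0,1\}^{\mathbb{Z}}$ and $x,y\in\mathbb{Z}$, $\eta^{x,y}$ is the configuration obtained from $\eta$ by exchanging the values at $x$ and $y$. Rates are functions $p(x,y;\eta)\ge 0$, continuous in $\eta$ (product topology), with $p(x,y;\eta)=0$ unless $\eta(x)=1$ and $\eta(y)=0$. The exclusion process with rates $p$ has generator $Lf(\eta)=\sum_{x\in\mathbb{Z}}\sum_{y\in\mathbb{Z}}p(x,y;\eta)[f(\eta^{x,y})-f(\eta)]$. Blocking configurations. For $n\in\mathbb{Z}$ let $\mathcal{X}_n=\{\eta\in\{0,1\}^{\mathbb{Z}}:\sum_{x\le n}\eta(x)=\sum_{x>n}(1-\eta(x))<\infty\}$ and $\mathcal{X}=\bigcup_n\mathcal{X}_n$, a countable set whose elements are called blocking configurations. A blocking measure is a probability measure supported on $\mathcal{X}$. Standing assumptions on all rates $p$ (and likewise $\bar p$): (i) $0\le p(x,y;\eta)\le 1$; (ii) for every $\zeta\in\mathcal{X}$,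 $\sum_x\sum_y p(x,y;\zeta)<\infty$. On $\mathcal{X}$ the process is the continuous time Markov jump chain that jumps from $\eta$ to $\eta^{x,y}$ at rate $p(x,y;\eta)$ (constructed jump by jump, i.e. the minimal chain, with explosions not excluded a priori). A blocking invariant measure for the process is a blocking measure $\mu$ such that if $\eta_0$ has law $\mu$ then $\eta_t$ has law $\mu$ for every $t\ge0$ (in particular the process started from $\mu$ almost surely does not explode). *)

theory Defs
  imports "HOL-Probability.Probability"
begin

type_synonym config = "int \<Rightarrow> bool"

type_synonym rates = "int \<Rightarrow> int \<Rightarrow> config \<Rightarrow> real"

definition exchange :: "config \<Rightarrow> int \<Rightarrow> int \<Rightarrow> config" where
  "exchange \<eta> x y = \<eta>(x := \<eta> y, y := \<eta> x)"

definition blocking_level :: "int \<Rightarrow> config set" where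
  "blocking_level n = {\<eta>. finite {x. x \<le> n \<and> \<eta> x} \<and> finite {x. x > n \<and> \<not> \<eta> x} \<and>
     card {x. x \<le> n \<and> \<eta> x} = card {x. x > n \<and> \<not> \<eta> x}}"

definition blocking_configs :: "config set" where
  "blocking_configs = (\<Union>n. blocking_level n)"

text \<open>Continuity below refers to the product topology on configurations, \<^typ>\<open>bool\<close> being discrete.\<close>

definition exclusion_rates :: "rates \<Rightarrow> bool" where
  "exclusion_rates p \<longleftrightarrow>
     (\<forall>x y. continuous_on UNIV (p x y)) \<and>
     (\<forall>x y \<eta>. \<not> (\<eta> x \<and> \<not> \<eta> y) \<longrightarrow> p x y \<eta> = 0) \<and>
     (\<forall>x y \<eta>. 0 \<le> p x y \<eta> \<and> p x y \<eta> \<le> 1) \<and>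
     (\<forall>\<zeta>\<in>blocking_configs. (\<lambda>(x, y). p x y \<zeta>) summable_on UNIV)"

definition simple_rates :: "(int \<Rightarrow> real) \<Rightarrow> rates" where
  "simple_rates a x y \<eta> = a (y - x) * of_bool (\<eta> x) * (1 - of_bool (\<eta> y))"

definition exit_rate :: "rates \<Rightarrow> config \<Rightarrow> real" where
  "exit_rate p \<eta> = (\<Sum>\<^sub>\<infinity>(x, y)\<in>UNIV. p x y \<eta>)"

definition jump_rate :: "rates \<Rightarrow> config \<Rightarrow> config \<Rightarrow> real" where
  "jump_rate p \<eta> \<zeta> = (\<Sum>\<^sub>\<infinity>(x, y)\<in>{(x, y). exchange \<eta> x y = \<zeta>}. p x y \<eta>)"

text \<open>Transition probabilities of the embedded jump chain; a configuration with exit rate 0 is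
  absorbing.\<close>

definition jump_prob :: "rates \<Rightarrow> config \<Rightarrow> config \<Rightarrow> real" where
  "jump_prob p \<eta> \<zeta> =
     (if exit_rate p \<eta> = 0 then of_bool (\<zeta> = \<eta>) else jump_rate p \<eta> \<zeta> / exit_rate p \<eta>)"

text \<open>A path is the sequence of pairs (state visited, holding time in that state). Holding times
  are extended reals because the holding time in an absorbing configuration is infinite.\<close>

type_synonym path = "nat \<Rightarrow> config \<times> ennreal"

definition path_space :: "path measure" where
  "path_space = (\<Pi>\<^sub>M n\<in>UNIV. count_space blocking_configs \<Otimes>\<^sub>M borel)"

text \<open>\<open>M\<close> is the law of the jump chain with rates \<open>p\<close> and initial law \<open>\<mu>\<close>: the visited states form
  the discrete Markov chain with transition probabilities \<open>jump_prob p\<close>, and given the visited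
  states the holding times are independent, exponential with parameter the exit rate of the
  respective state. The finite-dimensional probabilities below determine \<open>M\<close>.\<close>

definition jump_chain_law :: "rates \<Rightarrow> config pmf \<Rightarrow> path measure \<Rightarrow> bool" where
  "jump_chain_law p \<mu> M \<longleftrightarrow>
     prob_space M \<and> sets M = sets path_space \<and>
     (\<forall>n \<eta> s. (\<forall>i\<le>n. \<eta> i \<in> blocking_configs \<and> 0 \<le> s i) \<longrightarrow>
        measure M {\<omega> \<in> space M. \<forall>i\<le>n. fst (\<omega> i) = \<eta> i \<and> ennreal (s i) < snd (\<omega> i)} =
          pmf \<mu> (\<eta> 0) * (\<Prod>i<n. jump_prob p (\<eta> i) (\<eta> (Suc i))) *
          (\<Prod>i\<le>n. exp (- exit_rate p (\<eta> i) * s i)))"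

text \<open>The state at time \<open>t\<close> of the minimal chain: the state being held at time \<open>t\<close>, and
  \<^const>\<open>None\<close> from the explosion time onwards.\<close>

definition state_at :: "path \<Rightarrow> real \<Rightarrow> config option" where
  "state_at \<omega> t =
     (if \<exists>n. ennreal t < (\<Sum>i\<le>n. snd (\<omega> i))
      then Some (fst (\<omega> (LEAST n. ennreal t < (\<Sum>i\<le>n. snd (\<omega> i)))))
      else None)"

text \<open>A blocking measure lives on a countable set, hence is a \<^typ>\<open>config pmf\<close>. Invariance requires
  the law at time \<open>t\<close> to have full mass \<open>1\<close>, so it excludes explosion almost surely.\<close>

definition blocking_measure :: "config pmf \<Rightarrow> bool" where
  "blocking_measure \<mu> \<longleftrightarrow> set_pmf \<mu> \<subseteq> blocking_configs"

definition blocking_invariant :: "rates \<Rightarrow> config pmf \<Rightarrow> bool" where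
  "blocking_invariant p \<mu> \<longleftrightarrow> blocking_measure \<mu> \<and>
     (\<exists>M. jump_chain_law p \<mu> M \<and>
        (\<forall>t\<ge>0. \<forall>\<zeta>. measure M {\<omega> \<in> space M. state_at \<omega> t = Some \<zeta>} = pmf \<mu> \<zeta>))"

end

theory Submission
  imports Defs
begin

text \<open>Order the blocking configurations of one level by
\<open>\<eta> \<preceq> \<zeta>\<close> if up to every site \<open>\<eta>\<close> has at most as many particles as \<open>\<zeta>\<close>; equivalently, the
\<open>i\<close>-th particle of \<open>\<eta>\<close> is not to the left of the \<open>i\<close>-th particle of \<open>\<zeta>\<close>. The hypotheses on \<open>a\<close> and \<open>abar\<close>
say that the process with rates \<open>a\<close> is pushed to the right at least as strongly as the one with
rates \<open>abar\<close>, so it should stay below it. Below a given configuration there are only finitely many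
others. Hence tightness of the stationary process with rates \<open>abar\<close> carries over to the process
with rates \<open>a\<close> started from the same law, and a limit of averaged laws is invariant.

The comparison is made on generators, without a joint process. Let \<open>R f(\<eta>)\<close> be the expectation of
\<open>f\<close> at an independent exponential time of mean 1 for the minimal chain started at \<open>\<eta>\<close>, counting 0
after an explosion. It is the least nonnegative solution of \<open>(1 + q) u = f + Q u\<close>. Put \<open>g = R f\<close> for
the rates \<open>a\<close> and \<open>g\<^sub>*(\<zeta>) = min {g(\<eta>) | \<eta> \<preceq> \<zeta>}\<close>. At a minimiser \<open>\<eta>\<close>, match the \<open>i\<close>-th
particles and the \<open>j\<close>-th holes of \<open>\<eta>\<close> and \<open>\<zeta>\<close>. For the jump of the \<open>i\<close>-th particle into the
\<open>j\<close>-th hole, lemma \<open>matched_jumps\<close> leaves three cases, and in each of them the contribution to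
\<open>Q g\<close> at \<open>\<eta>\<close> is at least the contribution to \<open>Qbar g\<^sub>*\<close> at \<open>\<zeta>\<close>. Therefore \<open>g\<^sub>*\<close> is a
supersolution for the rates \<open>abar\<close>, and minimality of the resolvent gives
\<open>Rbar f \<le> g\<^sub>* \<le> R f\<close> for decreasing \<open>f\<close> (\<open>resolvent_comparison\<close>).

Let \<open>\<mu>\<close> be invariant for \<open>abar\<close>. Then \<open>\<mu> Rbar = \<mu>\<close>, and iterating the comparison with indicators of
finite down-sets shows that the laws \<open>\<mu> R\<^sup>k\<close> are tight; with \<open>f = 1\<close> it shows that they have mass 1.
A cluster point \<open>\<nu>\<close> of their averages satisfies \<open>\<nu> R = \<nu>\<close> (\<open>invariant_row_exists\<close>).

The remaining work relates \<open>\<mu> R = \<mu>\<close> to invariance of \<open>\<mu>\<close> in time. The finite-dimensional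
distributions of the jump chain yield that the probability of being in \<open>\<zeta>\<close> at time \<open>t\<close> after
exactly \<open>k\<close> jumps is \<open>F\<^sub>k(t, \<zeta>)\<close>, where \<open>F\<close> solves the forward equations
(\<open>survival_arrival_eq_forward\<close>), and the Laplace transform at 1 of the sum of the \<open>F\<^sub>k\<close> is \<open>\<mu> R\<close>
(\<open>laplace_total_forward\<close>). Invariance in time thus implies \<open>\<mu> R = \<mu>\<close>. Conversely
\<open>\<nu> R = \<nu>\<close> implies \<open>\<nu> Q = \<nu> q\<close>; then the forward equations bound the sum of the \<open>F\<^sub>k\<close> by \<open>\<nu>\<close>, and the
Laplace transform shows that no mass is missing at almost every \<open>t\<close>. As the probability of no
explosion before \<open>t\<close> decreases with \<open>t\<close>, no mass is missing at any \<open>t\<close>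
(\<open>state_at_stationary\<close>). A path measure with the required distributions is built from a table of
independent jumps (\<open>jump_chain_law_exists\<close>).\<close>

section \<open>Sums as integrals over counting measures\<close>

lemma suminf_first: "(\<Sum>n. f n) = f 0 + (\<Sum>n. f (Suc n))" for f :: "nat \<Rightarrow> ennreal"
  using Extended_Nonnegative_Real.suminf_offset[of f 1] by (simp add: add.commute summableI)

lemma nn_integral_count_space_eq_infsum:
  fixes f :: "'a \<Rightarrow> real"
  assumes "f summable_on A" "\<And>x. x \<in> A \<Longrightarrow> 0 \<le> f x"
  shows "(\<integral>\<^sup>+x. ennreal (f x) \<partial>count_space A) = ennreal (infsum f A)"
proof -
  have "(\<lambda>x. norm (f x)) summable_on A"
    using assms by (simp cong: summable_on_cong)
  then have abs: "Infinite_Set_Sum.abs_summable_on f A"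
    by (rule abs_summable_equivalent[THEN iffD1])
  show ?thesis
    using nn_integral_conv_infsetsum[OF abs] assms(2) infsetsum_infsum[OF abs] by simp
qed

lemma nn_integral_count_space_le:
  fixes f :: "'a \<Rightarrow> ennreal"
  assumes "countable S" and bound: "\<And>F. finite F \<Longrightarrow> F \<subseteq> S \<Longrightarrow> sum f F \<le> B"
  shows "(\<integral>\<^sup>+x. f x \<partial>count_space S) \<le> B"
proof (cases "S = {}")
  case False
  define F where "F n = from_nat_into S ` {..<n}" for n
  have F: "finite (F n)" "F n \<subseteq> S" for n
    using from_nat_into[OF False] by (auto simp: F_def)
  have "(\<integral>\<^sup>+x. f x \<partial>count_space S) = (\<integral>\<^sup>+x. (SUP n. f x * indicator (F n) x) \<partial>count_space S)"
  proof (rule nn_integral_cong)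
    fix x assume "x \<in> space (count_space S)"
    then obtain i where "x = from_nat_into S i"
      using from_nat_into_surj[OF assms(1)] by force
    then have "x \<in> F (Suc i)" by (auto simp: F_def)
    then have "f x \<le> f x * indicator (F (Suc i)) x" by simp
    also have "\<dots> \<le> (SUP n. f x * indicator (F n) x)" by (rule SUP_upper) simp
    finally show "f x = (SUP n. f x * indicator (F n) x)"
      by (intro antisym SUP_least) (auto simp: indicator_def)
  qed
  also have "\<dots> = (SUP n. \<integral>\<^sup>+x. f x * indicator (F n) x \<partial>count_space S)"
    by (rule nn_integral_monotone_convergence_SUP)
      (auto simp: F_def incseq_def le_fun_def indicator_def image_iff intro: less_le_trans)
  also have "\<dots> \<le> B"
  proof (rule SUP_least)
    fix n
    have "(\<integral>\<^sup>+x. f x * indicator (F n) x \<partial>count_space S) = (\<Sum>x\<in>F n. f x * indicator (F n) x)"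
      using F[of n] by (intro nn_integral_count_space') auto
    also have "\<dots> = sum f (F n)" by (intro sum.cong) auto
    finally show "(\<integral>\<^sup>+x. f x * indicator (F n) x \<partial>count_space S) \<le> B"
      using bound[OF F] by simp
  qed
  finally show ?thesis .
qed (simp add: nn_integral_empty)

lemma sum_le_nn_integral_count_space:
  fixes f :: "'a \<Rightarrow> ennreal"
  assumes "finite F" "F \<subseteq> S"
  shows "sum f F \<le> (\<integral>\<^sup>+x. f x \<partial>count_space S)"
proof -
  have "sum f F = (\<integral>\<^sup>+x. f x * indicator F x \<partial>count_space S)"
    using assms by (subst nn_integral_count_space'[where A = F]) auto
  also have "\<dots> \<le> (\<integral>\<^sup>+x. f x \<partial>count_space S)"
    by (intro nn_integral_mono) (auto simp: indicator_def)
  finally show ?thesis .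
qed

lemma nn_integral_count_space_eq_imp_eq:
  fixes f g :: "'a \<Rightarrow> ennreal"
  assumes le: "\<And>x. x \<in> S \<Longrightarrow> f x \<le> g x"
    and eq: "(\<integral>\<^sup>+x. f x \<partial>count_space S) = (\<integral>\<^sup>+x. g x \<partial>count_space S)"
    and fin: "(\<integral>\<^sup>+x. g x \<partial>count_space S) \<noteq> \<top>" and x: "x \<in> S"
  shows "f x = g x"
proof -
  have "(\<integral>\<^sup>+x. g x - f x \<partial>count_space S) = 0"
    using eq fin le by (subst nn_integral_diff) (auto simp: AE_count_space)
  then have "AE x in count_space S. g x - f x = 0"
    by (subst (asm) nn_integral_0_iff_AE) auto
  then have "g x - f x = 0" using x by (simp add: AE_count_space)
  then have "g x \<le> f x"
    using nn_integral_ge_point[OF x, of g] fin by (auto simp: diff_eq_0_iff_ennreal top_unique)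
  then show ?thesis using le[OF x] by simp
qed

lemma borel_measurable_nn_integral_count_space:
  assumes "countable I" "\<And>i. i \<in> I \<Longrightarrow> f i \<in> borel_measurable N"
  shows "(\<lambda>x. \<integral>\<^sup>+i. f i x \<partial>count_space I) \<in> borel_measurable N"
proof -
  interpret sigma_finite_measure "count_space I"
    by (rule sigma_finite_measure_count_space_countable[OF assms(1)])
  have "(\<lambda>x. f (fst x) (snd x)) \<in> borel_measurable (count_space I \<Otimes>\<^sub>M N)"
    by (rule measurable_pair_measure_countable1) (use assms in auto)
  then have "(\<lambda>(x, i). f i x) \<in> borel_measurable (N \<Otimes>\<^sub>M count_space I)"
    by (subst measurable_pair_swap_iff) (simp add: case_prod_unfold)
  then show ?thesis by (rule borel_measurable_nn_integral)
qed

lemma nn_integral_restricted_law: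
  assumes [measurable]: "A \<in> sets M" "f \<in> measurable M N" "g \<in> borel_measurable N"
  shows "(\<integral>\<^sup>+x. g x \<partial>distr (density M (indicator A)) N f) = (\<integral>\<^sup>+\<omega>. g (f \<omega>) * indicator A \<omega> \<partial>M)"
  by (simp add: nn_integral_distr nn_integral_density mult.commute)

section \<open>Blocking configurations\<close>

notation blocking_configs ("\<X>")

definition left_count :: "config \<Rightarrow> int \<Rightarrow> nat" where
  "left_count \<eta> k = card {x. x \<le> k \<and> \<eta> x}"

definition right_holes :: "config \<Rightarrow> int \<Rightarrow> nat" where
  "right_holes \<eta> k = card {x. x > k \<and> \<not> \<eta> x}"

lemma blocking_level_finite:
  assumes "\<eta> \<in> blocking_level n"
  shows "finite {x. x \<le> k \<and> \<eta> x}" "finite {x. x > k \<and> \<not> \<eta> x}"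
proof -
  have "{x. x \<le> k \<and> \<eta> x} \<subseteq> {x. x \<le> n \<and> \<eta> x} \<union> {n..k}" by auto
  with assms show "finite {x. x \<le> k \<and> \<eta> x}"
    unfolding blocking_level_def by (auto intro: finite_subset)
  have "{x. x > k \<and> \<not> \<eta> x} \<subseteq> {x. x > n \<and> \<not> \<eta> x} \<union> {k..n}" by auto
  with assms show "finite {x. x > k \<and> \<not> \<eta> x}"
    unfolding blocking_level_def by (auto intro: finite_subset)
qed

text \<open>Both sides increase by 1 when \<open>k\<close> does: the site \<open>k + 1\<close> either adds a particle on the left or
removes a hole on the right. So within one level the number of holes beyond a site is determined
by the number of particles up to it, and statements on holes reduce to statements on particles.\<close>

lemma blocking_level_balance:
  assumes "\<eta> \<in> blocking_level n"
  shows "int (left_count \<eta> k) - int (right_holes \<eta> k) = k - n"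
proof -
  note fin = blocking_level_finite[OF assms]
  have step: "int (left_count \<eta> (k + 1)) - int (right_holes \<eta> (k + 1))
      = int (left_count \<eta> k) - int (right_holes \<eta> k) + 1" for k
  proof (cases "\<eta> (k + 1)")
    case True
    have "{x. x \<le> k + 1 \<and> \<eta> x} = insert (k + 1) {x. x \<le> k \<and> \<eta> x}"
      using True by auto
    moreover have "x > k + 1 \<and> \<not> \<eta> x \<longleftrightarrow> x > k \<and> \<not> \<eta> x" for x
      using True by (cases "x = k + 1") auto
    ultimately show ?thesis
      using fin by (simp add: left_count_def right_holes_def)
  next
    case False
    have "{x. x > k \<and> \<not> \<eta> x} = insert (k + 1) {x. x > k + 1 \<and> \<not> \<eta> x}"
      using False by auto
    moreover have "x \<le> k + 1 \<and> \<eta> x \<longleftrightarrow> x \<le> k \<and> \<eta> x" for x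
      using False by (cases "x = k + 1") auto
    ultimately show ?thesis
      using fin by (simp add: left_count_def right_holes_def)
  qed
  show ?thesis
  proof (induction k rule: int_induct[where k = n])
    case base
    then show ?case
      using assms by (simp add: blocking_level_def left_count_def right_holes_def)
  next
    case (step1 i)
    then show ?case using step[of i] by simp
  next
    case (step2 i)
    then show ?case using step[of "i - 1"] by simp
  qed
qed

lemma left_count_exchange:
  assumes "\<eta> \<in> blocking_level n" "\<eta> x" "\<not> \<eta> y"
  shows "left_count (exchange \<eta> x y) k + of_bool (x \<le> k) = left_count \<eta> k + of_bool (y \<le> k)"
proof -
  have eq: "{z. z \<le> k \<and> exchange \<eta> x y z}
      = ({z. z \<le> k \<and> \<eta> z} - {x}) \<union> (if y \<le> k then {y} else {})"
    using assms(2,3) by (auto simp: exchange_def)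
  have fin: "finite {z. z \<le> k \<and> \<eta> z}"
    using blocking_level_finite(1)[OF assms(1)] .
  have 1: "card (({z. z \<le> k \<and> \<eta> z} - {x}) \<union> (if y \<le> k then {y} else {}))
      = card ({z. z \<le> k \<and> \<eta> z} - {x}) + of_bool (y \<le> k)"
    using fin assms(3) by (auto simp: card_insert_if)
  have 2: "card ({z. z \<le> k \<and> \<eta> z} - {x}) + of_bool (x \<le> k) = card {z. z \<le> k \<and> \<eta> z}"
  proof (cases "x \<le> k")
    case True
    then have m: "x \<in> {z. z \<le> k \<and> \<eta> z}" using assms(2) by simp
    show ?thesis using card_Suc_Diff1[OF fin m] True by simp
  next
    case False
    then have "{z. z \<le> k \<and> \<eta> z} - {x} = {z. z \<le> k \<and> \<eta> z}" by auto
    then show ?thesis using False by simp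
  qed
  show ?thesis
    unfolding left_count_def eq using 1 2 by linarith
qed

lemma exchange_blocking_level:
  assumes "\<eta> \<in> blocking_level n" "\<eta> x" "\<not> \<eta> y"
  shows "exchange \<eta> x y \<in> blocking_level n"
proof -
  note fin = blocking_level_finite[OF assms(1)]
  have eq: "{z. z > n \<and> \<not> exchange \<eta> x y z}
      = ({z. z > n \<and> \<not> \<eta> z} - {y}) \<union> (if x > n then {x} else {})"
    using assms(2,3) by (auto simp: exchange_def)
  have 1: "card (({z. z > n \<and> \<not> \<eta> z} - {y}) \<union> (if x > n then {x} else {}))
      = card ({z. z > n \<and> \<not> \<eta> z} - {y}) + of_bool (x > n)"
    using fin(2)[of n] assms(2) by (auto simp: card_insert_if)
  have 2: "card ({z. z > n \<and> \<not> \<eta> z} - {y}) + of_bool (y > n) = card {z. z > n \<and> \<not> \<eta> z}"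
  proof (cases "y > n")
    case True
    then have m: "y \<in> {z. z > n \<and> \<not> \<eta> z}" using assms(3) by simp
    show ?thesis using card_Suc_Diff1[OF fin(2) m] True by simp
  next
    case False
    then have "{z. z > n \<and> \<not> \<eta> z} - {y} = {z. z > n \<and> \<not> \<eta> z}" by auto
    then show ?thesis using False by simp
  qed
  have 3: "left_count \<eta> n = right_holes \<eta> n"
    using assms(1) by (simp add: blocking_level_def left_count_def right_holes_def)
  have "right_holes (exchange \<eta> x y) n + of_bool (y > n) = right_holes \<eta> n + of_bool (x > n)"
    unfolding right_holes_def eq using 1 2 by linarith
  then have "left_count (exchange \<eta> x y) n = right_holes (exchange \<eta> x y) n"
    using left_count_exchange[OF assms, of n] 3 by (cases "x \<le> n"; cases "y \<le> n") simp_all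
  then have 4: "card {z. z \<le> n \<and> exchange \<eta> x y z} = card {z. z > n \<and> \<not> exchange \<eta> x y z}"
    unfolding left_count_def right_holes_def .
  have "{z. z \<le> n \<and> exchange \<eta> x y z} \<subseteq> insert y {z. z \<le> n \<and> \<eta> z}"
    using assms(2) by (auto simp: exchange_def split: if_splits)
  then have "finite {z. z \<le> n \<and> exchange \<eta> x y z}"
    by (rule finite_subset) (simp add: fin(1))
  moreover have "finite {z. z > n \<and> \<not> exchange \<eta> x y z}"
    unfolding eq by (intro finite_UnI finite_Diff fin(2)) auto
  ultimately show ?thesis
    unfolding blocking_level_def using 4 by blast
qed

lemma exchange_blocking_configs:
  "\<eta> \<in> \<X> \<Longrightarrow> \<eta> x \<Longrightarrow> \<not> \<eta> y \<Longrightarrow> exchange \<eta> x y \<in> blocking_configs"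
  unfolding blocking_configs_def using exchange_blocking_level by blast

lemma countable_blocking_configs: "countable blocking_configs"
proof -
  have "countable (blocking_level n)" for n
  proof -
    let ?f = "\<lambda>\<eta>. ({x. x \<le> n \<and> \<eta> x}, {x. x > n \<and> \<not> \<eta> x})"
    have "inj_on ?f (blocking_level n)"
    proof (rule inj_onI, rule ext)
      fix \<eta> \<zeta> :: config and x assume "?f \<eta> = ?f \<zeta>"
      then have "x \<in> {x. x \<le> n \<and> \<eta> x} \<longleftrightarrow> x \<in> {x. x \<le> n \<and> \<zeta> x}"
        "x \<in> {x. x > n \<and> \<not> \<eta> x} \<longleftrightarrow> x \<in> {x. x > n \<and> \<not> \<zeta> x}" by blast+
      then show "\<eta> x = \<zeta> x" by (cases "x \<le> n") simp_all
    qed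
    moreover have "?f ` blocking_level n \<subseteq> Collect finite \<times> Collect finite"
      by (auto simp: blocking_level_def)
    then have "countable (?f ` blocking_level n)"
      by (rule countable_subset) (intro countable_SIGMA countable_Collect_finite)
    ultimately show ?thesis using countable_image_inj_on by blast
  qed
  then show ?thesis by (simp add: blocking_configs_def)
qed

text \<open>Within one level, comparing particle counts up to every site is the same as comparing hole counts
beyond every site, by \<open>blocking_level_balance\<close>.\<close>

definition further_right :: "config \<Rightarrow> config \<Rightarrow> bool" (infix "\<preceq>" 50) where
  "\<eta> \<preceq> \<zeta> \<longleftrightarrow> (\<exists>n. \<eta> \<in> blocking_level n \<and> \<zeta> \<in> blocking_level n) \<and>
     (\<forall>k. left_count \<eta> k \<le> left_count \<zeta> k)"

lemma further_right_refl: "\<eta> \<in> \<X> \<Longrightarrow> \<eta> \<preceq> \<eta>"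
  by (auto simp: further_right_def blocking_configs_def)

lemma further_right_trans:
  assumes "\<eta> \<preceq> \<zeta>" "\<zeta> \<preceq> \<xi>"
  shows "\<eta> \<preceq> \<xi>"
proof -
  obtain n m where n: "\<eta> \<in> blocking_level n" "\<zeta> \<in> blocking_level n"
    and m: "\<zeta> \<in> blocking_level m" "\<xi> \<in> blocking_level m"
    using assms by (auto simp: further_right_def)
  have "n = m"
    using blocking_level_balance[OF n(2), of 0] blocking_level_balance[OF m(1), of 0] by simp
  moreover have "left_count \<eta> k \<le> left_count \<xi> k" for k
    using assms unfolding further_right_def by (blast intro: order_trans)
  ultimately show ?thesis
    using n m by (auto simp: further_right_def)
qed

lemma further_right_blocking:
  "\<eta> \<preceq> \<zeta> \<Longrightarrow> \<eta> \<in> blocking_configs" "\<eta> \<preceq> \<zeta> \<Longrightarrow> \<zeta> \<in> blocking_configs"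
  by (auto simp: further_right_def blocking_configs_def)

text \<open>To the left of its first particle and to the right of its last hole, \<open>\<zeta>\<close> leaves no freedom to a
configuration \<open>\<eta> \<preceq> \<zeta>\<close>: it has no particles on the left part, and no holes on the right part by
\<open>blocking_level_balance\<close>. This finiteness turns the comparison into tightness, and it makes the
minimum in \<open>resolvent_comparison\<close> an attained one.\<close>

lemma finite_further_right:
  "finite {\<eta>. \<eta> \<preceq> \<zeta>}"
proof (cases "\<exists>\<eta>. \<eta> \<preceq> \<zeta>")
  case True
  then obtain n where n: "\<zeta> \<in> blocking_level n" by (auto simp: further_right_def)
  note fin = blocking_level_finite[OF n]
  obtain l where l: "\<And>x. x \<le> l \<Longrightarrow> \<not> \<zeta> x"
  proof
    let ?I = "insert 0 {x. x \<le> 0 \<and> \<zeta> x}"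
    fix x assume x: "x \<le> Min ?I - 1"
    have "finite ?I" using fin(1)[of 0] by simp
    then have "Min ?I \<le> y" if "y \<in> ?I" for y using that by (rule Min_le)
    from this[of 0] this[of x] x show "\<not> \<zeta> x" by auto
  qed
  obtain u where u: "\<And>x. x > u \<Longrightarrow> \<zeta> x"
  proof
    fix x assume "x > Max (insert 0 {x. x > 0 \<and> \<not> \<zeta> x})"
    then have "x > 0" "x \<notin> {x. x > 0 \<and> \<not> \<zeta> x}"
      using fin(2)[of 0] by auto
    then show "\<zeta> x" by simp
  qed
  have "{\<eta>. \<eta> \<preceq> \<zeta>} \<subseteq> (\<lambda>A x. x \<in> A \<or> x > u) ` Pow {l..u}"
  proof
    fix \<eta> assume "\<eta> \<in> {\<eta>. \<eta> \<preceq> \<zeta>}"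
    then obtain m where m: "\<eta> \<in> blocking_level m" "\<zeta> \<in> blocking_level m"
      and le: "\<And>k. left_count \<eta> k \<le> left_count \<zeta> k" by (auto simp: further_right_def)
    note fin' = blocking_level_finite[OF m(1)]
    have e: "{x. x \<le> l \<and> \<zeta> x} = {}" using l by blast
    have "left_count \<zeta> l = 0" unfolding left_count_def e by simp
    then have "left_count \<eta> l = 0" using le[of l] by simp
    then have 1: "\<not> \<eta> x" if "x \<le> l" for x
      using fin'(1)[of l] that by (auto simp: left_count_def)
    have e': "{x. x > u \<and> \<not> \<zeta> x} = {}" using u by blast
    have "right_holes \<zeta> u = 0" unfolding right_holes_def e' by simp
    then have "right_holes \<eta> u = 0"
      using le[of u] blocking_level_balance[OF m(1), of u] blocking_level_balance[OF m(2), of u]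
      by simp
    then have 2: "\<eta> x" if "x > u" for x
      using fin'(2)[of u] that by (auto simp: right_holes_def)
    show "\<eta> \<in> (\<lambda>A x. x \<in> A \<or> x > u) ` Pow {l..u}"
    proof
      show "\<eta> = (\<lambda>x. x \<in> {x. l \<le> x \<and> x \<le> u \<and> \<eta> x} \<or> x > u)"
      proof
        fix x show "\<eta> x = (x \<in> {x. l \<le> x \<and> x \<le> u \<and> \<eta> x} \<or> x > u)"
          using 1[of x] 2[of x] by (cases "x \<le> l"; cases "x > u") auto
      qed
    qed auto
  qed
  then show ?thesis by (rule finite_subset) auto
qed simp

lemma nn_integral_pmf_blocking:
  assumes "blocking_measure \<mu>"
  shows "(\<integral>\<^sup>+\<zeta>. ennreal (pmf \<mu> \<zeta>) \<partial>count_space \<X>) = 1"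
proof -
  have "(\<integral>\<^sup>+\<zeta>. ennreal (pmf \<mu> \<zeta>) \<partial>count_space \<X>)
      = (\<integral>\<^sup>+\<zeta>. ennreal (pmf \<mu> \<zeta>) \<partial>count_space UNIV)"
    using assms by (intro nn_integral_count_space_eq) (auto simp: blocking_measure_def set_pmf_iff)
  then show ?thesis by (simp add: nn_integral_pmf_eq_1)
qed

section \<open>Matching particles with particles and holes with holes\<close>

text \<open>The map sends the \<open>i\<close>-th element of \<open>B\<close> to the \<open>i\<close>-th element of \<open>A\<close>; the rank of \<open>x\<close> in \<open>C\<close> is
\<open>card (C \<inter> {..x})\<close>. The last property expresses that a site \<open>k\<close> at which both sets have the same
number of elements separates the same ranks in \<open>A\<close> and in \<open>B\<close>.\<close>

lemma order_matching:
  fixes A B :: "int set"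
  assumes fin: "\<And>k. finite (A \<inter> {..k})" "\<And>k. finite (B \<inter> {..k})"
    and inf: "infinite A" "infinite B"
    and le: "\<And>k. card (A \<inter> {..k}) \<le> card (B \<inter> {..k})"
  obtains \<pi> where "bij_betw \<pi> B A" "\<And>y. y \<in> B \<Longrightarrow> y \<le> \<pi> y"
    "\<And>k y. y \<in> B \<Longrightarrow> card (A \<inter> {..k}) = card (B \<inter> {..k}) \<Longrightarrow> \<pi> y \<le> k \<longleftrightarrow> y \<le> k"
proof -
  have rank_le_iff: "card (C \<inter> {..x}) \<le> card (C \<inter> {..k}) \<longleftrightarrow> x \<le> k"
    if "x \<in> C" and f: "\<And>k. finite (C \<inter> {..k})" for C :: "int set" and x k
  proof (cases "x \<le> k")
    case True
    then have "C \<inter> {..x} \<subseteq> C \<inter> {..k}" by auto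
    then show ?thesis using f card_mono True by blast
  next
    case False
    then have "C \<inter> {..k} \<subset> C \<inter> {..x}" using that(1) by auto
    then show ?thesis using f psubset_card_mono False by (metis leD)
  qed
  have bij: "bij_betw (\<lambda>x. card (C \<inter> {..x})) C {1..}"
    if f: "\<And>k. finite (C \<inter> {..k})" and i: "infinite C" for C :: "int set"
  proof (rule bij_betw_imageI)
    show "inj_on (\<lambda>x. card (C \<inter> {..x})) C"
    proof (rule inj_onI)
      fix x y assume "x \<in> C" "y \<in> C" "card (C \<inter> {..x}) = card (C \<inter> {..y})"
      then show "x = y"
        using rank_le_iff[OF \<open>x \<in> C\<close> f, of y] rank_le_iff[OF \<open>y \<in> C\<close> f, of x] by simp
    qed
    show "(\<lambda>x. card (C \<inter> {..x})) ` C = {1..}"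
    proof (intro equalityI subsetI)
      fix m assume "m \<in> (\<lambda>x. card (C \<inter> {..x})) ` C"
      then obtain x where "x \<in> C" "m = card (C \<inter> {..x})" by blast
      then show "m \<in> {1..}" using f[of x] by (auto simp: Suc_le_eq card_gt_0_iff)
    next
      fix m :: nat assume m: "m \<in> {1..}"
      obtain F where F: "F \<subseteq> C" "finite F" "card F = m"
        using infinite_arbitrarily_large[OF i] by blast
      have "F \<noteq> {}" using F m by auto
      have "F \<subseteq> C \<inter> {..Max F}" using F by auto
      then have ge: "m \<le> card (C \<inter> {..Max F})" using F(3) card_mono[OF f] by blast
      \<comment> \<open>The element of rank \<open>m\<close> is the least one whose rank is at least
        \<open>m\<close>; ranks increase by 1.\<close>
      define X where "X = {x \<in> C \<inter> {..Max F}. m \<le> card (C \<inter> {..x})}"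
      have finX: "finite X" unfolding X_def by (rule finite_subset[OF _ f[of "Max F"]]) auto
      have "Max F \<in> C" using F(1,2) \<open>F \<noteq> {}\<close> Max_in by blast
      then have "Max F \<in> X" using ge by (simp add: X_def)
      define x where "x = Min X"
      have x: "x \<in> X" unfolding x_def using finX \<open>Max F \<in> X\<close> by (intro Min_in) auto
      then have xC: "x \<in> C" "m \<le> card (C \<inter> {..x})" "x \<le> Max F" by (auto simp: X_def)
      have eq: "C \<inter> {..x} = insert x (C \<inter> {..x - 1})" using xC by auto
      have c: "card (C \<inter> {..x}) = Suc (card (C \<inter> {..x - 1}))"
        unfolding eq using f[of "x - 1"] by simp
      have "card (C \<inter> {..x - 1}) < m"
      proof (rule ccontr)
        assume "\<not> card (C \<inter> {..x - 1}) < m"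
        then have a: "m \<le> card (C \<inter> {..x - 1})" by simp
        then have ne: "C \<inter> {..x - 1} \<noteq> {}" using m by auto
        define z where "z = Max (C \<inter> {..x - 1})"
        have z: "z \<in> C \<inter> {..x - 1}" unfolding z_def using ne f by (intro Max_in) auto
        have "C \<inter> {..z} = C \<inter> {..x - 1}"
          using z f[of "x - 1"] by (auto simp: z_def)
        then have "z \<in> X" using a z xC by (auto simp: X_def)
        then have "x \<le> z" unfolding x_def using finX by simp
        then show False using z by auto
      qed
      then have "m = card (C \<inter> {..x})" using c xC by simp
      then show "m \<in> (\<lambda>x. card (C \<inter> {..x})) ` C" using xC by blast
    qed
  qed
  define \<pi> where "\<pi> = inv_into A (\<lambda>x. card (A \<inter> {..x})) \<circ> (\<lambda>y. card (B \<inter> {..y}))"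
  have b: "bij_betw \<pi> B A"
    unfolding \<pi>_def
    by (rule bij_betw_trans[OF bij[OF fin(2) inf(2)] bij_betw_inv_into[OF bij[OF fin(1) inf(1)]]])
  have rank: "card (A \<inter> {..\<pi> y}) = card (B \<inter> {..y})" if "y \<in> B" for y
  proof -
    have "card (B \<inter> {..y}) \<in> (\<lambda>x. card (A \<inter> {..x})) ` A"
      using bij[OF fin(1) inf(1)] bij[OF fin(2) inf(2)] that unfolding bij_betw_def by blast
    then show ?thesis
      unfolding \<pi>_def comp_def by (rule f_inv_into_f[where f = "\<lambda>x. card (A \<inter> {..x})"])
  qed
  have mem: "\<pi> y \<in> A" if "y \<in> B" for y using b that bij_betwE by blast
  show thesis
  proof
    show "bij_betw \<pi> B A" by fact
    show "y \<le> \<pi> y" if "y \<in> B" for y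
      using rank_le_iff[OF that fin(2), of "\<pi> y"] rank[OF that] le[of "\<pi> y"] by simp
    show "\<pi> y \<le> k \<longleftrightarrow> y \<le> k" if "y \<in> B" "card (A \<inter> {..k}) = card (B \<inter> {..k})" for k y
      using rank_le_iff[OF that(1) fin(2), of k] rank_le_iff[OF mem[OF that(1)] fin(1), of k]
        rank[OF that(1)] that(2) by simp
  qed
qed

lemma left_count_alt: "left_count \<eta> k = card (Collect \<eta> \<inter> {..k})"
  unfolding left_count_def by (rule arg_cong[where f = card]) auto

text \<open>Holes are matched by applying \<open>order_matching\<close> to their mirror images: the holes of a blocking
configuration are bounded above, so they are ranked from the right.\<close>

lemma particle_hole_matching:
  assumes "\<eta> \<preceq> \<zeta>"
  obtains \<pi> \<sigma> where
    "bij_betw \<pi> {y. \<zeta> y} {x. \<eta> x}" "bij_betw \<sigma> {w. \<not> \<zeta> w} {v. \<not> \<eta> v}"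
    "\<And>y. \<zeta> y \<Longrightarrow> y \<le> \<pi> y" "\<And>w. \<not> \<zeta> w \<Longrightarrow> \<sigma> w \<le> w"
    "\<And>k y. \<zeta> y \<Longrightarrow> left_count \<eta> k = left_count \<zeta> k \<Longrightarrow> \<pi> y \<le> k \<longleftrightarrow> y \<le> k"
    "\<And>k w. \<not> \<zeta> w \<Longrightarrow> left_count \<eta> k = left_count \<zeta> k \<Longrightarrow> \<sigma> w \<le> k \<longleftrightarrow> w \<le> k"
proof -
  obtain n where n: "\<eta> \<in> blocking_level n" "\<zeta> \<in> blocking_level n"
    and le: "\<And>k. left_count \<eta> k \<le> left_count \<zeta> k" using assms by (auto simp: further_right_def)
  have fin: "finite (Collect \<xi> \<inter> {..k})" "finite (uminus ` {v. \<not> \<xi> v} \<inter> {..k})"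
    and inf: "infinite (Collect \<xi>)" "infinite (uminus ` {v. \<not> \<xi> v})"
    and holes: "card (uminus ` {v. \<not> \<xi> v} \<inter> {..k}) = right_holes \<xi> (- k - 1)"
    if "\<xi> \<in> blocking_level n" for \<xi> k
  proof -
    note f = blocking_level_finite[OF that]
    have "Collect \<xi> \<inter> {..k} = {x. x \<le> k \<and> \<xi> x}" for k by auto
    then show "finite (Collect \<xi> \<inter> {..k})" using f(1) by simp
    have e: "uminus ` {v. \<not> \<xi> v} \<inter> {..k} = uminus ` {x. x > - k - 1 \<and> \<not> \<xi> x}" for k by auto
    show "finite (uminus ` {v. \<not> \<xi> v} \<inter> {..k})" unfolding e using f(2) by simp
    show "card (uminus ` {v. \<not> \<xi> v} \<inter> {..k}) = right_holes \<xi> (- k - 1)"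
      unfolding e right_holes_def by (rule card_image) simp
    have "Collect \<xi> \<supseteq> {0<..} - {x. x > 0 \<and> \<not> \<xi> x}" by auto
    moreover have "infinite ({0<..} - {x. x > (0::int) \<and> \<not> \<xi> x})"
      using f(2)[of 0] infinite_Ioi[of "0::int"] Diff_infinite_finite by blast
    ultimately show "infinite (Collect \<xi>)" using finite_subset by blast
    have "{v. \<not> \<xi> v} \<supseteq> {..0} - {x. x \<le> 0 \<and> \<xi> x}" by auto
    moreover have "infinite ({..0} - {x. x \<le> (0::int) \<and> \<xi> x})"
      using f(1)[of 0] infinite_Iic[of "0::int"] Diff_infinite_finite by blast
    ultimately have "infinite {v. \<not> \<xi> v}" using finite_subset by blast
    then show "infinite (uminus ` {v. \<not> \<xi> v})" by (simp add: finite_image_iff)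
  qed
  have le2: "card (Collect \<eta> \<inter> {..k}) \<le> card (Collect \<zeta> \<inter> {..k})" for k
    using le[of k] by (simp add: left_count_alt)
  obtain \<pi> where \<pi>: "bij_betw \<pi> (Collect \<zeta>) (Collect \<eta>)" "\<And>y. y \<in> Collect \<zeta> \<Longrightarrow> y \<le> \<pi> y"
    "\<And>k y. y \<in> Collect \<zeta> \<Longrightarrow> card (Collect \<eta> \<inter> {..k}) = card (Collect \<zeta> \<inter> {..k}) \<Longrightarrow> \<pi> y \<le> k \<longleftrightarrow> y \<le> k"
    by (rule order_matching[OF fin(1)[OF n(1)] fin(1)[OF n(2)] inf(1)[OF n(1)] inf(1)[OF n(2)] le2]) blast
  have bal: "int (right_holes \<eta> k) - int (right_holes \<zeta> k) = int (left_count \<eta> k) - int (left_count \<zeta> k)" for k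
    using blocking_level_balance[OF n(1), of k] blocking_level_balance[OF n(2), of k] by simp
  let ?A = "uminus ` {v. \<not> \<eta> v}" and ?B = "uminus ` {v. \<not> \<zeta> v}"
  have le': "card (?A \<inter> {..k}) \<le> card (?B \<inter> {..k})" for k
    unfolding holes[OF n(1)] holes[OF n(2)] using bal[of "- k - 1"] le[of "- k - 1"] by simp
  obtain \<tau> where \<tau>: "bij_betw \<tau> ?B ?A" "\<And>y. y \<in> ?B \<Longrightarrow> y \<le> \<tau> y"
    "\<And>k y. y \<in> ?B \<Longrightarrow> card (?A \<inter> {..k}) = card (?B \<inter> {..k}) \<Longrightarrow> \<tau> y \<le> k \<longleftrightarrow> y \<le> k"
    by (rule order_matching[OF fin(2)[OF n(1)] fin(2)[OF n(2)] inf(2)[OF n(1)] inf(2)[OF n(2)] le']) blast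
  have um: "bij_betw uminus C (uminus ` C)" for C :: "int set"
    by (rule bij_betw_imageI) auto
  have um': "bij_betw uminus (uminus ` C) C" for C :: "int set"
    using um[of "uminus ` C"] by (simp add: image_image)
  have \<sigma>: "bij_betw (uminus \<circ> (\<tau> \<circ> uminus)) {w. \<not> \<zeta> w} {v. \<not> \<eta> v}"
    by (rule bij_betw_trans[OF bij_betw_trans[OF um \<tau>(1)] um'])
  show thesis
  proof (rule that[where \<pi> = \<pi>, OF _ \<sigma>])
    show "(uminus \<circ> (\<tau> \<circ> uminus)) w \<le> w" if "\<not> \<zeta> w" for w
      using \<tau>(2)[of "- w"] that by auto
    show "(uminus \<circ> (\<tau> \<circ> uminus)) w \<le> k \<longleftrightarrow> w \<le> k"
      if "\<not> \<zeta> w" "left_count \<eta> k = left_count \<zeta> k" for k w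
    proof -
      have "card (?A \<inter> {..- k - 1}) = card (?B \<inter> {..- k - 1})"
        unfolding holes[OF n(1)] holes[OF n(2)] using bal[of k] that(2) by simp
      then have "\<tau> (- w) \<le> - k - 1 \<longleftrightarrow> - w \<le> - k - 1"
        using \<tau>(3)[of "- w" "- k - 1"] that(1) by auto
      then show ?thesis by auto
    qed
    show "bij_betw \<pi> {y. \<zeta> y} {x. \<eta> x}" using \<pi>(1) .
    show "y \<le> \<pi> y" if "\<zeta> y" for y using \<pi>(2) that by blast
    show "\<pi> y \<le> k \<longleftrightarrow> y \<le> k" if "\<zeta> y" "left_count \<eta> k = left_count \<zeta> k" for k y
      using \<pi>(3)[of y k] that by (simp only: mem_Collect_eq left_count_alt)
  qed
qed

text \<open>The combinatorial heart of the comparison. Here \<open>x\<close> and \<open>y\<close> are particles of equal rank, \<open>v\<close> and \<open>w\<close>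
holes of equal rank, and both particles jump. A jump of \<open>\<eta>\<close> alone can destroy \<open>\<eta> \<preceq> \<zeta>\<close> only if
it is a jump to the left across a site \<open>k\<close> where the counts agree; as matched particles and holes lie
on the same sides of \<open>k\<close>, the jump of \<open>\<zeta>\<close> then also goes to the left across \<open>k\<close>, and it is not longer
because \<open>v \<le> w < y \<le> x\<close>. Symmetrically, a jump of \<open>\<zeta>\<close> alone can destroy the order only if it goes to
the right across such a \<open>k\<close>, and then the jump of \<open>\<eta>\<close> goes to the right and is not longer. In these
two cases the order is kept if both jumps are made.\<close>

lemma matched_jumps:
  assumes le: "\<eta> \<preceq> \<zeta>" and occ: "\<eta> x" "\<not> \<eta> v" "\<zeta> y" "\<not> \<zeta> w"
    and yx: "y \<le> x" and vw: "v \<le> w"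
    and xk: "\<And>k. left_count \<eta> k = left_count \<zeta> k \<Longrightarrow> x \<le> k \<longleftrightarrow> y \<le> k"
    and vk: "\<And>k. left_count \<eta> k = left_count \<zeta> k \<Longrightarrow> v \<le> k \<longleftrightarrow> w \<le> k"
  obtains
    (neither) "exchange \<eta> x v \<preceq> \<zeta>" "\<eta> \<preceq> exchange \<zeta> y w"
  | (left) "v - x \<le> w - y" "w - y < 0" "\<eta> \<preceq> exchange \<zeta> y w" "exchange \<eta> x v \<preceq> exchange \<zeta> y w"
  | (right) "0 < v - x" "v - x \<le> w - y" "exchange \<eta> x v \<preceq> \<zeta>" "exchange \<eta> x v \<preceq> exchange \<zeta> y w"
proof -
  obtain n where n: "\<eta> \<in> blocking_level n" "\<zeta> \<in> blocking_level n"
    and J: "\<And>k. left_count \<eta> k \<le> left_count \<zeta> k" using le by (auto simp: further_right_def)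
  have n': "exchange \<eta> x v \<in> blocking_level n" "exchange \<zeta> y w \<in> blocking_level n"
    using n occ by (auto intro: exchange_blocking_level)
  note cnt = left_count_exchange[OF n(1) occ(1,2)] left_count_exchange[OF n(2) occ(3,4)]
  have 1: "exchange \<eta> x v \<preceq> \<zeta>"
    if "\<And>k. left_count \<eta> k = left_count \<zeta> k \<Longrightarrow> v \<le> k \<Longrightarrow> x \<le> k"
  proof -
    have "left_count (exchange \<eta> x v) k \<le> left_count \<zeta> k" for k
      using cnt(1)[of k] J[of k] that[of k] by (cases "left_count \<eta> k = left_count \<zeta> k"; cases "v \<le> k"; cases "x \<le> k") simp_all
    then show ?thesis using n n' by (auto simp: further_right_def)
  qed
  have 2: "\<eta> \<preceq> exchange \<zeta> y w"
    if "\<And>k. left_count \<eta> k = left_count \<zeta> k \<Longrightarrow> y \<le> k \<Longrightarrow> w \<le> k"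
  proof -
    have "left_count \<eta> k \<le> left_count (exchange \<zeta> y w) k" for k
      using cnt(2)[of k] J[of k] that[of k] by (cases "left_count \<eta> k = left_count \<zeta> k"; cases "y \<le> k"; cases "w \<le> k") simp_all
    then show ?thesis using n n' by (auto simp: further_right_def)
  qed
  have 3: "exchange \<eta> x v \<preceq> exchange \<zeta> y w"
    if "x \<le> v \<or> w \<le> y"
  proof -
    have "left_count (exchange \<eta> x v) k \<le> left_count (exchange \<zeta> y w) k" for k
      using cnt[of k] J[of k] that xk[of k] vk[of k] yx vw
      by (cases "left_count \<eta> k = left_count \<zeta> k"; cases "v \<le> k"; cases "x \<le> k";
          cases "y \<le> k"; cases "w \<le> k") simp_all
    then show ?thesis using n' by (auto simp: further_right_def)
  qed
  consider (a) k where "left_count \<eta> k = left_count \<zeta> k" "v \<le> k" "\<not> x \<le> k"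
    | (b) k where "left_count \<eta> k = left_count \<zeta> k" "y \<le> k" "\<not> w \<le> k"
    | (c) "\<And>k. left_count \<eta> k = left_count \<zeta> k \<Longrightarrow> v \<le> k \<Longrightarrow> x \<le> k"
      "\<And>k. left_count \<eta> k = left_count \<zeta> k \<Longrightarrow> y \<le> k \<Longrightarrow> w \<le> k"
    by blast
  then show thesis
  proof cases
    case a
    then have "w \<le> k" "\<not> y \<le> k" using xk[OF a(1)] vk[OF a(1)] by auto
    then show thesis using left 2 3 yx vw by fastforce
  next
    case b
    then have "x \<le> k" "\<not> v \<le> k" using xk[OF b(1)] vk[OF b(1)] by auto
    then show thesis using right 1 3 yx vw by fastforce
  next
    case c
    then show thesis using neither 1 2 by blast
  qed
qed

section \<open>Total jump rates\<close>

abbreviation jump_rates :: "rates \<Rightarrow> config \<Rightarrow> config \<Rightarrow> ennreal" where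
  "jump_rates p \<eta> \<zeta> \<equiv> ennreal (jump_rate p \<eta> \<zeta>)"

abbreviation exit_rates :: "rates \<Rightarrow> config \<Rightarrow> ennreal" where
  "exit_rates p \<eta> \<equiv> ennreal (exit_rate p \<eta>)"

context
  fixes p :: rates and \<eta> :: config
  assumes p: "exclusion_rates p" and \<eta>: "\<eta> \<in> blocking_configs"
begin

lemma rate_zero: "\<not> (\<eta> x \<and> \<not> \<eta> y) \<Longrightarrow> p x y \<eta> = 0" and rate_nonneg: "0 \<le> p x y \<eta>"
  using p by (auto simp: exclusion_rates_def)

lemma rates_summable: "(\<lambda>(x, y). p x y \<eta>) summable_on A"
  using p \<eta> summable_on_subset_banach[of "\<lambda>(x, y). p x y \<eta>" UNIV A]
  by (auto simp: exclusion_rates_def)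

lemma exit_rate_nonneg: "0 \<le> exit_rate p \<eta>"
  unfolding exit_rate_def by (intro infsum_nonneg) (auto simp: rate_nonneg)

lemma jump_rate_nonneg: "0 \<le> jump_rate p \<eta> \<zeta>"
  unfolding jump_rate_def by (intro infsum_nonneg) (auto simp: rate_nonneg)

text \<open>This passes between the generator as a sum over pairs of sites, in which particles and holes can be
matched, and as a sum over target configurations, in which it is a matrix.\<close>

lemma nn_integral_jump_rate:
  "(\<integral>\<^sup>+\<zeta>. jump_rates p \<eta> \<zeta> * \<phi> \<zeta> \<partial>count_space \<X>)
    = (\<integral>\<^sup>+(x, y). ennreal (p x y \<eta>) * \<phi> (exchange \<eta> x y) \<partial>count_space UNIV)"
proof -
  let ?e = "\<lambda>z. exchange \<eta> (fst z) (snd z)" and ?p = "\<lambda>z. p (fst z) (snd z) \<eta>"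
  have j: "jump_rates p \<eta> \<zeta> = (\<integral>\<^sup>+z. ennreal (?p z) * indicator {\<zeta>} (?e z) \<partial>count_space UNIV)" for \<zeta>
  proof -
    have "jump_rates p \<eta> \<zeta> = (\<integral>\<^sup>+z. ennreal (?p z) \<partial>count_space {z. ?e z = \<zeta>})"
      unfolding jump_rate_def
      using nn_integral_count_space_eq_infsum[OF rates_summable, of "{(x, y). exchange \<eta> x y = \<zeta>}"]
      by (simp add: case_prod_unfold rate_nonneg)
    also have "\<dots> = (\<integral>\<^sup>+z. ennreal (?p z) * indicator {z. ?e z = \<zeta>} z \<partial>count_space UNIV)"
      by (subst nn_integral_count_space_indicator) (simp_all add: NO_MATCH_def)
    also have "\<dots> = (\<integral>\<^sup>+z. ennreal (?p z) * indicator {\<zeta>} (?e z) \<partial>count_space UNIV)"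
      by (intro nn_integral_cong) (simp add: indicator_def)
    finally show ?thesis .
  qed
  have in_S: "?e z \<in> blocking_configs" if "?p z \<noteq> 0" for z
    using rate_zero[of "fst z" "snd z"] that exchange_blocking_configs[OF \<eta>] by blast
  have "(\<integral>\<^sup>+\<zeta>. jump_rates p \<eta> \<zeta> * \<phi> \<zeta> \<partial>count_space \<X>)
      = (\<integral>\<^sup>+\<zeta>. (\<integral>\<^sup>+z. ennreal (?p z) * indicator {\<zeta>} (?e z) * \<phi> \<zeta> \<partial>count_space UNIV) \<partial>count_space \<X>)"
    unfolding j by (intro nn_integral_cong) (simp add: nn_integral_multc)
  also have "\<dots> = (\<integral>\<^sup>+z. (\<integral>\<^sup>+\<zeta>. ennreal (?p z) * indicator {\<zeta>} (?e z) * \<phi> \<zeta> \<partial>count_space \<X>) \<partial>count_space UNIV)"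
    by (rule nn_integral_count_space_nn_integral[symmetric]) (auto simp: countable_blocking_configs)
  also have "\<dots> = (\<integral>\<^sup>+z. ennreal (?p z) * \<phi> (?e z) \<partial>count_space UNIV)"
  proof (rule nn_integral_cong)
    fix z
    show "(\<integral>\<^sup>+\<zeta>. ennreal (?p z) * indicator {\<zeta>} (?e z) * \<phi> \<zeta> \<partial>count_space \<X>)
        = ennreal (?p z) * \<phi> (?e z)"
    proof (cases "?p z = 0")
      case False
      have "(\<integral>\<^sup>+\<zeta>. ennreal (?p z) * indicator {\<zeta>} (?e z) * \<phi> \<zeta> \<partial>count_space \<X>)
          = (\<integral>\<^sup>+\<zeta>. ennreal (?p z) * \<phi> (?e z) * indicator {?e z} \<zeta> \<partial>count_space \<X>)"
        by (intro nn_integral_cong) (auto simp: indicator_def)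
      also have "\<dots> = ennreal (?p z) * \<phi> (?e z) * emeasure (count_space \<X>) {?e z}"
        using in_S[OF False] by (intro nn_integral_cmult_indicator) auto
      finally show ?thesis using in_S[OF False] by simp
    qed simp
  qed
  finally show ?thesis by (simp add: case_prod_unfold)
qed

lemma nn_integral_jump_rate_total:
  "(\<integral>\<^sup>+\<zeta>. jump_rates p \<eta> \<zeta> \<partial>count_space \<X>) = ennreal (exit_rate p \<eta>)"
  using nn_integral_jump_rate[of "\<lambda>_. 1"] nn_integral_count_space_eq_infsum[OF rates_summable, of UNIV]
  by (simp add: exit_rate_def case_prod_unfold rate_nonneg)

end

lemma nn_integral_simple_rates:
  "(\<integral>\<^sup>+(x, y). ennreal (simple_rates a x y \<eta>) * \<phi> (exchange \<eta> x y) \<partial>count_space UNIV)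
    = (\<integral>\<^sup>+(x, y). ennreal (a (y - x)) * \<phi> (exchange \<eta> x y) \<partial>count_space ({x. \<eta> x} \<times> {y. \<not> \<eta> y}))"
  by (subst (2) nn_integral_count_space_indicator)
    (auto intro!: nn_integral_cong simp: simple_rates_def indicator_def split: prod.splits)

section \<open>The resolvent of a minimal jump chain\<close>

locale rate_matrix =
  fixes S :: "'s set" and Q :: "'s \<Rightarrow> 's \<Rightarrow> ennreal" and q :: "'s \<Rightarrow> ennreal"
  assumes countable_S: "countable S"
    and total_rate: "\<And>\<eta>. \<eta> \<in> S \<Longrightarrow> (\<integral>\<^sup>+\<zeta>. Q \<eta> \<zeta> \<partial>count_space S) = q \<eta>"
    and finite_rate: "\<And>\<eta>. \<eta> \<in> S \<Longrightarrow> q \<eta> < \<top>"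
begin

definition act :: "('s \<Rightarrow> ennreal) \<Rightarrow> 's \<Rightarrow> ennreal" where
  "act f \<eta> = (\<integral>\<^sup>+\<zeta>. Q \<eta> \<zeta> * f \<zeta> \<partial>count_space S)"

text \<open>With \<open>D = 1 + q\<close> this is the operator \<open>Q D\<^sup>-\<^sup>1\<close>, so that the resolvent below is the Neumann series
\<open>D\<^sup>-\<^sup>1 (1 + Q D\<^sup>-\<^sup>1 + (Q D\<^sup>-\<^sup>1)\<^sup>2 + \<dots>)\<close>.\<close>

definition discounted_act :: "('s \<Rightarrow> ennreal) \<Rightarrow> 's \<Rightarrow> ennreal" where
  "discounted_act f = act (\<lambda>\<zeta>. f \<zeta> / (1 + q \<zeta>))"

text \<open>The expectation of \<open>f\<close> at an exponential time of mean 1, split according to the number \<open>n\<close> of jumps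
made before that time.\<close>

definition resolvent :: "('s \<Rightarrow> ennreal) \<Rightarrow> 's \<Rightarrow> ennreal" where
  "resolvent f \<eta> = (\<Sum>n. (discounted_act ^^ n) f \<eta>) / (1 + q \<eta>)"

text \<open>The row vector \<open>\<mu> D\<^sup>-\<^sup>1 (Q D\<^sup>-\<^sup>1)\<^sup>n\<close>: the law at an exponential time of mean 1, on the event that
exactly \<open>n\<close> jumps have occurred, of the chain with initial law \<open>\<mu>\<close>.\<close>

primrec occupation :: "('s \<Rightarrow> ennreal) \<Rightarrow> nat \<Rightarrow> 's \<Rightarrow> ennreal" where
  "occupation \<mu> 0 \<zeta> = \<mu> \<zeta> / (1 + q \<zeta>)"
| "occupation \<mu> (Suc n) \<zeta> = (\<integral>\<^sup>+\<xi>. occupation \<mu> n \<xi> * Q \<xi> \<zeta> \<partial>count_space S) / (1 + q \<zeta>)"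

definition total_occupation :: "('s \<Rightarrow> ennreal) \<Rightarrow> 's \<Rightarrow> ennreal" where
  "total_occupation \<mu> \<zeta> = (\<Sum>n. occupation \<mu> n \<zeta>)"

lemma denominator: "\<eta> \<in> S \<Longrightarrow> 1 + q \<eta> \<noteq> 0" "\<eta> \<in> S \<Longrightarrow> 1 + q \<eta> \<noteq> \<top>" "\<eta> \<in> S \<Longrightarrow> 1 + q \<eta> < \<top>"
  using finite_rate[of \<eta>] by auto

lemma cancel_denominator: "\<eta> \<in> S \<Longrightarrow> x / (1 + q \<eta>) * (1 + q \<eta>) = x"
  using denominator by (simp add: ennreal_divide_times ennreal_mult_divide_eq)

lemma divide_denominator_le: "\<eta> \<in> S \<Longrightarrow> x \<le> (1 + q \<eta>) * y \<Longrightarrow> x / (1 + q \<eta>) \<le> y"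
  using denominator[of \<eta>] by (auto intro!: divide_le_posI_ennreal simp: mult.commute zero_less_iff_neq_zero)

lemma act_cong: "(\<And>\<zeta>. \<zeta> \<in> S \<Longrightarrow> f \<zeta> = g \<zeta>) \<Longrightarrow> act f \<eta> = act g \<eta>"
  unfolding act_def by (intro nn_integral_cong) simp

lemma act_mono: "(\<And>\<zeta>. \<zeta> \<in> S \<Longrightarrow> f \<zeta> \<le> g \<zeta>) \<Longrightarrow> act f \<eta> \<le> act g \<eta>"
  unfolding act_def by (intro nn_integral_mono mult_left_mono) simp_all

lemma act_suminf: "act (\<lambda>\<zeta>. \<Sum>n. f n \<zeta>) \<eta> = (\<Sum>n. act (f n) \<eta>)"
  unfolding act_def by (subst nn_integral_suminf[symmetric]) simp_all

lemma act_sum: "act (\<lambda>\<zeta>. \<Sum>n\<in>A. f n \<zeta>) \<eta> = (\<Sum>n\<in>A. act (f n) \<eta>)"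
  unfolding act_def by (subst nn_integral_sum[symmetric]) (simp_all add: sum_distrib_left)

lemma resolvent_equation:
  assumes "\<eta> \<in> S"
  shows "(1 + q \<eta>) * resolvent f \<eta> = f \<eta> + act (resolvent f) \<eta>"
proof -
  have "(1 + q \<eta>) * resolvent f \<eta> = (\<Sum>n. (discounted_act ^^ n) f \<eta>)"
    using cancel_denominator[OF assms] by (simp add: resolvent_def mult.commute)
  also have "\<dots> = f \<eta> + (\<Sum>n. discounted_act ((discounted_act ^^ n) f) \<eta>)"
    by (subst suminf_first) simp
  also have "(\<Sum>n. discounted_act ((discounted_act ^^ n) f) \<eta>)
      = act (\<lambda>\<zeta>. \<Sum>n. (discounted_act ^^ n) f \<zeta> / (1 + q \<zeta>)) \<eta>"
    unfolding discounted_act_def[of "(discounted_act ^^ n) f" for n] by (rule act_suminf[symmetric])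
  also have "\<dots> = act (resolvent f) \<eta>"
    by (rule act_cong) (simp add: resolvent_def ennreal_suminf_divide)
  finally show ?thesis .
qed

text \<open>Each partial sum of the Neumann series is dominated by a supersolution, by induction on its length.
This is the maximum principle for the minimal chain and holds even if the chain explodes.\<close>

lemma resolvent_minimal:
  assumes super: "\<And>\<eta>. \<eta> \<in> S \<Longrightarrow> f \<eta> + act G \<eta> \<le> (1 + q \<eta>) * G \<eta>" and "\<eta> \<in> S"
  shows "resolvent f \<eta> \<le> G \<eta>"
proof -
  have partial: "(\<Sum>n<N. (discounted_act ^^ n) f \<eta>) \<le> (1 + q \<eta>) * G \<eta>" if "\<eta> \<in> S" for N \<eta>
    using that
  proof (induction N arbitrary: \<eta>)
    case (Suc N)
    have "(\<Sum>n<Suc N. (discounted_act ^^ n) f \<eta>)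
        = f \<eta> + (\<Sum>n<N. discounted_act ((discounted_act ^^ n) f) \<eta>)"
      by (simp add: sum.lessThan_Suc_shift del: sum.lessThan_Suc)
    also have "(\<Sum>n<N. discounted_act ((discounted_act ^^ n) f) \<eta>)
        = act (\<lambda>\<zeta>. \<Sum>n<N. (discounted_act ^^ n) f \<zeta> / (1 + q \<zeta>)) \<eta>"
      unfolding discounted_act_def[of "(discounted_act ^^ n) f" for n] by (rule act_sum[symmetric])
    also have "\<dots> \<le> act G \<eta>"
    proof (rule act_mono)
      fix \<zeta> assume \<zeta>: "\<zeta> \<in> S"
      have "(\<Sum>n<N. (discounted_act ^^ n) f \<zeta> / (1 + q \<zeta>)) = (\<Sum>n<N. (discounted_act ^^ n) f \<zeta>) / (1 + q \<zeta>)"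
        by (simp add: divide_ennreal_def sum_distrib_right)
      also have "\<dots> \<le> G \<zeta>" by (rule divide_denominator_le[OF \<zeta> Suc.IH[OF \<zeta>]])
      finally show "(\<Sum>n<N. (discounted_act ^^ n) f \<zeta> / (1 + q \<zeta>)) \<le> G \<zeta>" .
    qed
    finally show ?case using super[OF Suc.prems] by (meson add_left_mono order_trans)
  qed simp
  have "(\<Sum>n. (discounted_act ^^ n) f \<eta>) \<le> (1 + q \<eta>) * G \<eta>"
    by (rule suminf_le_const) (auto intro: partial assms summableI)
  then show ?thesis unfolding resolvent_def by (rule divide_denominator_le[OF assms(2)])
qed

lemma resolvent_le_1:
  assumes "\<And>\<eta>. \<eta> \<in> S \<Longrightarrow> f \<eta> \<le> 1" "\<eta> \<in> S"
  shows "resolvent f \<eta> \<le> 1"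
  using assms by (intro resolvent_minimal) (auto simp: act_def total_rate intro!: add_right_mono)

text \<open>Duality: \<open>total_occupation\<close> is the action of the resolvent on row vectors.\<close>

lemma occupation_resolvent:
  "(\<integral>\<^sup>+\<zeta>. total_occupation \<mu> \<zeta> * f \<zeta> \<partial>count_space S) = (\<integral>\<^sup>+\<eta>. \<mu> \<eta> * resolvent f \<eta> \<partial>count_space S)"
proof -
  have step: "(\<integral>\<^sup>+\<zeta>. occupation \<mu> (Suc n) \<zeta> * g \<zeta> \<partial>count_space S)
      = (\<integral>\<^sup>+\<zeta>. occupation \<mu> n \<zeta> * discounted_act g \<zeta> \<partial>count_space S)" for n g
  proof -
    have "(\<integral>\<^sup>+\<zeta>. occupation \<mu> (Suc n) \<zeta> * g \<zeta> \<partial>count_space S)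
        = (\<integral>\<^sup>+\<zeta>. (\<integral>\<^sup>+\<xi>. occupation \<mu> n \<xi> * (Q \<xi> \<zeta> * (g \<zeta> / (1 + q \<zeta>))) \<partial>count_space S) \<partial>count_space S)"
    proof (rule nn_integral_cong)
      fix \<zeta>
      have "occupation \<mu> (Suc n) \<zeta> * g \<zeta>
          = (\<integral>\<^sup>+\<xi>. occupation \<mu> n \<xi> * Q \<xi> \<zeta> \<partial>count_space S) * (g \<zeta> / (1 + q \<zeta>))"
        by (simp add: divide_ennreal_def mult_ac)
      then show "occupation \<mu> (Suc n) \<zeta> * g \<zeta>
          = (\<integral>\<^sup>+\<xi>. occupation \<mu> n \<xi> * (Q \<xi> \<zeta> * (g \<zeta> / (1 + q \<zeta>))) \<partial>count_space S)"
        by (simp add: nn_integral_multc[symmetric] mult.assoc)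
    qed
    also have "\<dots> = (\<integral>\<^sup>+\<xi>. (\<integral>\<^sup>+\<zeta>. occupation \<mu> n \<xi> * (Q \<xi> \<zeta> * (g \<zeta> / (1 + q \<zeta>))) \<partial>count_space S) \<partial>count_space S)"
      by (rule nn_integral_count_space_nn_integral) (simp_all add: countable_S)
    also have "\<dots> = (\<integral>\<^sup>+\<zeta>. occupation \<mu> n \<zeta> * discounted_act g \<zeta> \<partial>count_space S)"
      by (intro nn_integral_cong) (simp add: discounted_act_def act_def nn_integral_cmult)
    finally show ?thesis .
  qed
  have iter: "(\<integral>\<^sup>+\<zeta>. occupation \<mu> n \<zeta> * f \<zeta> \<partial>count_space S)
      = (\<integral>\<^sup>+\<eta>. \<mu> \<eta> * ((discounted_act ^^ n) f \<eta> / (1 + q \<eta>)) \<partial>count_space S)" for n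
  proof (induction n arbitrary: f)
    case 0
    show ?case by (intro nn_integral_cong) (simp add: divide_ennreal_def mult_ac)
  next
    case (Suc n)
    show ?case unfolding step Suc.IH by (simp only: funpow_Suc_right comp_def)
  qed
  have "(\<integral>\<^sup>+\<zeta>. total_occupation \<mu> \<zeta> * f \<zeta> \<partial>count_space S)
      = (\<Sum>n. \<integral>\<^sup>+\<zeta>. occupation \<mu> n \<zeta> * f \<zeta> \<partial>count_space S)"
    unfolding total_occupation_def
    by (subst nn_integral_suminf[symmetric]) simp_all
  also have "\<dots> = (\<integral>\<^sup>+\<eta>. (\<Sum>n. \<mu> \<eta> * ((discounted_act ^^ n) f \<eta> / (1 + q \<eta>))) \<partial>count_space S)"
    unfolding iter by (rule nn_integral_suminf[symmetric]) simp
  also have "\<dots> = (\<integral>\<^sup>+\<eta>. \<mu> \<eta> * resolvent f \<eta> \<partial>count_space S)"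
    by (intro nn_integral_cong) (simp add: resolvent_def ennreal_suminf_divide)
  finally show ?thesis .
qed

lemma total_occupation_equation:
  assumes "\<zeta> \<in> S"
  shows "total_occupation \<mu> \<zeta> * (1 + q \<zeta>) = \<mu> \<zeta> + (\<integral>\<^sup>+\<xi>. total_occupation \<mu> \<xi> * Q \<xi> \<zeta> \<partial>count_space S)"
proof -
  have "total_occupation \<mu> \<zeta> * (1 + q \<zeta>) = (\<Sum>n. occupation \<mu> n \<zeta> * (1 + q \<zeta>))"
    unfolding total_occupation_def by simp
  also have "\<dots> = \<mu> \<zeta> + (\<Sum>n. \<integral>\<^sup>+\<xi>. occupation \<mu> n \<xi> * Q \<xi> \<zeta> \<partial>count_space S)"
    by (subst suminf_first) (simp add: cancel_denominator[OF assms])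
  also have "(\<Sum>n. \<integral>\<^sup>+\<xi>. occupation \<mu> n \<xi> * Q \<xi> \<zeta> \<partial>count_space S)
      = (\<integral>\<^sup>+\<xi>. total_occupation \<mu> \<xi> * Q \<xi> \<zeta> \<partial>count_space S)"
    unfolding total_occupation_def by (subst nn_integral_suminf[symmetric]) simp_all
  finally show ?thesis .
qed

lemma total_occupation_eq_resolvent:
  assumes "\<zeta> \<in> S"
  shows "total_occupation \<mu> \<zeta> = (\<integral>\<^sup>+\<eta>. \<mu> \<eta> * resolvent (indicator {\<zeta>}) \<eta> \<partial>count_space S)"
proof -
  have "(\<integral>\<^sup>+\<xi>. total_occupation \<mu> \<xi> * indicator {\<zeta>} \<xi> \<partial>count_space S) = total_occupation \<mu> \<zeta>"
    using assms by (subst nn_integral_count_space'[where A = "{\<zeta>}"]) auto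
  then show ?thesis using occupation_resolvent[of \<mu> "indicator {\<zeta>}"] by simp
qed

lemma total_occupation_pow:
  "(\<integral>\<^sup>+\<zeta>. (total_occupation ^^ k) \<mu> \<zeta> * f \<zeta> \<partial>count_space S)
    = (\<integral>\<^sup>+\<eta>. \<mu> \<eta> * (resolvent ^^ k) f \<eta> \<partial>count_space S)"
proof (induction k arbitrary: f)
  case (Suc k)
  have "(\<integral>\<^sup>+\<zeta>. (total_occupation ^^ Suc k) \<mu> \<zeta> * f \<zeta> \<partial>count_space S)
      = (\<integral>\<^sup>+\<zeta>. (total_occupation ^^ k) \<mu> \<zeta> * resolvent f \<zeta> \<partial>count_space S)"
    by (simp add: occupation_resolvent)
  also have "\<dots> = (\<integral>\<^sup>+\<eta>. \<mu> \<eta> * (resolvent ^^ Suc k) f \<eta> \<partial>count_space S)"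
    unfolding Suc.IH by (simp add: funpow_swap1)
  finally show ?case .
qed simp

lemma resolvent_pow_le_1:
  assumes "\<And>\<eta>. \<eta> \<in> S \<Longrightarrow> f \<eta> \<le> 1" "\<eta> \<in> S"
  shows "(resolvent ^^ k) f \<eta> \<le> 1"
  using assms by (induction k arbitrary: \<eta>) (auto intro: resolvent_le_1)

lemma occupation_cong:
  assumes "\<And>\<zeta>. \<zeta> \<in> S \<Longrightarrow> \<mu> \<zeta> = \<nu> \<zeta>" "\<zeta> \<in> S"
  shows "total_occupation \<mu> \<zeta> = total_occupation \<nu> \<zeta>"
  unfolding total_occupation_eq_resolvent[OF assms(2)]
  using assms(1) by (intro nn_integral_cong) simp

lemma resolvent_pow_invariant:
  assumes "\<And>\<zeta>. \<zeta> \<in> S \<Longrightarrow> total_occupation \<mu> \<zeta> = \<mu> \<zeta>"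
  shows "(\<integral>\<^sup>+\<eta>. \<mu> \<eta> * (resolvent ^^ k) f \<eta> \<partial>count_space S) = (\<integral>\<^sup>+\<eta>. \<mu> \<eta> * f \<eta> \<partial>count_space S)"
proof (induction k)
  case (Suc k)
  have "(\<integral>\<^sup>+\<eta>. \<mu> \<eta> * (resolvent ^^ Suc k) f \<eta> \<partial>count_space S)
      = (\<integral>\<^sup>+\<eta>. total_occupation \<mu> \<eta> * (resolvent ^^ k) f \<eta> \<partial>count_space S)"
    by (simp add: occupation_resolvent)
  also have "\<dots> = (\<integral>\<^sup>+\<eta>. \<mu> \<eta> * (resolvent ^^ k) f \<eta> \<partial>count_space S)"
    by (intro nn_integral_cong) (simp add: assms)
  finally show ?case using Suc.IH by simp
qed simp

end

section \<open>Comparison of two exclusion processes\<close>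

lemma rate_matrix_jump_rate:
  assumes "exclusion_rates p"
  shows "rate_matrix \<X> (jump_rates p) (exit_rates p)"
  by standard (use assms in \<open>auto simp: countable_blocking_configs nn_integral_jump_rate_total\<close>)

definition rates_resolvent :: "rates \<Rightarrow> (config \<Rightarrow> ennreal) \<Rightarrow> config \<Rightarrow> ennreal" where
  "rates_resolvent p = rate_matrix.resolvent \<X>
     (jump_rates p) (exit_rates p)"

definition rates_occupation :: "rates \<Rightarrow> (config \<Rightarrow> ennreal) \<Rightarrow> config \<Rightarrow> ennreal" where
  "rates_occupation p = rate_matrix.total_occupation \<X>
     (jump_rates p) (exit_rates p)"

text \<open>This is \<open>b (G' - g) \<le> a (g' - g)\<close> without subtraction, as the values are extended nonnegative reals.
In the first case the left side is at most 0 and the right side at least 0. In the other two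
\<open>G' - g \<le> g' - g\<close>; the larger weight multiplies \<open>G' - g \<le> 0\<close> in the second case and \<open>g' - g \<ge> 0\<close> in the
third. The cases are those of \<open>matched_jumps\<close>.\<close>

lemma weighted_comparison:
  fixes a b g g' G G' :: ennreal
  assumes "g' \<ge> g \<and> G' \<le> g \<or> a \<le> b \<and> G' \<le> g \<and> G' \<le> g' \<or> b \<le> a \<and> g \<le> g' \<and> G' \<le> g'"
  shows "b * G' + a * g \<le> a * g' + b * g"
proof -
  consider "g' \<ge> g" "G' \<le> g" | d where "b = a + d" "G' \<le> g" "G' \<le> g'"
    | d where "a = b + d" "g \<le> g'" "G' \<le> g'"
    using assms le_iff_add by metis
  then show ?thesis
  proof cases
    case 1
    then have "b * G' + a * g \<le> b * g + a * g'" by (intro add_mono mult_left_mono) auto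
    then show ?thesis by (simp add: add.commute)
  next
    case 2
    then have "a * G' + d * G' + a * g \<le> a * g' + d * g + a * g"
      by (intro add_mono mult_left_mono) auto
    then show ?thesis using 2 by (simp add: distrib_right add_ac)
  next
    case 3
    then have "b * G' + (b * g + d * g) \<le> b * g' + (b * g + d * g')"
      by (intro add_mono mult_left_mono) auto
    then show ?thesis using 3 by (simp add: distrib_right add_ac)
  qed
qed

text \<open>The minimum \<open>G\<close> of the resolvent for \<open>a\<close> over all \<open>\<eta> \<preceq> \<zeta>\<close> is shown to be a supersolution for \<open>abar\<close>,
so \<open>resolvent_minimal\<close> applies. At a minimiser \<open>\<eta>\<close>, where \<open>G \<zeta> = g \<eta>\<close>, a jump of \<open>\<eta>\<close> that stays below
\<open>\<zeta>\<close> cannot decrease \<open>g\<close>, and a jump of \<open>\<zeta>\<close> that stays above \<open>\<eta>\<close> cannot increase \<open>G\<close>. So only jumps that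
would destroy the order have to be compensated by the matched jump of the other configuration.\<close>

lemma resolvent_comparison:
  fixes a abar :: "int \<Rightarrow> real" and f fbar :: "config \<Rightarrow> ennreal"
  assumes ex: "exclusion_rates (simple_rates a)" "exclusion_rates (simple_rates abar)"
    and right: "\<And>x y. 0 < x \<Longrightarrow> x \<le> y \<Longrightarrow> a x \<ge> abar y"
    and left: "\<And>x y. y \<le> x \<Longrightarrow> x < 0 \<Longrightarrow> a y \<le> abar x"
    and le1: "\<And>\<eta>. \<eta> \<in> \<X> \<Longrightarrow> f \<eta> \<le> 1"
    and dom: "\<And>\<eta> \<zeta>. \<eta> \<preceq> \<zeta> \<Longrightarrow> fbar \<zeta> \<le> f \<eta>"
    and le: "\<eta> \<preceq> \<zeta>"
  shows "rates_resolvent (simple_rates abar) fbar \<zeta> \<le> rates_resolvent (simple_rates a) f \<eta>"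
proof -
  interpret R: rate_matrix \<X>
    "jump_rates (simple_rates a)" "exit_rates (simple_rates a)"
    by (rule rate_matrix_jump_rate[OF ex(1)])
  interpret B: rate_matrix \<X>
    "jump_rates (simple_rates abar)" "exit_rates (simple_rates abar)"
    by (rule rate_matrix_jump_rate[OF ex(2)])
  define g where "g = R.resolvent f"
  define G where "G \<zeta> = (INF \<eta>\<in>{\<eta>. \<eta> \<preceq> \<zeta>}. g \<eta>)" for \<zeta>
  have G_le: "G \<zeta> \<le> g \<eta>" if "\<eta> \<preceq> \<zeta>" for \<eta> \<zeta>
    unfolding G_def using that by (intro INF_lower) simp
  have super: "fbar \<zeta> + B.act G \<zeta> \<le> (1 + ennreal (exit_rate (simple_rates abar) \<zeta>)) * G \<zeta>"
    if \<zeta>: "\<zeta> \<in> blocking_configs" for \<zeta>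
  proof -
    have "G \<zeta> \<in> g ` {\<eta>. \<eta> \<preceq> \<zeta>}"
      unfolding G_def using finite_further_right[of \<zeta>] further_right_refl[OF \<zeta>]
      by (subst cInf_eq_Min) (auto intro!: Min_in)
    then obtain \<eta> where \<eta>\<zeta>: "\<eta> \<preceq> \<zeta>" and G: "G \<zeta> = g \<eta>" by auto
    have \<eta>: "\<eta> \<in> blocking_configs" using further_right_blocking(1)[OF \<eta>\<zeta>] .
    have min: "g \<eta> \<le> g \<eta>'" if "\<eta>' \<preceq> \<zeta>" for \<eta>' using G_le[OF that] G by simp
    obtain \<pi> \<sigma> where bij: "bij_betw \<pi> {y. \<zeta> y} {x. \<eta> x}" "bij_betw \<sigma> {w. \<not> \<zeta> w} {v. \<not> \<eta> v}"
      and ord: "\<And>y. \<zeta> y \<Longrightarrow> y \<le> \<pi> y" "\<And>w. \<not> \<zeta> w \<Longrightarrow> \<sigma> w \<le> w"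
      and side: "\<And>k y. \<zeta> y \<Longrightarrow> left_count \<eta> k = left_count \<zeta> k \<Longrightarrow> \<pi> y \<le> k \<longleftrightarrow> y \<le> k"
        "\<And>k w. \<not> \<zeta> w \<Longrightarrow> left_count \<eta> k = left_count \<zeta> k \<Longrightarrow> \<sigma> w \<le> k \<longleftrightarrow> w \<le> k"
      by (rule particle_hole_matching[OF \<eta>\<zeta>]) (rule that; assumption)
    let ?I = "{y. \<zeta> y} \<times> {w. \<not> \<zeta> w}"
    have matched: "(\<integral>\<^sup>+\<xi>. ennreal (jump_rate (simple_rates a) \<eta> \<xi>) * \<phi> \<xi> \<partial>count_space \<X>)
        = (\<integral>\<^sup>+(y, w). ennreal (a (\<sigma> w - \<pi> y)) * \<phi> (exchange \<eta> (\<pi> y) (\<sigma> w)) \<partial>count_space ?I)" for \<phi>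
      unfolding nn_integral_jump_rate[OF ex(1) \<eta>] nn_integral_simple_rates
      by (subst nn_integral_bij_count_space[OF bij_betw_map_prod[OF bij], symmetric])
        (simp add: case_prod_unfold)
    have bars: "(\<integral>\<^sup>+\<xi>. ennreal (jump_rate (simple_rates abar) \<zeta> \<xi>) * \<phi> \<xi> \<partial>count_space \<X>)
        = (\<integral>\<^sup>+(y, w). ennreal (abar (w - y)) * \<phi> (exchange \<zeta> y w) \<partial>count_space ?I)" for \<phi>
      unfolding nn_integral_jump_rate[OF ex(2) \<zeta>] nn_integral_simple_rates ..
    have "ennreal (abar (w - y)) * G (exchange \<zeta> y w) + ennreal (a (\<sigma> w - \<pi> y)) * g \<eta>
        \<le> ennreal (a (\<sigma> w - \<pi> y)) * g (exchange \<eta> (\<pi> y) (\<sigma> w)) + ennreal (abar (w - y)) * g \<eta>"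
      if yw: "\<zeta> y" "\<not> \<zeta> w" for y w
    proof (rule weighted_comparison)
      have occ: "\<eta> (\<pi> y)" "\<not> \<eta> (\<sigma> w)" using bij yw by (auto dest!: bij_betwE)
      show "g \<eta> \<le> g (exchange \<eta> (\<pi> y) (\<sigma> w)) \<and> G (exchange \<zeta> y w) \<le> g \<eta>
        \<or> ennreal (a (\<sigma> w - \<pi> y)) \<le> ennreal (abar (w - y)) \<and> G (exchange \<zeta> y w) \<le> g \<eta>
            \<and> G (exchange \<zeta> y w) \<le> g (exchange \<eta> (\<pi> y) (\<sigma> w))
        \<or> ennreal (abar (w - y)) \<le> ennreal (a (\<sigma> w - \<pi> y)) \<and> g \<eta> \<le> g (exchange \<eta> (\<pi> y) (\<sigma> w))
            \<and> G (exchange \<zeta> y w) \<le> g (exchange \<eta> (\<pi> y) (\<sigma> w))"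
        by (rule matched_jumps[OF \<eta>\<zeta> occ yw ord(1)[OF yw(1)] ord(2)[OF yw(2)] side(1)[OF yw(1)] side(2)[OF yw(2)]])
          (blast intro: G_le min ennreal_leI[OF right] ennreal_leI[OF left])+
    qed
    then have "(\<integral>\<^sup>+(y, w). ennreal (abar (w - y)) * G (exchange \<zeta> y w) + ennreal (a (\<sigma> w - \<pi> y)) * g \<eta> \<partial>count_space ?I)
        \<le> (\<integral>\<^sup>+(y, w). ennreal (a (\<sigma> w - \<pi> y)) * g (exchange \<eta> (\<pi> y) (\<sigma> w)) + ennreal (abar (w - y)) * g \<eta> \<partial>count_space ?I)"
      by (intro nn_integral_mono) auto
    then have sum: "B.act G \<zeta> + ennreal (exit_rate (simple_rates a) \<eta>) * g \<eta>
        \<le> R.act g \<eta> + ennreal (exit_rate (simple_rates abar) \<zeta>) * g \<eta>"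
      using matched[of g] bars[of G] matched[of "\<lambda>_. 1"] bars[of "\<lambda>_. 1"]
      by (simp add: R.act_def B.act_def case_prod_unfold nn_integral_add nn_integral_multc
          R.total_rate[OF \<eta>] B.total_rate[OF \<zeta>])
    have "fbar \<zeta> + (B.act G \<zeta> + ennreal (exit_rate (simple_rates a) \<eta>) * g \<eta>)
        \<le> f \<eta> + (R.act g \<eta> + ennreal (exit_rate (simple_rates abar) \<zeta>) * g \<eta>)"
      by (intro add_mono dom \<eta>\<zeta> sum)
    also have "\<dots> = (1 + ennreal (exit_rate (simple_rates a) \<eta>)) * g \<eta> + ennreal (exit_rate (simple_rates abar) \<zeta>) * g \<eta>"
      using R.resolvent_equation[OF \<eta>, of f] by (simp add: g_def add.assoc)
    \<comment> \<open>The term \<open>q(\<eta>) g(\<eta>)\<close> is finite and appears on both sides, so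
      it cancels.\<close>
    finally have "ennreal (exit_rate (simple_rates a) \<eta>) * g \<eta> + (fbar \<zeta> + B.act G \<zeta>)
        \<le> ennreal (exit_rate (simple_rates a) \<eta>) * g \<eta> + (1 + ennreal (exit_rate (simple_rates abar) \<zeta>)) * g \<eta>"
      by (simp add: distrib_right add_ac)
    moreover have "g \<eta> \<le> 1" unfolding g_def by (rule R.resolvent_le_1[OF le1 \<eta>])
    then have "g \<eta> < \<top>" by (rule le_less_trans) simp
    then have "ennreal (exit_rate (simple_rates a) \<eta>) * g \<eta> \<noteq> \<top>"
      by (auto simp: ennreal_mult_eq_top_iff)
    ultimately show ?thesis unfolding G by (simp add: ennreal_add_left_cancel_le)
  qed
  have "B.resolvent fbar \<zeta> \<le> G \<zeta>"
    by (rule B.resolvent_minimal[OF super further_right_blocking(2)[OF le]])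
  also have "\<dots> \<le> g \<eta>" by (rule G_le[OF le])
  finally show ?thesis unfolding g_def rates_resolvent_def .
qed

section \<open>Invariant distributions of the resolvent\<close>

text \<open>A Krylov--Bogolyubov argument: a cluster point \<open>\<nu>\<close> of the averages of \<open>\<mu> R\<^sup>k\<close>, in the compact space
of functions into \<open>[0, 1]\<close>, is a probability by tightness and satisfies \<open>\<nu> R \<le> \<nu>\<close> by approximation
with finite sums. Since no mass is lost along the iteration, \<open>R 1 = 1\<close> on the support of \<open>\<nu>\<close>, so
both sides of this inequality have mass 1.\<close>

theorem (in rate_matrix) invariant_row_exists:
  fixes \<mu> :: "'s \<Rightarrow> ennreal"
  assumes mass: "\<And>k. (\<integral>\<^sup>+\<zeta>. (total_occupation ^^ k) \<mu> \<zeta> \<partial>count_space S) = 1"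
    and tight: "\<And>e. 0 < e \<Longrightarrow> \<exists>D\<subseteq>S. finite D \<and> (\<forall>k. (\<Sum>\<zeta>\<in>D. (total_occupation ^^ k) \<mu> \<zeta>) \<ge> ennreal (1 - e))"
  obtains \<nu> :: "'s \<Rightarrow> real" where "\<And>\<zeta>. 0 \<le> \<nu> \<zeta>" "(\<integral>\<^sup>+\<zeta>. ennreal (\<nu> \<zeta>) \<partial>count_space S) = 1"
    "\<And>\<zeta>. \<zeta> \<in> S \<Longrightarrow> total_occupation (\<lambda>\<zeta>. ennreal (\<nu> \<zeta>)) \<zeta> = ennreal (\<nu> \<zeta>)"
proof -
  define u where "u k \<zeta> = enn2real ((total_occupation ^^ k) \<mu> \<zeta>)" for k \<zeta>
  have le1: "(total_occupation ^^ k) \<mu> \<zeta> \<le> 1" if "\<zeta> \<in> S" for k \<zeta>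
    using nn_integral_ge_point[OF that, of "(total_occupation ^^ k) \<mu>"] mass[of k] by simp
  have eu: "(total_occupation ^^ k) \<mu> \<zeta> = ennreal (u k \<zeta>)" if "\<zeta> \<in> S" for k \<zeta>
    unfolding u_def by (rule ennreal_enn2real[symmetric]) (rule le_less_trans[OF le1[OF that, of k]], simp)
  have u0: "0 \<le> u k \<zeta>" for k \<zeta> by (simp add: u_def)
  have u1: "u k \<zeta> \<le> 1" if "\<zeta> \<in> S" for k \<zeta>
    using le1[OF that, of k] eu[OF that, of k] by (simp add: u0)
  define c where "c N \<zeta> = (if \<zeta> \<in> S then (\<Sum>k<N. u k \<zeta>) / real N else 0)" for N \<zeta>
  have c01: "c N \<zeta> \<in> {0..1}" for N \<zeta>
  proof -
    have "(\<Sum>k<N. u k \<zeta>) \<le> real N" if "\<zeta> \<in> S"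
      using sum_bounded_above[of "{..<N}" "\<lambda>k. u k \<zeta>" 1] u1[OF that] by simp
    then show ?thesis by (auto simp: c_def u0 sum_nonneg divide_le_eq)
  qed
  \<comment> \<open>Cluster points replace a diagonal argument: along the filter \<open>E\<close> below,
    finer than the usual one on the naturals, the averages converge pointwise.\<close>
  have "compact (PiE UNIV (\<lambda>_::'s. {0..1::real}))"
    using compactin_PiE[of "\<lambda>_. euclidean" UNIV "\<lambda>_::'s. {0..1::real}"]
    by (simp add: euclidean_product_topology)
  moreover have "\<forall>\<^sub>F f in filtermap c sequentially. f \<in> PiE UNIV (\<lambda>_::'s. {0..1::real})"
    using c01 by (auto simp: eventually_filtermap PiE_UNIV_domain)
  moreover have "filtermap c sequentially \<noteq> bot" by (simp add: filtermap_bot_iff)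
  ultimately obtain \<nu> where \<nu>: "inf (nhds \<nu>) (filtermap c sequentially) \<noteq> bot"
    unfolding compact_filter le_principal by blast
  define E where "E = inf (filtercomap c (nhds \<nu>)) sequentially"
  have E: "E \<noteq> bot"
  proof
    assume "E = bot"
    then obtain P Q where "eventually P (filtercomap c (nhds \<nu>))" "eventually Q sequentially" "\<And>N. \<not> (P N \<and> Q N)"
      unfolding E_def trivial_limit_def eventually_inf by metis
    then obtain P' where P': "eventually P' (nhds \<nu>)" "\<And>N. P' (c N) \<Longrightarrow> \<not> Q N" and Q: "eventually Q sequentially"
      unfolding eventually_filtercomap by metis
    have "eventually (\<lambda>f. \<not> P' f) (filtermap c sequentially)"
      unfolding eventually_filtermap using Q by eventually_elim (use P' in blast)
    then have "eventually (\<lambda>f. False) (inf (nhds \<nu>) (filtermap c sequentially))"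
      unfolding eventually_inf using P'(1) by metis
    then show False using \<nu> by (simp add: trivial_limit_def)
  qed
  have "(c \<longlongrightarrow> \<nu>) E"
    unfolding E_def filterlim_def using filtermap_filtercomap[of c "nhds \<nu>"]
    by (meson filtermap_mono inf_le1 order_trans)
  then have lim: "((\<lambda>N. c N \<zeta>) \<longlongrightarrow> \<nu> \<zeta>) E" for \<zeta>
    by (rule continuous_on_tendsto_compose[OF continuous_on_product_coordinates]) auto
  have E_seq: "E \<le> sequentially" by (simp add: E_def)
  have \<nu>0: "0 \<le> \<nu> \<zeta>" for \<zeta>
    by (rule tendsto_lowerbound[OF lim _ E]) (use c01 in auto)
  have \<nu>1: "\<nu> \<zeta> = 0" if "\<And>k. u k \<zeta> = 0" for \<zeta>
  proof -
    have "c N \<zeta> = 0" for N using that by (simp add: c_def)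
    then show ?thesis using tendsto_unique[OF E lim, of \<zeta> 0] by simp
  qed
  define n where "n \<zeta> = ennreal (\<nu> \<zeta>)" for \<zeta>
  have sum_u: "(\<Sum>\<zeta>\<in>F. ennreal (u k \<zeta>)) \<le> 1" if "finite F" "F \<subseteq> S" for F k
  proof -
    have "(\<Sum>\<zeta>\<in>F. ennreal (u k \<zeta>)) = (\<Sum>\<zeta>\<in>F. (total_occupation ^^ k) \<mu> \<zeta>)"
      using that eu by (intro sum.cong) auto
    then show ?thesis
      using sum_le_nn_integral_count_space[OF that, of "(total_occupation ^^ k) \<mu>"] mass[of k] by simp
  qed
  have n_ge_eps: "(\<integral>\<^sup>+\<zeta>. n \<zeta> \<partial>count_space S) \<ge> ennreal (1 - e)" if "0 < e" for e
  proof -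
    obtain D where D: "D \<subseteq> S" "finite D" "\<And>k. ennreal (1 - e) \<le> (\<Sum>\<zeta>\<in>D. (total_occupation ^^ k) \<mu> \<zeta>)"
      using tight[OF \<open>0 < e\<close>] by blast
    have D': "1 - e \<le> (\<Sum>\<zeta>\<in>D. u k \<zeta>)" for k
    proof -
      have "(\<Sum>\<zeta>\<in>D. (total_occupation ^^ k) \<mu> \<zeta>) = (\<Sum>\<zeta>\<in>D. ennreal (u k \<zeta>))"
        using D(1) eu by (intro sum.cong) auto
      also have "\<dots> = ennreal (\<Sum>\<zeta>\<in>D. u k \<zeta>)" by (simp add: u0)
      finally show ?thesis using D(3)[of k] by (simp add: sum_nonneg u0)
    qed
    have "((\<lambda>N. \<Sum>\<zeta>\<in>D. c N \<zeta>) \<longlongrightarrow> (\<Sum>\<zeta>\<in>D. \<nu> \<zeta>)) E" by (intro tendsto_sum lim)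
    moreover have "\<forall>\<^sub>F N in E. 1 - e \<le> (\<Sum>\<zeta>\<in>D. c N \<zeta>)"
    proof (rule filter_leD[OF E_seq])
      show "\<forall>\<^sub>F N in sequentially. 1 - e \<le> (\<Sum>\<zeta>\<in>D. c N \<zeta>)"
        using eventually_gt_at_top[of 0]
      proof eventually_elim
        case (elim N)
        have "(\<Sum>\<zeta>\<in>D. c N \<zeta>) = (\<Sum>\<zeta>\<in>D. (\<Sum>k<N. u k \<zeta>) / real N)"
          using D(1) by (intro sum.cong) (auto simp: c_def)
        also have "\<dots> = (\<Sum>k<N. \<Sum>\<zeta>\<in>D. u k \<zeta>) / real N"
          unfolding sum_divide_distrib[symmetric] by (subst sum.swap) simp
        finally show ?case
          using sum_bounded_below[of "{..<N}" "1 - e" "\<lambda>k. \<Sum>\<zeta>\<in>D. u k \<zeta>"] D' elim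
          by (simp add: le_divide_eq mult.commute)
      qed
    qed
    ultimately have "1 - e \<le> (\<Sum>\<zeta>\<in>D. \<nu> \<zeta>)" by (rule tendsto_lowerbound[OF _ _ E])
    then have "ennreal (1 - e) \<le> (\<Sum>\<zeta>\<in>D. n \<zeta>)" unfolding n_def by (simp add: \<nu>0 ennreal_leI)
    also have "\<dots> \<le> (\<integral>\<^sup>+\<zeta>. n \<zeta> \<partial>count_space S)" by (rule sum_le_nn_integral_count_space[OF D(2,1)])
    finally show ?thesis .
  qed
  have n_ge: "1 \<le> (\<integral>\<^sup>+\<zeta>. n \<zeta> \<partial>count_space S)"
  proof (rule ennreal_le_epsilon)
    fix e :: real assume "0 < e"
    have "1 \<le> ennreal (1 - e) + ennreal e"
    proof (cases "e \<le> 1")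
      case True
      then have "ennreal (1 - e) + ennreal e = ennreal ((1 - e) + e)"
        using \<open>0 < e\<close> by (subst ennreal_plus) auto
      then show ?thesis by simp
    next
      case False
      then have "1 \<le> ennreal e" by simp
      then show ?thesis by (rule add_increasing[OF zero_le])
    qed
    also have "\<dots> \<le> (\<integral>\<^sup>+\<zeta>. n \<zeta> \<partial>count_space S) + ennreal e" by (intro add_right_mono n_ge_eps[OF \<open>0 < e\<close>])
    finally show "1 \<le> (\<integral>\<^sup>+\<zeta>. n \<zeta> \<partial>count_space S) + ennreal e" .
  qed
  have avg: "(\<Sum>\<zeta>\<in>F. c N \<zeta> * \<rho> \<zeta>) = (\<Sum>k<N. \<Sum>\<zeta>\<in>F. u k \<zeta> * \<rho> \<zeta>) / real N"
    if "F \<subseteq> S" for F N \<rho>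
  proof -
    have "(\<Sum>\<zeta>\<in>F. c N \<zeta> * \<rho> \<zeta>) = (\<Sum>\<zeta>\<in>F. (\<Sum>k<N. u k \<zeta> * \<rho> \<zeta>) / real N)"
      using that by (intro sum.cong) (auto simp: c_def sum_distrib_right)
    also have "\<dots> = (\<Sum>k<N. \<Sum>\<zeta>\<in>F. u k \<zeta> * \<rho> \<zeta>) / real N"
      unfolding sum_divide_distrib[symmetric] by (subst sum.swap) simp
    finally show ?thesis .
  qed
  have sub: "total_occupation n \<zeta> \<le> n \<zeta>" if \<zeta>: "\<zeta> \<in> S" for \<zeta>
    unfolding total_occupation_eq_resolvent[OF \<zeta>]
  proof (rule nn_integral_count_space_le[OF countable_S])
    fix F assume F: "finite F" "F \<subseteq> S"
    define \<rho> where "\<rho> \<eta> = enn2real (resolvent (indicator {\<zeta>}) \<eta>)" for \<eta>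
    have \<rho>: "resolvent (indicator {\<zeta>}) \<eta> = ennreal (\<rho> \<eta>)" if "\<eta> \<in> S" for \<eta>
      unfolding \<rho>_def
      by (rule ennreal_enn2real[symmetric], rule le_less_trans[OF resolvent_le_1[OF _ that]])
        (auto simp: indicator_def)
    have \<rho>0: "0 \<le> \<rho> \<eta>" for \<eta> by (simp add: \<rho>_def)
    have step: "(\<Sum>\<eta>\<in>F. u k \<eta> * \<rho> \<eta>) \<le> u (Suc k) \<zeta>" for k
    proof -
      have "ennreal (\<Sum>\<eta>\<in>F. u k \<eta> * \<rho> \<eta>) = (\<Sum>\<eta>\<in>F. ennreal (u k \<eta> * \<rho> \<eta>))"
        by (simp add: u0 \<rho>0)
      also have "\<dots> = (\<Sum>\<eta>\<in>F. (total_occupation ^^ k) \<mu> \<eta> * resolvent (indicator {\<zeta>}) \<eta>)"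
        using F(2) by (intro sum.cong) (auto simp: u0 \<rho>0 eu \<rho> ennreal_mult)
      also have "\<dots> \<le> total_occupation ((total_occupation ^^ k) \<mu>) \<zeta>"
        unfolding total_occupation_eq_resolvent[OF \<zeta>] by (rule sum_le_nn_integral_count_space[OF F])
      also have "\<dots> = ennreal (u (Suc k) \<zeta>)" using eu[OF \<zeta>, of "Suc k"] by simp
      finally show ?thesis by (simp add: u0)
    qed
    have "((\<lambda>N. \<Sum>\<eta>\<in>F. c N \<eta> * \<rho> \<eta>) \<longlongrightarrow> (\<Sum>\<eta>\<in>F. \<nu> \<eta> * \<rho> \<eta>)) E"
      by (intro tendsto_sum tendsto_mult lim tendsto_const)
    moreover have "((\<lambda>N. c N \<zeta> + 1 / real N) \<longlongrightarrow> \<nu> \<zeta> + 0) E"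
      by (intro tendsto_add lim tendsto_mono[OF E_seq] lim_1_over_n)
    moreover have "(\<Sum>\<eta>\<in>F. c N \<eta> * \<rho> \<eta>) \<le> c N \<zeta> + 1 / real N" for N
    proof -
      \<comment> \<open>Telescoping: shifting the average by one step changes it by at most \<open>1 /
        N\<close>.\<close>
      have "(\<Sum>k<N. \<Sum>\<eta>\<in>F. u k \<eta> * \<rho> \<eta>) \<le> (\<Sum>k<N. u (Suc k) \<zeta>)"
        by (intro sum_mono step)
      also have "\<dots> \<le> (\<Sum>k<Suc N. u k \<zeta>)"
        by (simp add: sum.lessThan_Suc_shift u0 del: sum.lessThan_Suc)
      also have "\<dots> \<le> (\<Sum>k<N. u k \<zeta>) + 1" using u1[OF \<zeta>] by simp
      finally have "(\<Sum>k<N. \<Sum>\<eta>\<in>F. u k \<eta> * \<rho> \<eta>) / real N \<le> ((\<Sum>k<N. u k \<zeta>) + 1) / real N"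
        by (rule divide_right_mono) simp
      then show ?thesis unfolding avg[OF F(2)] using \<zeta> by (simp add: c_def add_divide_distrib)
    qed
    ultimately have "(\<Sum>\<eta>\<in>F. \<nu> \<eta> * \<rho> \<eta>) \<le> \<nu> \<zeta> + 0"
      by (intro tendsto_le[OF E]) auto
    then have "ennreal (\<Sum>\<eta>\<in>F. \<nu> \<eta> * \<rho> \<eta>) \<le> n \<zeta>" by (simp add: n_def ennreal_leI)
    moreover have "ennreal (\<Sum>\<eta>\<in>F. \<nu> \<eta> * \<rho> \<eta>) = (\<Sum>\<eta>\<in>F. ennreal (\<nu> \<eta> * \<rho> \<eta>))"
      by (simp add: \<nu>0 \<rho>0)
    moreover have "\<dots> = (\<Sum>\<eta>\<in>F. n \<eta> * resolvent (indicator {\<zeta>}) \<eta>)"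
      using F(2) by (intro sum.cong) (auto simp: \<nu>0 \<rho>0 n_def \<rho> ennreal_mult)
    ultimately show "(\<Sum>\<eta>\<in>F. n \<eta> * resolvent (indicator {\<zeta>}) \<eta>) \<le> n \<zeta>" by simp
  qed
  have n_le: "(\<integral>\<^sup>+\<zeta>. n \<zeta> \<partial>count_space S) \<le> 1"
  proof (rule nn_integral_count_space_le[OF countable_S])
    fix F assume F: "finite F" "F \<subseteq> S"
    have "((\<lambda>N. \<Sum>\<zeta>\<in>F. c N \<zeta>) \<longlongrightarrow> (\<Sum>\<zeta>\<in>F. \<nu> \<zeta>)) E" by (intro tendsto_sum lim)
    moreover have "(\<Sum>\<zeta>\<in>F. c N \<zeta>) \<le> 1" for N
    proof -
      have "(\<Sum>\<zeta>\<in>F. u k \<zeta>) \<le> 1" for k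
        using sum_u[OF F, of k] by (simp add: u0 sum_nonneg)
      then have "(\<Sum>k<N. \<Sum>\<zeta>\<in>F. u k \<zeta> * 1) \<le> real N"
        using sum_bounded_above[of "{..<N}" "\<lambda>k. \<Sum>\<zeta>\<in>F. u k \<zeta>" 1] by simp
      then show ?thesis using avg[OF F(2), of N "\<lambda>_. 1"] by (simp add: divide_le_eq)
    qed
    ultimately have "(\<Sum>\<zeta>\<in>F. \<nu> \<zeta>) \<le> 1" by (intro tendsto_upperbound[OF _ _ E]) auto
    then show "(\<Sum>\<zeta>\<in>F. n \<zeta>) \<le> 1" by (simp add: n_def \<nu>0)
  qed
  have n_mass: "(\<integral>\<^sup>+\<zeta>. n \<zeta> \<partial>count_space S) = 1" using n_ge n_le by simp
  \<comment> \<open>Equal masses of consecutive iterates force them to vanish wherever \<open>R 1 <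
    1\<close>, and \<open>\<nu>\<close> inherits this.\<close>
  have honest: "n \<zeta> * resolvent (\<lambda>_. 1) \<zeta> = n \<zeta>" if \<zeta>: "\<zeta> \<in> S" for \<zeta>
  proof (cases "resolvent (\<lambda>_. 1) \<zeta> = 1")
    case False
    have "u k \<zeta> = 0" for k
    proof -
      have "(\<integral>\<^sup>+\<zeta>. (total_occupation ^^ k) \<mu> \<zeta> * resolvent (\<lambda>_. 1) \<zeta> \<partial>count_space S)
          = (\<integral>\<^sup>+\<zeta>. (total_occupation ^^ k) \<mu> \<zeta> \<partial>count_space S)"
        using mass[of k] mass[of "Suc k"] occupation_resolvent[of "(total_occupation ^^ k) \<mu>" "\<lambda>_. 1"] by simp
      then have "(total_occupation ^^ k) \<mu> \<zeta> * resolvent (\<lambda>_. 1) \<zeta> = (total_occupation ^^ k) \<mu> \<zeta>"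
      proof (intro nn_integral_count_space_eq_imp_eq[where S = S
            and f = "\<lambda>\<zeta>. (total_occupation ^^ k) \<mu> \<zeta> * resolvent (\<lambda>_. 1) \<zeta>"
            and g = "(total_occupation ^^ k) \<mu>"])
        show "(total_occupation ^^ k) \<mu> x * resolvent (\<lambda>_. 1) x \<le> (total_occupation ^^ k) \<mu> x"
          if "x \<in> S" for x
          using mult_left_mono[OF resolvent_le_1[of "\<lambda>_. 1", OF _ that], of "(total_occupation ^^ k) \<mu> x"]
          by simp
        show "(\<integral>\<^sup>+\<zeta>. (total_occupation ^^ k) \<mu> \<zeta> \<partial>count_space S) \<noteq> \<top>" by (simp add: mass)
      qed (simp_all add: \<zeta>)
      moreover have "resolvent (\<lambda>_. 1) \<zeta> < 1"
        using False resolvent_le_1[of "\<lambda>_. 1" \<zeta>] \<zeta> by (simp add: order.strict_iff_order)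
      ultimately show ?thesis
        using eu[OF \<zeta>, of k] u0[of k \<zeta>]
        by (auto simp: ennreal_mult_cancel_left[where c = 1, simplified] order_antisym)
    qed
    then show ?thesis using \<nu>1[of \<zeta>] by (simp add: n_def)
  qed simp
  have "(\<integral>\<^sup>+\<zeta>. total_occupation n \<zeta> \<partial>count_space S) = (\<integral>\<^sup>+\<zeta>. n \<zeta> \<partial>count_space S)"
    using occupation_resolvent[of n "\<lambda>_. 1"] honest by (simp cong: nn_integral_cong_simp)
  then have "total_occupation n \<zeta> = n \<zeta>" if "\<zeta> \<in> S" for \<zeta>
    using n_mass by (intro nn_integral_count_space_eq_imp_eq[where S = S, OF sub _ _ that]) auto
  then show thesis
    using that[of \<nu>] \<nu>0 n_mass unfolding n_def by blast
qed

text \<open>For \<open>f\<close> decreasing in \<open>\<preceq>\<close>, the comparison on the diagonal gives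
\<open>\<mu> R\<^sup>k f \<ge> \<mu> Rbar\<^sup>k f = \<mu> f\<close>. Indicators of finite down-sets yield tightness of \<open>\<mu> R\<^sup>k\<close>, and \<open>f = 1\<close>
yields that its mass stays 1.\<close>

theorem invariant_occupation_transfer:
  fixes a abar :: "int \<Rightarrow> real"
  assumes ex: "exclusion_rates (simple_rates a)" "exclusion_rates (simple_rates abar)"
    and right: "\<And>x y. 0 < x \<Longrightarrow> x \<le> y \<Longrightarrow> a x \<ge> abar y"
    and left: "\<And>x y. y \<le> x \<Longrightarrow> x < 0 \<Longrightarrow> a y \<le> abar x"
    and \<mu>: "blocking_measure \<mu>"
    and inv: "\<And>\<zeta>. \<zeta> \<in> \<X> \<Longrightarrow>
      rates_occupation (simple_rates abar) (\<lambda>\<zeta>. ennreal (pmf \<mu> \<zeta>)) \<zeta> = ennreal (pmf \<mu> \<zeta>)"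
  obtains \<nu> where "blocking_measure \<nu>"
    "\<And>\<zeta>. \<zeta> \<in> \<X> \<Longrightarrow>
      rates_occupation (simple_rates a) (\<lambda>\<zeta>. ennreal (pmf \<nu> \<zeta>)) \<zeta> = ennreal (pmf \<nu> \<zeta>)"
proof -
  let ?S = \<X>
  interpret R: rate_matrix ?S
    "jump_rates (simple_rates a)" "exit_rates (simple_rates a)"
    by (rule rate_matrix_jump_rate[OF ex(1)])
  interpret B: rate_matrix ?S
    "jump_rates (simple_rates abar)" "exit_rates (simple_rates abar)"
    by (rule rate_matrix_jump_rate[OF ex(2)])
  define m where "m \<zeta> = ennreal (pmf \<mu> \<zeta>)" for \<zeta>
  have m1: "(\<integral>\<^sup>+\<zeta>. m \<zeta> \<partial>count_space ?S) = 1"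
    unfolding m_def by (rule nn_integral_pmf_blocking[OF \<mu>])
  have compare: "(B.resolvent ^^ k) f \<zeta> \<le> (R.resolvent ^^ k) f \<eta>"
    if "\<And>\<eta> \<zeta>. \<eta> \<preceq> \<zeta> \<Longrightarrow> f \<zeta> \<le> f \<eta>" "\<And>\<eta>. f \<eta> \<le> 1" "\<eta> \<preceq> \<zeta>" for f k \<eta> \<zeta>
    using that(3)
  proof (induction k arbitrary: \<eta> \<zeta>)
    case (Suc k)
    have le1: "(R.resolvent ^^ k) f \<eta> \<le> 1" if "\<eta> \<in> ?S" for \<eta>
      using R.resolvent_pow_le_1[where f = f and k = k, OF _ that] \<open>\<And>\<eta>. f \<eta> \<le> 1\<close> by blast
    show ?case
      using resolvent_comparison[OF ex right left le1 Suc.IH Suc.prems]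
      by (simp add: rates_resolvent_def)
  qed (use that in auto)
  have ge: "(\<integral>\<^sup>+\<zeta>. m \<zeta> * f \<zeta> \<partial>count_space ?S) \<le> (\<integral>\<^sup>+\<zeta>. (R.total_occupation ^^ k) m \<zeta> * f \<zeta> \<partial>count_space ?S)"
    if "\<And>\<eta> \<zeta>. \<eta> \<preceq> \<zeta> \<Longrightarrow> f \<zeta> \<le> f \<eta>" "\<And>\<eta>. f \<eta> \<le> 1" for f k
  proof -
    have "(\<integral>\<^sup>+\<zeta>. m \<zeta> * f \<zeta> \<partial>count_space ?S) = (\<integral>\<^sup>+\<zeta>. m \<zeta> * (B.resolvent ^^ k) f \<zeta> \<partial>count_space ?S)"
      by (rule B.resolvent_pow_invariant[symmetric]) (use inv in \<open>simp add: m_def rates_occupation_def\<close>)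
    also have "\<dots> \<le> (\<integral>\<^sup>+\<zeta>. m \<zeta> * (R.resolvent ^^ k) f \<zeta> \<partial>count_space ?S)"
      using compare[OF that further_right_refl] by (intro nn_integral_mono mult_left_mono) auto
    finally show ?thesis by (simp add: R.total_occupation_pow)
  qed
  have mass: "(\<integral>\<^sup>+\<zeta>. (R.total_occupation ^^ k) m \<zeta> \<partial>count_space ?S) = 1" for k
  proof (rule antisym)
    have "(\<integral>\<^sup>+\<zeta>. (R.total_occupation ^^ k) m \<zeta> \<partial>count_space ?S)
        = (\<integral>\<^sup>+\<zeta>. m \<zeta> * (R.resolvent ^^ k) (\<lambda>_. 1) \<zeta> \<partial>count_space ?S)"
      using R.total_occupation_pow[of k m "\<lambda>_. 1"] by simp
    also have "\<dots> \<le> (\<integral>\<^sup>+\<zeta>. m \<zeta> * 1 \<partial>count_space ?S)"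
      using R.resolvent_pow_le_1[of "\<lambda>_. 1"] by (intro nn_integral_mono mult_left_mono) auto
    finally show "(\<integral>\<^sup>+\<zeta>. (R.total_occupation ^^ k) m \<zeta> \<partial>count_space ?S) \<le> 1" using m1 by simp
    show "1 \<le> (\<integral>\<^sup>+\<zeta>. (R.total_occupation ^^ k) m \<zeta> \<partial>count_space ?S)"
      using ge[of "\<lambda>_. 1" k] m1 by simp
  qed
  have tight: "\<exists>D\<subseteq>?S. finite D \<and> (\<forall>k. ennreal (1 - e) \<le> (\<Sum>\<zeta>\<in>D. (R.total_occupation ^^ k) m \<zeta>))"
    if "0 < e" for e :: real
  proof -
    have "\<not> (\<forall>F. finite F \<longrightarrow> F \<subseteq> ?S \<longrightarrow> sum m F \<le> ennreal (1 - e))"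
    proof
      assume "\<forall>F. finite F \<longrightarrow> F \<subseteq> ?S \<longrightarrow> sum m F \<le> ennreal (1 - e)"
      then have "1 \<le> ennreal (1 - e)"
        using nn_integral_count_space_le[OF countable_blocking_configs, of m "ennreal (1 - e)"] m1 by auto
      then show False using that by simp
    qed
    then obtain F where F: "finite F" "F \<subseteq> ?S" "ennreal (1 - e) \<le> sum m F" by auto
    define D where "D = (\<Union>\<zeta>\<in>F. {\<eta>. \<eta> \<preceq> \<zeta>})"
    have D: "finite D" "D \<subseteq> ?S"
      using F finite_further_right further_right_blocking by (auto simp: D_def)
    have "F \<subseteq> D" unfolding D_def using F(2) further_right_refl by blast
    have down: "indicator D \<zeta> \<le> (indicator D \<eta> :: ennreal)" if "\<eta> \<preceq> \<zeta>" for \<eta> \<zeta>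
      using further_right_trans[OF that] by (auto simp: D_def indicator_def)
    have int_D: "(\<integral>\<^sup>+\<zeta>. g \<zeta> * indicator D \<zeta> \<partial>count_space ?S) = sum g D" for g :: "config \<Rightarrow> ennreal"
      using D by (subst nn_integral_count_space'[where A = D]) auto
    have "ennreal (1 - e) \<le> (\<Sum>\<zeta>\<in>D. (R.total_occupation ^^ k) m \<zeta>)" for k
    proof -
      have "ennreal (1 - e) \<le> sum m D" using F(3) sum_mono2[OF D(1) \<open>F \<subseteq> D\<close>, of m] by (auto intro: order_trans)
      also have "\<dots> \<le> (\<Sum>\<zeta>\<in>D. (R.total_occupation ^^ k) m \<zeta>)"
        using ge[of "indicator D" k] down unfolding int_D by (auto simp: indicator_def)
      finally show ?thesis .
    qed
    with D show ?thesis by blast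
  qed
  obtain n where n: "\<And>\<zeta>. 0 \<le> n \<zeta>" "(\<integral>\<^sup>+\<zeta>. ennreal (n \<zeta>) \<partial>count_space ?S) = 1"
    "\<And>\<zeta>. \<zeta> \<in> ?S \<Longrightarrow> R.total_occupation (\<lambda>\<zeta>. ennreal (n \<zeta>)) \<zeta> = ennreal (n \<zeta>)"
    using R.invariant_row_exists[OF mass tight] by blast
  define n' where "n' \<zeta> = (if \<zeta> \<in> ?S then n \<zeta> else 0)" for \<zeta>
  have "(\<integral>\<^sup>+\<zeta>. ennreal (n' \<zeta>) \<partial>count_space UNIV) = (\<integral>\<^sup>+\<zeta>. ennreal (n' \<zeta>) \<partial>count_space ?S)"
    by (intro nn_integral_count_space_eq) (auto simp: n'_def)
  also have "\<dots> = 1" using n(2) by (simp add: n'_def cong: nn_integral_cong_simp)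
  finally have pmf: "pmf (embed_pmf n') \<zeta> = n' \<zeta>" for \<zeta>
    using n(1) by (intro pmf_embed_pmf) (auto simp: n'_def)
  show thesis
  proof
    show "blocking_measure (embed_pmf n')"
      by (auto simp: blocking_measure_def set_pmf_iff pmf n'_def split: if_splits)
    show "rates_occupation (simple_rates a) (\<lambda>\<zeta>. ennreal (pmf (embed_pmf n') \<zeta>)) \<zeta>
        = ennreal (pmf (embed_pmf n') \<zeta>)" if "\<zeta> \<in> ?S" for \<zeta>
      using R.occupation_cong[of "\<lambda>\<zeta>. ennreal (n' \<zeta>)" "\<lambda>\<zeta>. ennreal (n \<zeta>)"] n(3) that
      by (simp add: rates_occupation_def pmf n'_def)
  qed
qed

section \<open>Holding times\<close>

text \<open>The exponential law as a law on extended reals. In an absorbing configuration the holding time is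
infinite, which corresponds to the parameter 0.\<close>

definition holding_law :: "real \<Rightarrow> ennreal measure" where
  "holding_law q = (if q = 0 then return borel \<top>
     else distr (density lborel (\<lambda>x. ennreal (exponential_density q x))) borel ennreal)"

lemma sets_holding_law [simp, measurable_cong]: "sets (holding_law q) = sets borel"
  by (simp add: holding_law_def)

lemma space_holding_law [simp]: "space (holding_law q) = UNIV"
  by (simp add: holding_law_def)

lemma prob_space_holding_law: "0 \<le> q \<Longrightarrow> prob_space (holding_law q)"
  unfolding holding_law_def
  by (auto intro!: prob_space_return prob_space.prob_space_distr prob_space_exponential_density)

lemma nn_integral_holding_law:
  assumes "0 < q" and [measurable]: "f \<in> borel_measurable borel"
  shows "(\<integral>\<^sup>+v. f v \<partial>holding_law q)
    = (\<integral>\<^sup>+v. ennreal (q * exp (- q * v)) * f (ennreal v) * indicator {0..} v \<partial>lborel)"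
proof -
  have "(\<integral>\<^sup>+v. f v \<partial>holding_law q) = (\<integral>\<^sup>+v. ennreal (exponential_density q v) * f (ennreal v) \<partial>lborel)"
    using assms(1) by (simp add: holding_law_def nn_integral_distr nn_integral_density)
  also have "\<dots> = (\<integral>\<^sup>+v. ennreal (q * exp (- q * v)) * f (ennreal v) * indicator {0..} v \<partial>lborel)"
    by (intro nn_integral_cong) (auto simp: exponential_density_def indicator_def mult.commute)
  finally show ?thesis .
qed

lemma nn_integral_exp_atLeast:
  assumes "0 < q"
  shows "(\<integral>\<^sup>+v. ennreal (exp (- q * v)) * indicator {s..} v \<partial>lborel) = ennreal (exp (- q * s) / q)"
proof -
  have "((\<lambda>v. - exp (- q * v) / q) \<longlongrightarrow> 0) at_top"
    using assms by real_asymp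
  moreover have "((\<lambda>v. - exp (- q * v) / q) has_real_derivative exp (- q * v)) (at v)" for v
    using assms by (auto intro!: derivative_eq_intros)
  ultimately have "(\<integral>\<^sup>+v. ennreal (exp (- q * v)) * indicator {s..} v \<partial>lborel)
      = ennreal (0 - (- exp (- q * s) / q))"
    by (intro nn_integral_FTC_atLeast) auto
  then show ?thesis by simp
qed

lemma holding_law_tail:
  assumes "0 \<le> q" "0 \<le> s"
  shows "emeasure (holding_law q) {ennreal s<..} = ennreal (exp (- q * s))"
proof (cases "q = 0")
  case False
  then have q: "0 < q" using assms by simp
  have "emeasure (holding_law q) {ennreal s<..} = (\<integral>\<^sup>+v. indicator {ennreal s<..} v \<partial>holding_law q)"
    by simp
  also have "\<dots> = (\<integral>\<^sup>+v. ennreal (q * exp (- q * v)) * indicator {ennreal s<..} (ennreal v) * indicator {0..} v \<partial>lborel)"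
    by (rule nn_integral_holding_law[OF q]) simp
  also have "\<dots> = (\<integral>\<^sup>+v. ennreal q * (ennreal (exp (- q * v)) * indicator {s..} v) \<partial>lborel)"
    using AE_lborel_singleton[of s] assms q
    by (intro nn_integral_cong_AE)
      (auto elim!: eventually_mono simp: indicator_def ennreal_mult ennreal_less_iff)
  also have "\<dots> = ennreal q * ennreal (exp (- q * s) / q)"
    by (subst nn_integral_cmult) (simp, simp only: nn_integral_exp_atLeast[OF q])
  also have "\<dots> = ennreal (exp (- q * s))" using q by (simp add: ennreal_mult[symmetric])
  finally show ?thesis .
qed (simp add: holding_law_def)

lemma holding_law_0:
  assumes "0 \<le> q"
  shows "emeasure (holding_law q) {0} = 0"
proof -
  interpret prob_space "holding_law q" using assms by (rule prob_space_holding_law)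
  have "emeasure (holding_law q) {0<..} = emeasure (holding_law q) (space (holding_law q))"
    using holding_law_tail[OF assms, of 0] emeasure_space_1 by simp
  then have "emeasure (holding_law q) (space (holding_law q) - {0<..}) = 0"
    by (subst emeasure_Diff) auto
  moreover have "space (holding_law q) - {0<..} = {0}" by (auto simp: zero_less_iff_neq_zero)
  ultimately show ?thesis by simp
qed

text \<open>The prescribed probabilities of the jump chain involve the events that a holding time exceeds some
\<open>s \<ge> 0\<close>; these do not control the mass at 0, which has to be excluded separately.\<close>

lemma measure_eqI_tails:
  fixes M N :: "ennreal measure"
  assumes sets: "sets M = sets borel" "sets N = sets borel"
    and tails: "\<And>s. 0 \<le> s \<Longrightarrow> emeasure M {ennreal s<..} = emeasure N {ennreal s<..}"
    and zero: "emeasure M {0} = 0" "emeasure N {0} = 0"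
    and fin: "emeasure M {0<..} \<noteq> \<top>"
  shows "M = N"
proof -
  have U: "emeasure L UNIV = emeasure L {0<..}" if "sets L = sets borel" "emeasure L {0} = 0"
    for L :: "ennreal measure"
  proof -
    have "{0} \<union> {(0::ennreal)<..} = UNIV" by (auto simp: zero_less_iff_neq_zero)
    then have "emeasure L UNIV = emeasure L {0} + emeasure L {0<..}"
      using plus_emeasure[of "{0}" L "{0<..}"] that by simp
    then show ?thesis using that by simp
  qed
  let ?E = "insert UNIV (range greaterThan) :: ennreal set set"
  have gen: "sets (borel :: ennreal measure) = sigma_sets UNIV ?E"
  proof -
    have "sigma_sets (UNIV :: ennreal set) (range greaterThan) = sigma_sets UNIV ?E"
      by (intro sigma_sets_eqI) (auto intro: sigma_sets.Basic sigma_sets_top)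
    then show ?thesis by (subst borel_Ioi) simp
  qed
  show ?thesis
  proof (rule measure_eqI_generator_eq[of ?E UNIV M N "\<lambda>_. UNIV"])
    show "Int_stable ?E"
    proof (rule Int_stableI)
      fix a b assume "a \<in> ?E" "b \<in> ?E"
      moreover have "{x<..} \<inter> {y<..} = {max x y<..}" for x y :: ennreal by auto
      ultimately show "a \<inter> b \<in> ?E" by auto
    qed
    show "emeasure M X = emeasure N X" if X: "X \<in> ?E" for X
    proof (cases "X = UNIV")
      case True
      then show ?thesis using U[OF sets(1) zero(1)] U[OF sets(2) zero(2)] tails[of 0] by simp
    next
      case False
      then obtain y where y: "X = {y<..}" using X by blast
      show ?thesis
      proof (cases y)
        case (real r)
        then show ?thesis using tails[of r] y by simp
      next
        case top
        then have "X = {}" using y by auto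
        then show ?thesis by simp
      qed
    qed
    show "emeasure M UNIV \<noteq> \<infinity>" using U[OF sets(1) zero(1)] fin by simp
  qed (use sets gen in auto)
qed

text \<open>The probability that a holding time with parameter \<open>q\<close> which starts at time \<open>u\<close> covers the time \<open>t\<close>.\<close>

definition survival :: "real \<Rightarrow> real \<Rightarrow> ennreal \<Rightarrow> ennreal" where
  "survival q t u = (if u \<le> ennreal t then ennreal (exp (- q * (t - enn2real u))) else 0)"

lemma measurable_survival [measurable]:
  "(\<lambda>x. survival q (f x) (g x)) \<in> borel_measurable M"
  if [measurable]: "f \<in> borel_measurable M" "g \<in> borel_measurable M"
  unfolding survival_def by measurable

lemma survival_tail:
  assumes "0 \<le> q" "0 \<le> t"
  shows "emeasure (holding_law q) {v. u \<le> ennreal t \<and> ennreal t < u + v} = survival q t u"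
proof (cases "u \<le> ennreal t")
  case True
  then obtain r where r: "u = ennreal r" "0 \<le> r" by (cases u) (auto simp: top_unique)
  have "ennreal t < u + v \<longleftrightarrow> ennreal (t - r) < v" for v
    using True assms r by (cases v) (auto simp: ennreal_plus[symmetric] ennreal_less_iff simp del: ennreal_plus)
  then have "{v. u \<le> ennreal t \<and> ennreal t < u + v} = {ennreal (t - r)<..}" using True by auto
  then show ?thesis
    using holding_law_tail[OF assms(1), of "t - r"] True assms r by (simp add: survival_def)
qed (simp add: survival_def)

text \<open>If a state with exit rate \<open>q\<close> is entered at time \<open>u\<close>, the next state, with exit rate \<open>q'\<close>, is occupied at
time \<open>t\<close> before any further jump precisely if it is entered at some time \<open>w\<close> in \<open>[u, t]\<close> and held
until \<open>t\<close>. The substitution is \<open>w = u + v\<close>.\<close>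

lemma survival_convolution:
  assumes "0 \<le> q" "0 \<le> t"
  shows "(\<integral>\<^sup>+v. survival q' t (u + v) \<partial>holding_law q)
    = (\<integral>\<^sup>+w. ennreal q * (ennreal (exp (- q' * (t - w))) * survival q w u * indicator {0..t} w) \<partial>lborel)"
proof (cases "q = 0")
  case True
  then show ?thesis by (simp add: holding_law_def nn_integral_return survival_def top_unique)
next
  case False
  then have q: "0 < q" using assms by simp
  show ?thesis
  proof (cases u)
    case (real r)
    have "(\<integral>\<^sup>+w. ennreal q * (ennreal (exp (- q' * (t - w))) * survival q w u * indicator {0..t} w) \<partial>lborel)
        = (\<integral>\<^sup>+v. ennreal q * (ennreal (exp (- q' * (t - (r + 1 * v)))) * survival q (r + 1 * v) u * indicator {0..t} (r + 1 * v)) \<partial>lborel)"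
      by (subst nn_integral_real_affine[where c = 1 and t = r]) auto
    also have "\<dots> = (\<integral>\<^sup>+v. ennreal (q * exp (- q * v)) * survival q' t (u + ennreal v) * indicator {0..} v \<partial>lborel)"
    proof (rule nn_integral_cong)
      fix v
      show "ennreal q * (ennreal (exp (- q' * (t - (r + 1 * v)))) * survival q (r + 1 * v) u * indicator {0..t} (r + 1 * v))
        = ennreal (q * exp (- q * v)) * survival q' t (u + ennreal v) * indicator {0..} v"
      proof (cases "0 \<le> v")
        case True
        have "u + ennreal v = ennreal (r + v)" using True real by simp
        then have "survival q' t (u + ennreal v)
            = (if r + v \<le> t then ennreal (exp (- q' * (t - (r + v)))) else 0)"
          using True real assms by (simp add: survival_def del: ennreal_plus)
        moreover have "survival q (r + v) u = ennreal (exp (- q * v))"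
          using True real by (simp add: survival_def del: ennreal_plus)
        ultimately show ?thesis using True real q assms
          by (auto simp: indicator_def ennreal_mult' mult_ac)
      next
        case False
        then have "survival q (r + v) u = 0 \<or> r + v < 0"
          using real by (auto simp: survival_def ennreal_le_iff2)
        then show ?thesis using False by (auto simp: indicator_def)
      qed
    qed
    finally show ?thesis by (subst nn_integral_holding_law[OF q]) auto
  qed (simp add: survival_def nn_integral_0_iff_AE top_unique)
qed

section \<open>The Markov property of the jump chain\<close>

lemma jump_prob_nonneg:
  assumes "exclusion_rates p" "\<eta> \<in> blocking_configs"
  shows "0 \<le> jump_prob p \<eta> \<zeta>"
  using jump_rate_nonneg[OF assms] exit_rate_nonneg[OF assms] by (simp add: jump_prob_def)

lemma nn_integral_jump_prob:
  assumes "exclusion_rates p" "\<eta> \<in> blocking_configs"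
  shows "(\<integral>\<^sup>+\<zeta>. ennreal (jump_prob p \<eta> \<zeta>) \<partial>count_space \<X>) = 1"
proof (cases "exit_rate p \<eta> = 0")
  case True
  have "(\<integral>\<^sup>+\<zeta>. ennreal (jump_prob p \<eta> \<zeta>) \<partial>count_space \<X>)
      = (\<integral>\<^sup>+\<zeta>. indicator {\<eta>} \<zeta> \<partial>count_space \<X>)"
    using True by (intro nn_integral_cong) (auto simp: jump_prob_def indicator_def)
  then show ?thesis using assms(2) by simp
next
  case False
  then have q: "0 < exit_rate p \<eta>" using exit_rate_nonneg[OF assms] by simp
  have "(\<integral>\<^sup>+\<zeta>. ennreal (jump_prob p \<eta> \<zeta>) \<partial>count_space \<X>)
      = (\<integral>\<^sup>+\<zeta>. jump_rates p \<eta> \<zeta> / ennreal (exit_rate p \<eta>) \<partial>count_space \<X>)"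
    using q jump_rate_nonneg[OF assms]
    by (intro nn_integral_cong) (simp add: jump_prob_def divide_ennreal)
  also have "\<dots> = 1"
    using q nn_integral_jump_rate_total[OF assms] by (simp add: nn_integral_divide divide_ennreal)
  finally show ?thesis .
qed

lemma exit_rate_jump_prob:
  assumes "exclusion_rates p" "\<eta> \<in> blocking_configs" "\<zeta> \<in> blocking_configs"
  shows "exit_rate p \<eta> * jump_prob p \<eta> \<zeta> = jump_rate p \<eta> \<zeta>"
proof (cases "exit_rate p \<eta> = 0")
  case True
  have "jump_rates p \<eta> \<zeta> \<le> ennreal (exit_rate p \<eta>)"
    using nn_integral_ge_point[OF assms(3), of "\<lambda>\<zeta>. jump_rates p \<eta> \<zeta>"]
      nn_integral_jump_rate_total[OF assms(1,2)] by simp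
  then show ?thesis using True jump_rate_nonneg[OF assms(1,2), of \<zeta>] by simp
qed (simp add: jump_prob_def)

lemma space_path_space: "space path_space = {\<omega>. \<forall>i. fst (\<omega> i) \<in> \<X>}"
  by (auto simp: path_space_def space_PiM space_pair_measure PiE_UNIV_domain Pi_iff mem_Times_iff)

locale jump_chain =
  fixes p :: rates and \<mu> :: "config pmf" and M :: "path measure"
  assumes rates: "exclusion_rates p" and blocking: "blocking_measure \<mu>"
    and law: "jump_chain_law p \<mu> M"
begin

sublocale prob_space M using law by (simp add: jump_chain_law_def)

lemma sets_M: "sets M = sets path_space" using law by (simp add: jump_chain_law_def)

lemma space_M: "space M = {\<omega>. \<forall>i. fst (\<omega> i) \<in> \<X>}"
  using sets_eq_imp_space_eq[OF sets_M] by (simp add: space_path_space)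

lemma measurable_state [measurable]: "(\<lambda>\<omega>. fst (\<omega> i)) \<in> measurable M (count_space \<X>)"
  and measurable_holding [measurable]: "(\<lambda>\<omega>. snd (\<omega> i)) \<in> borel_measurable M"
  unfolding measurable_cong_sets[OF sets_M refl] path_space_def by measurable

lemma state_sets [measurable]: "Measurable.pred M (\<lambda>\<omega>. fst (\<omega> i) = \<zeta>)"
proof (cases "\<zeta> \<in> blocking_configs")
  case True
  have "(\<lambda>\<omega>. fst (\<omega> i)) -` {\<zeta>} \<inter> space M \<in> sets M"
    using True by (intro measurable_sets[OF measurable_state]) simp
  moreover have "(\<lambda>\<omega>. fst (\<omega> i)) -` {\<zeta>} \<inter> space M = {\<omega>\<in>space M. fst (\<omega> i) = \<zeta>}" by auto
  ultimately show ?thesis by (simp add: pred_def)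
next
  case False
  then have "{\<omega>\<in>space M. fst (\<omega> i) = \<zeta>} = {}" by (auto simp: space_M)
  then show ?thesis by (simp only: pred_def) simp
qed

definition jump_time :: "nat \<Rightarrow> path \<Rightarrow> ennreal" where
  "jump_time k \<omega> = (\<Sum>i<k. snd (\<omega> i))"

lemma measurable_jump_time [measurable]: "jump_time k \<in> borel_measurable M"
  unfolding jump_time_def[abs_def] by measurable

lemma jump_time_Suc: "jump_time (Suc k) \<omega> = jump_time k \<omega> + snd (\<omega> k)"
  by (simp add: jump_time_def)

definition path_weight :: "nat \<Rightarrow> (nat \<Rightarrow> config) \<Rightarrow> (nat \<Rightarrow> real) \<Rightarrow> real" where
  "path_weight n \<eta> s = pmf \<mu> (\<eta> 0) * (\<Prod>i<n. jump_prob p (\<eta> i) (\<eta> (Suc i))) *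
     (\<Prod>i\<le>n. exp (- exit_rate p (\<eta> i) * s i))"

lemma emeasure_path_prefix:
  assumes "\<And>i. i \<le> n \<Longrightarrow> \<eta> i \<in> blocking_configs" "\<And>i. i \<le> n \<Longrightarrow> 0 \<le> s i"
  shows "emeasure M {\<omega>\<in>space M. \<forall>i\<le>n. fst (\<omega> i) = \<eta> i \<and> ennreal (s i) < snd (\<omega> i)}
    = ennreal (path_weight n \<eta> s)"
  using law assms by (simp add: emeasure_eq_measure jump_chain_law_def path_weight_def)

lemma path_weight_Suc:
  assumes "\<And>i. i \<le> n \<Longrightarrow> \<eta>' i = \<eta> i" "\<And>i. i \<le> n \<Longrightarrow> s' i = s i"
  shows "path_weight (Suc n) \<eta>' s'
    = path_weight n \<eta> s * (jump_prob p (\<eta> n) (\<eta>' (Suc n)) * exp (- exit_rate p (\<eta>' (Suc n)) * s' (Suc n)))"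
proof -
  have "(\<Prod>i<n. jump_prob p (\<eta>' i) (\<eta>' (Suc i))) = (\<Prod>i<n. jump_prob p (\<eta> i) (\<eta> (Suc i)))"
    "(\<Prod>i\<le>n. exp (- exit_rate p (\<eta>' i) * s' i)) = (\<Prod>i\<le>n. exp (- exit_rate p (\<eta> i) * s i))"
    using assms by (auto intro!: prod.cong)
  then show ?thesis using assms by (simp add: path_weight_def mult_ac)
qed

lemma path_weight_nonneg:
  assumes "\<And>i. i \<le> n \<Longrightarrow> \<eta> i \<in> blocking_configs"
  shows "0 \<le> path_weight n \<eta> s"
  unfolding path_weight_def using assms
  by (intro mult_nonneg_nonneg prod_nonneg) (auto intro!: jump_prob_nonneg rates)

lemma AE_first_holding_pos: "AE \<omega> in M. 0 < snd (\<omega> 0)"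
proof -
  let ?A = "\<lambda>\<xi>. {\<omega>\<in>space M. fst (\<omega> 0) = \<xi> \<and> 0 < snd (\<omega> 0)}"
  have "emeasure M (?A \<xi>) = ennreal (pmf \<mu> \<xi>)" if "\<xi> \<in> blocking_configs" for \<xi>
    using emeasure_path_prefix[of 0 "\<lambda>_. \<xi>" "\<lambda>_. 0"] that by (simp add: path_weight_def)
  then have "(\<integral>\<^sup>+\<xi>. emeasure M (?A \<xi>) \<partial>count_space \<X>) = 1"
    using nn_integral_pmf_blocking[OF blocking] by (simp cong: nn_integral_cong_simp)
  moreover have "emeasure M (\<Union>\<xi>\<in>\<X>. ?A \<xi>)
      = (\<integral>\<^sup>+\<xi>. emeasure M (?A \<xi>) \<partial>count_space \<X>)"
    by (rule emeasure_UN_countable) (auto simp: countable_blocking_configs disjoint_family_on_def)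
  moreover have "(\<Union>\<xi>\<in>\<X>. ?A \<xi>) = {\<omega>\<in>space M. 0 < snd (\<omega> 0)}"
    by (auto simp: space_M)
  ultimately have "emeasure M {\<omega>\<in>space M. 0 < snd (\<omega> 0)} = 1" by simp
  then show ?thesis by (subst AE_iff_emeasure_eq_1) simp_all
qed

text \<open>By \<open>emeasure_path_prefix\<close> with \<open>s = 0\<close>, each finite history with positive holding times has exactly
the probability of the corresponding history of the embedded chain. The latter probabilities sum to 1
over all continuations, so there is no mass left for a vanishing holding time.\<close>

lemma AE_holding_pos: "AE \<omega> in M. \<forall>i. 0 < snd (\<omega> i)"
proof -
  have "AE \<omega> in M. \<forall>i\<le>n. 0 < snd (\<omega> i)" for n
  proof (induction n)
    case (Suc n)
    let ?P = "PiE {..n} (\<lambda>_. \<X>)"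
    have "AE \<omega> in M. \<forall>\<eta>\<in>?P. \<not> ((\<forall>i\<le>n. fst (\<omega> i) = \<eta> i \<and> 0 < snd (\<omega> i)) \<and> snd (\<omega> (Suc n)) = 0)"
    proof (rule AE_ball_countable')
      fix \<eta> assume "\<eta> \<in> ?P"
      then have \<eta>: "\<eta> i \<in> blocking_configs" if "i \<le> n" for i using that by (auto simp: PiE_def Pi_def)
      let ?A = "{\<omega>\<in>space M. \<forall>i\<le>n. fst (\<omega> i) = \<eta> i \<and> 0 < snd (\<omega> i)}"
      let ?B = "\<lambda>\<xi>. {\<omega>\<in>space M. \<forall>i\<le>Suc n. fst (\<omega> i) = (\<eta>(Suc n := \<xi>)) i \<and> 0 < snd (\<omega> i)}"
      have A: "emeasure M ?A = ennreal (path_weight n \<eta> (\<lambda>_. 0))"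
        using emeasure_path_prefix[of n \<eta> "\<lambda>_. 0"] \<eta> by simp
      have B: "emeasure M (?B \<xi>) = ennreal (path_weight n \<eta> (\<lambda>_. 0)) * ennreal (jump_prob p (\<eta> n) \<xi>)"
        if "\<xi> \<in> blocking_configs" for \<xi>
      proof -
        have "emeasure M (?B \<xi>) = ennreal (path_weight (Suc n) (\<eta>(Suc n := \<xi>)) (\<lambda>_. 0))"
          using emeasure_path_prefix[of "Suc n" "\<eta>(Suc n := \<xi>)" "\<lambda>_. 0"] \<eta> that by simp
        also have "path_weight (Suc n) (\<eta>(Suc n := \<xi>)) (\<lambda>_. 0) = path_weight n \<eta> (\<lambda>_. 0) * jump_prob p (\<eta> n) \<xi>"
          by (subst path_weight_Suc[where \<eta> = \<eta> and s = "\<lambda>_. 0"]) auto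
        finally show ?thesis
          using \<eta> by (simp add: ennreal_mult path_weight_nonneg jump_prob_nonneg[OF rates])
      qed
      have Bm: "?B \<xi> \<in> sets M" for \<xi> by measurable
      have "emeasure M (\<Union>\<xi>\<in>\<X>. ?B \<xi>)
          = (\<integral>\<^sup>+\<xi>. emeasure M (?B \<xi>) \<partial>count_space \<X>)"
        using Bm by (intro emeasure_UN_countable) (auto simp: countable_blocking_configs disjoint_family_on_def)
      also have "\<dots> = (\<integral>\<^sup>+\<xi>. ennreal (path_weight n \<eta> (\<lambda>_. 0)) * ennreal (jump_prob p (\<eta> n) \<xi>) \<partial>count_space \<X>)"
        using B by (intro nn_integral_cong) simp
      also have "\<dots> = emeasure M ?A"
        using nn_integral_jump_prob[OF rates \<eta>[of n]] A by (simp add: nn_integral_cmult)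
      finally have eq: "emeasure M (\<Union>\<xi>\<in>\<X>. ?B \<xi>) = emeasure M ?A" .
      have sub: "(\<Union>\<xi>\<in>\<X>. ?B \<xi>) \<subseteq> ?A" by (auto simp: le_Suc_eq)
      have Um: "(\<Union>\<xi>\<in>\<X>. ?B \<xi>) \<in> sets M"
        using Bm countable_blocking_configs by (intro sets.countable_UN'') auto
      have Am: "?A \<in> sets M" by measurable
      have "emeasure M (?A - (\<Union>\<xi>\<in>\<X>. ?B \<xi>)) = 0"
        using emeasure_Diff[OF _ Am Um sub] eq by simp
      then have "?A - (\<Union>\<xi>\<in>\<X>. ?B \<xi>) \<in> null_sets M"
        by (intro null_setsI sets.Diff Am Um)
      moreover have "{\<omega>\<in>space M. \<not> \<not> ((\<forall>i\<le>n. fst (\<omega> i) = \<eta> i \<and> 0 < snd (\<omega> i)) \<and> snd (\<omega> (Suc n)) = 0)}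
          \<subseteq> ?A - (\<Union>\<xi>\<in>\<X>. ?B \<xi>)"
        by fastforce
      ultimately show "AE \<omega> in M. \<not> ((\<forall>i\<le>n. fst (\<omega> i) = \<eta> i \<and> 0 < snd (\<omega> i)) \<and> snd (\<omega> (Suc n)) = 0)"
        by (rule AE_I')
    qed (auto intro!: countable_PiE simp: countable_blocking_configs)
    with Suc AE_space show ?case
    proof eventually_elim
      case (elim \<omega>)
      have "restrict (\<lambda>i. fst (\<omega> i)) {..n} \<in> ?P" using elim(2) by (auto simp: space_M)
      then have "snd (\<omega> (Suc n)) \<noteq> 0" using elim(1,3) by fastforce
      then show ?case using elim(1) by (auto simp: le_Suc_eq zero_less_iff_neq_zero)
    qed
  qed (use AE_first_holding_pos in simp)
  then have "AE \<omega> in M. \<forall>n. \<forall>i\<le>n. 0 < snd (\<omega> i)" by (simp add: AE_all_countable)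
  then show ?thesis by (rule eventually_mono) blast
qed

end

context jump_chain
begin

definition history_event :: "nat \<Rightarrow> (nat \<Rightarrow> config) \<Rightarrow> (nat \<Rightarrow> real) \<Rightarrow> path set" where
  "history_event k \<eta> s = {\<omega>\<in>space M. \<forall>i<k. fst (\<omega> i) = \<eta> i \<and> ennreal (s i) < snd (\<omega> i)}"

lemma sets_history_event [measurable]: "history_event k \<eta> s \<in> sets M"
  unfolding history_event_def by measurable

lemma markov_history_event:
  assumes \<eta>: "\<And>i. i < k \<Longrightarrow> \<eta> i \<in> blocking_configs" and s: "\<And>i. i < k \<Longrightarrow> 0 \<le> s i"
    and \<zeta>: "\<zeta> \<in> blocking_configs" and \<xi>: "\<xi> \<in> blocking_configs" and r: "0 \<le> r"
  shows "emeasure M (history_event k \<eta> s \<inter>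
      {\<omega>\<in>space M. fst (\<omega> k) = \<zeta> \<and> ennreal r < snd (\<omega> k) \<and> fst (\<omega> (Suc k)) = \<xi>})
    = emeasure M (history_event k \<eta> s \<inter> {\<omega>\<in>space M. fst (\<omega> k) = \<zeta>})
      * ennreal (exp (- exit_rate p \<zeta> * r) * jump_prob p \<zeta> \<xi>)" (is "emeasure M ?L = emeasure M ?R * _")
proof -
  \<comment> \<open>Both events are finite-dimensional up to null sets, of lengths \<open>k\<close> and
    \<open>k + 1\<close>; a coordinate on whose holding time nothing is imposed gets the bound 0.\<close>
  define \<eta>' where "\<eta>' = \<eta>(k := \<zeta>, Suc k := \<xi>)"
  define s1 where "s1 = s(k := 0::real, Suc k := 0)"
  define s2 where "s2 = s(k := r, Suc k := 0)"
  have \<eta>': "\<eta>' i \<in> blocking_configs" if "i \<le> Suc k" for i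
    using that \<eta> \<zeta> \<xi> by (auto simp: \<eta>'_def le_Suc_eq less_Suc_eq_le)
  have s1: "0 \<le> s1 i" "0 \<le> s2 i" if "i \<le> Suc k" for i
    using that s r by (auto simp: s1_def s2_def le_Suc_eq less_Suc_eq_le)
  let ?E = "\<lambda>n s. {\<omega>\<in>space M. \<forall>i\<le>n. fst (\<omega> i) = \<eta>' i \<and> ennreal (s i) < snd (\<omega> i)}"
  have "emeasure M ?R = emeasure M (?E k s1)"
  proof (rule emeasure_eq_AE)
    show "AE \<omega> in M. \<omega> \<in> ?R \<longleftrightarrow> \<omega> \<in> ?E k s1"
      using AE_holding_pos
      by eventually_elim (auto simp: history_event_def \<eta>'_def s1_def order_le_less)
  qed measurable
  also have "\<dots> = ennreal (path_weight k \<eta>' s1)"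
    using \<eta>' s1 by (intro emeasure_path_prefix) auto
  finally have R: "emeasure M ?R = ennreal (path_weight k \<eta>' s1)" .
  have "emeasure M ?L = emeasure M (?E (Suc k) s2)"
  proof (rule emeasure_eq_AE)
    show "AE \<omega> in M. \<omega> \<in> ?L \<longleftrightarrow> \<omega> \<in> ?E (Suc k) s2"
      using AE_holding_pos
      by eventually_elim (auto simp: history_event_def \<eta>'_def s2_def order_le_less less_Suc_eq)
  qed measurable
  also have "\<dots> = ennreal (path_weight (Suc k) \<eta>' s2)"
    using \<eta>' s1 by (intro emeasure_path_prefix) auto
  also have "path_weight (Suc k) \<eta>' s2 = path_weight k \<eta>' s2 * jump_prob p \<zeta> \<xi>"
    by (subst path_weight_Suc[where \<eta> = \<eta>' and s = s2]) (auto simp: \<eta>'_def s2_def)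
  also have "path_weight k \<eta>' s2 = path_weight k \<eta>' s1 * exp (- exit_rate p \<zeta> * r)"
  proof -
    have "(\<Prod>i<k. exp (- exit_rate p (\<eta>' i) * s2 i)) = (\<Prod>i<k. exp (- exit_rate p (\<eta>' i) * s1 i))"
      by (intro prod.cong) (auto simp: s1_def s2_def)
    then show ?thesis
      unfolding path_weight_def lessThan_Suc_atMost[symmetric] by (simp add: s1_def s2_def \<eta>'_def)
  qed
  finally show ?thesis
    unfolding R using path_weight_nonneg[of k \<eta>' s1] \<eta>' by (simp add: ennreal_mult' mult.assoc)
qed

text \<open>Given the current state, the holding time and the next state are independent of the time of arrival.
For history events this is the product form of the finite-dimensional distributions. These events
are stable under intersection, and the time of arrival is measurable for the sigma-algebra that they
generate on the set where the past holding times are positive, which has full measure.\<close>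

lemma markov_jump_time:
  assumes \<zeta>: "\<zeta> \<in> blocking_configs" and \<xi>: "\<xi> \<in> blocking_configs" and r: "0 \<le> r"
    and B: "B \<in> sets borel"
  shows "emeasure M {\<omega>\<in>space M. jump_time k \<omega> \<in> B \<and> fst (\<omega> k) = \<zeta> \<and> ennreal r < snd (\<omega> k) \<and> fst (\<omega> (Suc k)) = \<xi>}
    = emeasure M {\<omega>\<in>space M. jump_time k \<omega> \<in> B \<and> fst (\<omega> k) = \<zeta>}
      * ennreal (exp (- exit_rate p \<zeta> * r) * jump_prob p \<zeta> \<xi>)"
proof -
  let ?X = "{\<omega>\<in>space M. fst (\<omega> k) = \<zeta> \<and> ennreal r < snd (\<omega> k) \<and> fst (\<omega> (Suc k)) = \<xi>}"
  let ?Z = "{\<omega>\<in>space M. fst (\<omega> k) = \<zeta>}"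
  let ?c = "ennreal (exp (- exit_rate p \<zeta> * r) * jump_prob p \<zeta> \<xi>)"
  have XZ: "?X \<in> sets M" "?Z \<in> sets M" by measurable
  define W where "W = {\<omega>\<in>space M. \<forall>i<k. 0 < snd (\<omega> i)}"
  have W[measurable]: "W \<in> sets M" unfolding W_def by measurable
  define G where "G = insert {} {history_event k \<eta> s |\<eta> s. (\<forall>i<k. \<eta> i \<in> \<X>) \<and> (\<forall>i<k. 0 \<le> s i)}"
  have G_in: "history_event k \<eta> s \<in> G" if "\<And>i. i < k \<Longrightarrow> \<eta> i \<in> blocking_configs" "\<And>i. i < k \<Longrightarrow> 0 \<le> s i" for \<eta> s
    using that unfolding G_def by blast
  have GW: "G \<subseteq> Pow W"
    by (auto simp: G_def W_def history_event_def intro: le_less_trans[OF zero_le])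
  have G_sets: "sigma_sets W G \<subseteq> sets M"
    by (rule sets.sigma_sets_subset') (auto simp: G_def)
  have Int: "Int_stable G"
  proof (rule Int_stableI)
    \<comment> \<open>Two history events with different past states are disjoint; otherwise the larger
      bounds on the holding times prevail.\<close>
    fix a b assume "a \<in> G" "b \<in> G"
    then consider "a \<inter> b = {}" | \<eta> s \<eta>' s' where "a = history_event k \<eta> s" "b = history_event k \<eta>' s'"
      "\<forall>i<k. \<eta> i \<in> blocking_configs" "\<forall>i<k. 0 \<le> s i" "\<forall>i<k. 0 \<le> s' i"
      unfolding G_def by blast
    then show "a \<inter> b \<in> G"
    proof cases
      case 2
      show ?thesis
      proof (cases "\<forall>i<k. \<eta> i = \<eta>' i")
        case True
        have "ennreal (max x y) < z \<longleftrightarrow> ennreal x < z \<and> ennreal y < z" for x y z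
          by (cases "x \<le> y") (auto simp: max_def not_le intro: le_less_trans[OF ennreal_leI] le_less_trans[OF ennreal_leI[OF less_imp_le]])
        then have "a \<inter> b = history_event k \<eta> (\<lambda>i. max (s i) (s' i))"
          using True 2 by (auto simp: history_event_def)
        moreover have "history_event k \<eta> (\<lambda>i. max (s i) (s' i)) \<in> G"
          by (rule G_in) (use 2 in \<open>auto simp: le_max_iff_disj\<close>)
        ultimately show ?thesis by simp
      next
        case False
        then have "a \<inter> b = {}" using 2 by (auto simp: history_event_def)
        then show ?thesis by (simp add: G_def)
      qed
    qed (simp add: G_def)
  qed
  define P where "P D \<longleftrightarrow> emeasure M (D \<inter> ?X) = emeasure M (D \<inter> ?Z) * ?c" for D
  have P_G: "P D" if "D \<in> G" for D
    using that markov_history_event[OF _ _ \<zeta> \<xi> r] by (auto simp: G_def P_def)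
  let ?I = "PiE {..<k} (\<lambda>_. \<X>)"
  have count: "countable ?I" by (intro countable_PiE) (auto simp: countable_blocking_configs)
  \<comment> \<open>The event \<open>W\<close> is the disjoint union over all past state sequences of the
    events with \<open>s = 0\<close>.\<close>
  have W_UN: "W = (\<Union>\<eta>\<in>?I. history_event k \<eta> (\<lambda>_. 0))"
  proof (intro equalityI subsetI)
    fix \<omega> assume \<omega>: "\<omega> \<in> W"
    then have "restrict (\<lambda>i. fst (\<omega> i)) {..<k} \<in> ?I" by (auto simp: W_def space_M)
    moreover have "\<omega> \<in> history_event k (restrict (\<lambda>i. fst (\<omega> i)) {..<k}) (\<lambda>_. 0)"
      using \<omega> by (simp add: W_def history_event_def)
    ultimately show "\<omega> \<in> (\<Union>\<eta>\<in>?I. history_event k \<eta> (\<lambda>_. 0))" by blast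
  qed (auto simp: W_def history_event_def)
  have P_W: "P W"
  proof -
    have disj: "disjoint_family_on (\<lambda>\<eta>. history_event k \<eta> (\<lambda>_. 0) \<inter> C) ?I" for C
    proof (unfold disjoint_family_on_def, intro ballI impI)
      fix \<eta> \<eta>' assume e: "\<eta> \<in> ?I" "\<eta>' \<in> ?I" "\<eta> \<noteq> \<eta>'"
      then obtain i where "i < k" "\<eta> i \<noteq> \<eta>' i" using PiE_ext[OF e(1,2)] by auto
      then show "(history_event k \<eta> (\<lambda>_. 0) \<inter> C) \<inter> (history_event k \<eta>' (\<lambda>_. 0) \<inter> C) = {}"
        by (auto simp: history_event_def)
    qed
    have split: "emeasure M (W \<inter> C) = (\<integral>\<^sup>+\<eta>. emeasure M (history_event k \<eta> (\<lambda>_. 0) \<inter> C) \<partial>count_space ?I)"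
      if "C \<in> sets M" for C
      unfolding W_UN Int_UN_distrib2 UN_simps(4)[symmetric] using that disj
      by (subst emeasure_UN_countable[symmetric]) (auto simp: count)
    have "emeasure M (W \<inter> ?X) = (\<integral>\<^sup>+\<eta>. emeasure M (history_event k \<eta> (\<lambda>_. 0) \<inter> ?Z) * ?c \<partial>count_space ?I)"
      unfolding split[OF XZ(1)] using markov_history_event[OF _ _ \<zeta> \<xi> r, of k _ "\<lambda>_. 0"]
      by (intro nn_integral_cong) (auto simp: PiE_def Pi_def)
    also have "\<dots> = emeasure M (W \<inter> ?Z) * ?c"
      unfolding split[OF XZ(2)] by (rule nn_integral_multc) simp
    finally show ?thesis by (simp add: P_def)
  qed
  have P_sigma: "P D" if "D \<in> sigma_sets W G" for D
    using Int GW that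
  proof (induction rule: sigma_sets_induct_disjoint)
    case (compl A)
    have A: "A \<in> sets M" "A \<subseteq> W" using compl(1) G_sets sigma_sets_into_sp[OF GW] by auto
    have add: "emeasure M (A \<inter> C) + emeasure M ((W - A) \<inter> C) = emeasure M (W \<inter> C)" if "C \<in> sets M" for C
    proof -
      have "(A \<inter> C) \<union> ((W - A) \<inter> C) = W \<inter> C" using A by auto
      then show ?thesis using plus_emeasure[of "A \<inter> C" M "(W - A) \<inter> C"] A that by auto
    qed
    have "emeasure M (A \<inter> ?Z) * ?c + emeasure M ((W - A) \<inter> ?X) = emeasure M (A \<inter> ?Z) * ?c + emeasure M ((W - A) \<inter> ?Z) * ?c"
      using add[OF XZ(1)] add[OF XZ(2)] compl(2) P_W by (simp add: P_def distrib_right[symmetric])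
    moreover have "emeasure M (A \<inter> ?Z) * ?c \<noteq> \<top>"
      by (simp add: ennreal_mult_eq_top_iff emeasure_eq_measure)
    ultimately show ?case by (simp add: P_def ennreal_add_left_cancel)
  next
    case (union A)
    have A: "A i \<in> sets M" for i using union(2) G_sets by auto
    have sum: "emeasure M ((\<Union>i. A i) \<inter> C) = (\<Sum>i. emeasure M (A i \<inter> C))" if "C \<in> sets M" for C
      unfolding Int_UN_distrib2 UN_simps(4)[symmetric] using A that union(1)
      by (intro suminf_emeasure[symmetric]) (auto simp: disjoint_family_on_def)
    show ?case
      using union(3) unfolding P_def sum[OF XZ(1)] sum[OF XZ(2)] by simp
  qed (auto simp: P_def P_G[unfolded P_def])
  let ?\<Sigma> = "sigma W G"
  have S: "space ?\<Sigma> = W" "sets ?\<Sigma> = sigma_sets W G" using GW by auto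
  have "(\<lambda>\<omega>. snd (\<omega> i)) \<in> borel_measurable ?\<Sigma>" if i: "i < k" for i
  proof (rule borel_measurableI_greater)
    fix y :: ennreal
    show "{\<omega> \<in> space ?\<Sigma>. y < snd (\<omega> i)} \<in> sets ?\<Sigma>"
    proof (cases y)
      case (real b)
      let ?s = "\<lambda>j. if j = i then b else 0"
      have "{\<omega> \<in> W. y < snd (\<omega> i)} = (\<Union>\<eta>\<in>?I. history_event k \<eta> ?s)"
      proof (intro equalityI subsetI)
        fix \<omega> assume \<omega>: "\<omega> \<in> {\<omega> \<in> W. y < snd (\<omega> i)}"
        then have "restrict (\<lambda>i. fst (\<omega> i)) {..<k} \<in> ?I" by (auto simp: W_def space_M)
        moreover have "\<omega> \<in> history_event k (restrict (\<lambda>i. fst (\<omega> i)) {..<k}) ?s"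
          using \<omega> real by (simp add: W_def history_event_def)
        ultimately show "\<omega> \<in> (\<Union>\<eta>\<in>?I. history_event k \<eta> ?s)" by blast
      next
        fix \<omega> assume "\<omega> \<in> (\<Union>\<eta>\<in>?I. history_event k \<eta> ?s)"
        then show "\<omega> \<in> {\<omega> \<in> W. y < snd (\<omega> i)}"
          using i real by (auto simp: W_def history_event_def intro: le_less_trans[OF zero_le])
      qed
      moreover have "history_event k \<eta> ?s \<in> sets ?\<Sigma>" if "\<eta> \<in> ?I" for \<eta>
        unfolding S using that real by (intro sigma_sets.Basic G_in) auto
      ultimately show ?thesis
        unfolding S(1) using count by (simp add: sets.countable_UN'')
    next
      case top
      then have "{\<omega> \<in> space ?\<Sigma>. y < snd (\<omega> i)} = {}" by auto
      then show ?thesis by (simp only: sets.empty_sets)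
    qed
  qed
  then have "jump_time k \<in> borel_measurable ?\<Sigma>"
    unfolding jump_time_def[abs_def] by (intro borel_measurable_sum) auto
  from measurable_sets[OF this B] have "P (jump_time k -` B \<inter> W)"
    unfolding S by (rule P_sigma)
  moreover have "emeasure M (jump_time k -` B \<inter> W \<inter> C) = emeasure M ({\<omega>\<in>space M. jump_time k \<omega> \<in> B} \<inter> C)"
    if [measurable]: "C \<in> sets M" for C
  proof (rule emeasure_eq_AE)
    show "AE \<omega> in M. \<omega> \<in> jump_time k -` B \<inter> W \<inter> C \<longleftrightarrow> \<omega> \<in> {\<omega>\<in>space M. jump_time k \<omega> \<in> B} \<inter> C"
      using AE_holding_pos AE_space by eventually_elim (auto simp: W_def)
    have "jump_time k -` B \<inter> W = (jump_time k -` B \<inter> space M) \<inter> W" by (auto simp: W_def)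
    then show "jump_time k -` B \<inter> W \<inter> C \<in> sets M"
      using measurable_sets[OF measurable_jump_time B, of k] W that by auto
    show "{\<omega>\<in>space M. jump_time k \<omega> \<in> B} \<inter> C \<in> sets M" using B by measurable
  qed
  moreover have "{\<omega>\<in>space M. jump_time k \<omega> \<in> B} \<inter> ?X
      = {\<omega>\<in>space M. jump_time k \<omega> \<in> B \<and> fst (\<omega> k) = \<zeta> \<and> ennreal r < snd (\<omega> k) \<and> fst (\<omega> (Suc k)) = \<xi>}"
    "{\<omega>\<in>space M. jump_time k \<omega> \<in> B} \<inter> ?Z = {\<omega>\<in>space M. jump_time k \<omega> \<in> B \<and> fst (\<omega> k) = \<zeta>}"
    by auto
  ultimately show ?thesis using XZ by (simp add: P_def)
qed

end

section \<open>The forward equations\<close>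

text \<open>The forward integral equations: the last jump before \<open>t\<close>, which leads from \<open>\<zeta>\<close> to \<open>\<xi>\<close>, takes place
at time \<open>w\<close>, and \<open>\<xi>\<close> is then held until \<open>t\<close>.\<close>

primrec forward :: "rates \<Rightarrow> config pmf \<Rightarrow> nat \<Rightarrow> config \<Rightarrow> real \<Rightarrow> ennreal" where
  "forward p \<mu> 0 \<zeta> t = ennreal (pmf \<mu> \<zeta>) * ennreal (exp (- exit_rate p \<zeta> * t))"
| "forward p \<mu> (Suc k) \<xi> t = (\<integral>\<^sup>+\<zeta>. jump_rates p \<zeta> \<xi> *
     (\<integral>\<^sup>+w. ennreal (exp (- exit_rate p \<xi> * (t - w))) * forward p \<mu> k \<zeta> w * indicator {0..t} w \<partial>lborel)
     \<partial>count_space \<X>)"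

context jump_chain
begin

text \<open>The law of the time of the \<open>k\<close>-th jump on the event that it leads to \<open>\<zeta>\<close>; a measure of total
mass at most 1.\<close>

definition arrival :: "nat \<Rightarrow> config \<Rightarrow> ennreal measure" where
  "arrival k \<zeta> = distr (density M (indicator {\<omega>\<in>space M. fst (\<omega> k) = \<zeta>})) borel (jump_time k)"

lemma sets_arrival [simp, measurable_cong]: "sets (arrival k \<zeta>) = sets borel"
  by (simp add: arrival_def)

lemma space_arrival [simp]: "space (arrival k \<zeta>) = UNIV"
  by (simp add: arrival_def)

lemma nn_integral_arrival:
  assumes [measurable]: "f \<in> borel_measurable borel"
  shows "(\<integral>\<^sup>+u. f u \<partial>arrival k \<zeta>)
    = (\<integral>\<^sup>+\<omega>. f (jump_time k \<omega>) * indicator {\<omega>\<in>space M. fst (\<omega> k) = \<zeta>} \<omega> \<partial>M)"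
  unfolding arrival_def by (rule nn_integral_restricted_law) measurable

lemma emeasure_arrival:
  assumes B[measurable]: "B \<in> sets borel"
  shows "emeasure (arrival k \<zeta>) B = emeasure M {\<omega>\<in>space M. jump_time k \<omega> \<in> B \<and> fst (\<omega> k) = \<zeta>}"
proof -
  have "emeasure (arrival k \<zeta>) B = (\<integral>\<^sup>+u. indicator B u \<partial>arrival k \<zeta>)" by simp
  also have "\<dots> = (\<integral>\<^sup>+\<omega>. indicator B (jump_time k \<omega>) * indicator {\<omega>\<in>space M. fst (\<omega> k) = \<zeta>} \<omega> \<partial>M)"
    by (rule nn_integral_arrival) simp
  also have "\<dots> = (\<integral>\<^sup>+\<omega>. indicator {\<omega>\<in>space M. jump_time k \<omega> \<in> B \<and> fst (\<omega> k) = \<zeta>} \<omega> \<partial>M)"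
    by (rule nn_integral_cong) (simp add: indicator_def)
  also have "\<dots> = emeasure M {\<omega>\<in>space M. jump_time k \<omega> \<in> B \<and> fst (\<omega> k) = \<zeta>}"
    by (rule nn_integral_indicator) measurable
  finally show ?thesis .
qed

lemma finite_measure_arrival: "finite_measure (arrival k \<zeta>)"
  by (rule finite_measureI) (simp add: emeasure_arrival emeasure_eq_measure)

lemma emeasure_arrival_jump:
  assumes \<zeta>: "\<zeta> \<in> blocking_configs" and \<xi>: "\<xi> \<in> blocking_configs"
    and B[measurable]: "B \<in> sets borel" and C[measurable]: "C \<in> sets borel"
  shows "emeasure M {\<omega>\<in>space M. jump_time k \<omega> \<in> B \<and> snd (\<omega> k) \<in> C \<and> fst (\<omega> k) = \<zeta> \<and> fst (\<omega> (Suc k)) = \<xi>}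
    = emeasure (arrival k \<zeta>) B * (ennreal (jump_prob p \<zeta> \<xi>) * emeasure (holding_law (exit_rate p \<zeta>)) C)"
proof -
  let ?q = "exit_rate p \<zeta>"
  have q: "0 \<le> ?q" by (rule exit_rate_nonneg[OF rates \<zeta>])
  let ?F = "{\<omega>\<in>space M. jump_time k \<omega> \<in> B \<and> fst (\<omega> k) = \<zeta> \<and> fst (\<omega> (Suc k)) = \<xi>}"
  define N where "N = distr (density M (indicator ?F)) borel (\<lambda>\<omega>. snd (\<omega> k))"
  have N: "emeasure N D = emeasure M {\<omega>\<in>space M. jump_time k \<omega> \<in> B \<and> snd (\<omega> k) \<in> D \<and> fst (\<omega> k) = \<zeta> \<and> fst (\<omega> (Suc k)) = \<xi>}"
    if [measurable]: "D \<in> sets borel" for D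
  proof -
    have "emeasure N D = (\<integral>\<^sup>+u. indicator D u \<partial>N)" using that by (simp add: N_def)
    also have "\<dots> = (\<integral>\<^sup>+\<omega>. indicator D (snd (\<omega> k)) * indicator ?F \<omega> \<partial>M)"
      unfolding N_def by (rule nn_integral_restricted_law) measurable
    also have "\<dots> = (\<integral>\<^sup>+\<omega>. indicator {\<omega>\<in>space M. jump_time k \<omega> \<in> B \<and> snd (\<omega> k) \<in> D \<and> fst (\<omega> k) = \<zeta> \<and> fst (\<omega> (Suc k)) = \<xi>} \<omega> \<partial>M)"
      by (intro nn_integral_cong) (auto simp: indicator_def)
    finally show ?thesis by (simp add: nn_integral_indicator)
  qed
  let ?c = "emeasure (arrival k \<zeta>) B * ennreal (jump_prob p \<zeta> \<xi>)"
  have "N = scale_measure ?c (holding_law ?q)"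
  proof (rule measure_eqI_tails)
    show "sets N = sets borel" by (simp add: N_def)
    show "emeasure N {ennreal s<..} = emeasure (scale_measure ?c (holding_law ?q)) {ennreal s<..}" if s: "0 \<le> s" for s
    proof -
      have "emeasure N {ennreal s<..} = emeasure M {\<omega>\<in>space M. jump_time k \<omega> \<in> B \<and> fst (\<omega> k) = \<zeta> \<and> ennreal s < snd (\<omega> k) \<and> fst (\<omega> (Suc k)) = \<xi>}"
        by (subst N) (auto intro!: arg_cong[where f = "emeasure M"])
      then show ?thesis
        using markov_jump_time[OF \<zeta> \<xi> s B] holding_law_tail[OF q s] jump_prob_nonneg[OF rates \<zeta>]
        by (simp add: emeasure_arrival ennreal_mult mult_ac)
    qed
    have "AE \<omega> in M. \<not> (jump_time k \<omega> \<in> B \<and> snd (\<omega> k) \<in> {0} \<and> fst (\<omega> k) = \<zeta> \<and> fst (\<omega> (Suc k)) = \<xi>)"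
      using AE_holding_pos by (rule eventually_mono) (metis less_irrefl singletonD)
    then show "emeasure N {0} = 0"
      by (subst N) (auto intro!: emeasure_eq_0_AE)
    show "emeasure (scale_measure ?c (holding_law ?q)) {0} = 0"
      using holding_law_0[OF q] by simp
    show "emeasure N {0<..} \<noteq> \<top>" by (subst N) (auto simp: emeasure_eq_measure)
  qed simp
  then show ?thesis using N[OF C] by (simp add: mult.assoc)
qed

text \<open>On the event that the \<open>k\<close>-th jump leads to \<open>\<zeta>\<close> and the next one to \<open>\<xi>\<close>, the arrival time and the holding
time are independent.\<close>

lemma nn_integral_jump:
  assumes \<zeta>: "\<zeta> \<in> blocking_configs" and \<xi>: "\<xi> \<in> blocking_configs"
    and f[measurable]: "case_prod f \<in> borel_measurable (borel \<Otimes>\<^sub>M borel)"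
  shows "(\<integral>\<^sup>+\<omega>. f (jump_time k \<omega>) (snd (\<omega> k)) * indicator {\<omega>\<in>space M. fst (\<omega> k) = \<zeta> \<and> fst (\<omega> (Suc k)) = \<xi>} \<omega> \<partial>M)
    = ennreal (jump_prob p \<zeta> \<xi>) * (\<integral>\<^sup>+u. \<integral>\<^sup>+v. f u v \<partial>holding_law (exit_rate p \<zeta>) \<partial>arrival k \<zeta>)"
proof -
  let ?H = "scale_measure (ennreal (jump_prob p \<zeta> \<xi>)) (holding_law (exit_rate p \<zeta>))"
  let ?F = "{\<omega>\<in>space M. fst (\<omega> k) = \<zeta> \<and> fst (\<omega> (Suc k)) = \<xi>}"
  let ?N = "distr (density M (indicator ?F)) (borel \<Otimes>\<^sub>M borel) (\<lambda>\<omega>. (jump_time k \<omega>, snd (\<omega> k)))"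
  interpret H: prob_space "holding_law (exit_rate p \<zeta>)"
    by (rule prob_space_holding_law[OF exit_rate_nonneg[OF rates \<zeta>]])
  interpret A: finite_measure "arrival k \<zeta>" by (rule finite_measure_arrival)
  interpret SH: finite_measure ?H
    by (rule finite_measureI) (auto simp: H.emeasure_eq_measure ennreal_mult_eq_top_iff)
  have pair: "arrival k \<zeta> \<Otimes>\<^sub>M ?H = ?N"
  proof (rule pair_measure_eqI)
    show "sets (arrival k \<zeta> \<Otimes>\<^sub>M ?H) = sets ?N"
      by (simp cong: sets_pair_measure_cong)
    fix B C assume "B \<in> sets (arrival k \<zeta>)" "C \<in> sets ?H"
    then have [measurable]: "B \<in> sets borel" "C \<in> sets borel" by simp_all
    have "emeasure ?N (B \<times> C) = (\<integral>\<^sup>+x. indicator (B \<times> C) x \<partial>?N)" by simp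
    also have "\<dots> = (\<integral>\<^sup>+\<omega>. indicator (B \<times> C) (jump_time k \<omega>, snd (\<omega> k)) * indicator ?F \<omega> \<partial>M)"
      by (rule nn_integral_restricted_law) measurable
    also have "\<dots> = (\<integral>\<^sup>+\<omega>. indicator {\<omega>\<in>space M. jump_time k \<omega> \<in> B \<and> snd (\<omega> k) \<in> C \<and> fst (\<omega> k) = \<zeta> \<and> fst (\<omega> (Suc k)) = \<xi>} \<omega> \<partial>M)"
      by (intro nn_integral_cong) (auto simp: indicator_def)
    also have "\<dots> = emeasure (arrival k \<zeta>) B * emeasure ?H C"
      by (simp add: nn_integral_indicator emeasure_arrival_jump[OF \<zeta> \<xi>])
    finally show "emeasure (arrival k \<zeta>) B * emeasure ?H C = emeasure ?N (B \<times> C)" by simp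
  qed (unfold_locales)
  have "(\<integral>\<^sup>+\<omega>. f (jump_time k \<omega>) (snd (\<omega> k)) * indicator ?F \<omega> \<partial>M) = (\<integral>\<^sup>+x. case_prod f x \<partial>?N)"
    by (subst nn_integral_restricted_law) simp_all
  also have "\<dots> = (\<integral>\<^sup>+u. \<integral>\<^sup>+v. f u v \<partial>?H \<partial>arrival k \<zeta>)"
    unfolding pair[symmetric] by (subst SH.nn_integral_fst[symmetric]) simp_all
  also have "\<dots> = (\<integral>\<^sup>+u. ennreal (jump_prob p \<zeta> \<xi>) * (\<integral>\<^sup>+v. f u v \<partial>holding_law (exit_rate p \<zeta>)) \<partial>arrival k \<zeta>)"
    by (intro nn_integral_cong nn_integral_scale_measure) simp
  also have "\<dots> = ennreal (jump_prob p \<zeta> \<xi>) * (\<integral>\<^sup>+u. \<integral>\<^sup>+v. f u v \<partial>holding_law (exit_rate p \<zeta>) \<partial>arrival k \<zeta>)"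
    by (rule nn_integral_cmult) simp
  finally show ?thesis .
qed

lemma nn_integral_split_state:
  assumes [measurable]: "f \<in> borel_measurable M"
  shows "(\<integral>\<^sup>+\<omega>. f \<omega> \<partial>M) = (\<integral>\<^sup>+\<zeta>. \<integral>\<^sup>+\<omega>. f \<omega> * indicator {\<omega>\<in>space M. fst (\<omega> k) = \<zeta>} \<omega> \<partial>M \<partial>count_space \<X>)"
proof -
  have "(\<integral>\<^sup>+\<omega>. f \<omega> \<partial>M) = (\<integral>\<^sup>+\<omega>. \<integral>\<^sup>+\<zeta>. f \<omega> * indicator {\<omega>\<in>space M. fst (\<omega> k) = \<zeta>} \<omega> \<partial>count_space \<X> \<partial>M)"
  proof (rule nn_integral_cong)
    fix \<omega> assume \<omega>: "\<omega> \<in> space M"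
    then have "(\<integral>\<^sup>+\<zeta>. f \<omega> * indicator {\<omega>\<in>space M. fst (\<omega> k) = \<zeta>} \<omega> \<partial>count_space \<X>)
        = (\<Sum>\<zeta>\<in>{fst (\<omega> k)}. f \<omega> * indicator {\<omega>\<in>space M. fst (\<omega> k) = \<zeta>} \<omega>)"
      by (intro nn_integral_count_space') (auto simp: space_M)
    then show "f \<omega> = (\<integral>\<^sup>+\<zeta>. f \<omega> * indicator {\<omega>\<in>space M. fst (\<omega> k) = \<zeta>} \<omega> \<partial>count_space \<X>)"
      using \<omega> by simp
  qed
  also have "\<dots> = (\<integral>\<^sup>+\<zeta>. \<integral>\<^sup>+\<omega>. f \<omega> * indicator {\<omega>\<in>space M. fst (\<omega> k) = \<zeta>} \<omega> \<partial>M \<partial>count_space \<X>)"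
    by (rule nn_integral_count_space_nn_integral) (simp_all add: countable_blocking_configs)
  finally show ?thesis .
qed

lemma emeasure_alive:
  assumes \<zeta>: "\<zeta> \<in> blocking_configs" and t: "0 \<le> t"
  shows "emeasure M {\<omega>\<in>space M. fst (\<omega> k) = \<zeta> \<and> jump_time k \<omega> \<le> ennreal t \<and> ennreal t < jump_time (Suc k) \<omega>}
    = (\<integral>\<^sup>+u. survival (exit_rate p \<zeta>) t u \<partial>arrival k \<zeta>)" (is "emeasure M ?A = _")
proof -
  have A[measurable]: "?A \<in> sets M" by measurable
  define f :: "ennreal \<Rightarrow> ennreal \<Rightarrow> ennreal" where
    "f u v = indicator {x. fst x \<le> ennreal t \<and> ennreal t < fst x + snd x} (u, v)" for u v
  have f[measurable]: "case_prod f \<in> borel_measurable (borel \<Otimes>\<^sub>M borel)"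
    unfolding f_def by measurable
  have "emeasure M ?A = (\<integral>\<^sup>+\<omega>. indicator ?A \<omega> \<partial>M)" by simp
  also have "\<dots> = (\<integral>\<^sup>+\<xi>. \<integral>\<^sup>+\<omega>. indicator ?A \<omega> * indicator {\<omega>\<in>space M. fst (\<omega> (Suc k)) = \<xi>} \<omega> \<partial>M \<partial>count_space \<X>)"
    by (rule nn_integral_split_state) simp
  also have "\<dots> = (\<integral>\<^sup>+\<xi>. ennreal (jump_prob p \<zeta> \<xi>) * (\<integral>\<^sup>+u. survival (exit_rate p \<zeta>) t u \<partial>arrival k \<zeta>) \<partial>count_space \<X>)"
  proof (rule nn_integral_cong)
    fix \<xi> assume "\<xi> \<in> space (count_space \<X>)"
    then have \<xi>: "\<xi> \<in> blocking_configs" by simp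
    have "(\<integral>\<^sup>+\<omega>. indicator ?A \<omega> * indicator {\<omega>\<in>space M. fst (\<omega> (Suc k)) = \<xi>} \<omega> \<partial>M)
        = (\<integral>\<^sup>+\<omega>. f (jump_time k \<omega>) (snd (\<omega> k)) * indicator {\<omega>\<in>space M. fst (\<omega> k) = \<zeta> \<and> fst (\<omega> (Suc k)) = \<xi>} \<omega> \<partial>M)"
      by (intro nn_integral_cong) (auto simp: indicator_def f_def jump_time_Suc)
    also have "\<dots> = ennreal (jump_prob p \<zeta> \<xi>) * (\<integral>\<^sup>+u. \<integral>\<^sup>+v. f u v \<partial>holding_law (exit_rate p \<zeta>) \<partial>arrival k \<zeta>)"
      by (rule nn_integral_jump[OF \<zeta> \<xi> f])
    finally have *: "(\<integral>\<^sup>+\<omega>. indicator ?A \<omega> * indicator {\<omega>\<in>space M. fst (\<omega> (Suc k)) = \<xi>} \<omega> \<partial>M)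
        = ennreal (jump_prob p \<zeta> \<xi>) * (\<integral>\<^sup>+u. \<integral>\<^sup>+v. f u v \<partial>holding_law (exit_rate p \<zeta>) \<partial>arrival k \<zeta>)" .
    have "(\<integral>\<^sup>+v. f u v \<partial>holding_law (exit_rate p \<zeta>)) = survival (exit_rate p \<zeta>) t u" for u
    proof -
      have "(\<integral>\<^sup>+v. f u v \<partial>holding_law (exit_rate p \<zeta>))
          = (\<integral>\<^sup>+v. indicator {v. u \<le> ennreal t \<and> ennreal t < u + v} v \<partial>holding_law (exit_rate p \<zeta>))"
        by (intro nn_integral_cong) (auto simp: f_def indicator_def)
      also have "\<dots> = emeasure (holding_law (exit_rate p \<zeta>)) {v. u \<le> ennreal t \<and> ennreal t < u + v}"
        by (rule nn_integral_indicator) measurable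
      finally show ?thesis using survival_tail[OF exit_rate_nonneg[OF rates \<zeta>] t] by simp
    qed
    with * show "(\<integral>\<^sup>+\<omega>. indicator ?A \<omega> * indicator {\<omega>\<in>space M. fst (\<omega> (Suc k)) = \<xi>} \<omega> \<partial>M)
        = ennreal (jump_prob p \<zeta> \<xi>) * (\<integral>\<^sup>+u. survival (exit_rate p \<zeta>) t u \<partial>arrival k \<zeta>)" by simp
  qed
  also have "\<dots> = (\<integral>\<^sup>+u. survival (exit_rate p \<zeta>) t u \<partial>arrival k \<zeta>)"
    by (simp add: nn_integral_multc nn_integral_jump_prob[OF rates \<zeta>])
  finally show ?thesis .
qed

text \<open>Induction on the number of jumps: the arrival time at \<open>\<xi>\<close> is the arrival time at the previous state
plus the holding time there, and \<open>survival_convolution\<close> integrates out the latter.\<close>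

lemma survival_arrival_eq_forward:
  assumes "\<zeta> \<in> blocking_configs" "0 \<le> t"
  shows "(\<integral>\<^sup>+u. survival (exit_rate p \<zeta>) t u \<partial>arrival k \<zeta>) = forward p \<mu> k \<zeta> t"
  using assms
proof (induction k arbitrary: \<zeta> t)
  case 0
  have "(\<integral>\<^sup>+u. survival (exit_rate p \<zeta>) t u \<partial>arrival 0 \<zeta>)
      = emeasure M {\<omega>\<in>space M. fst (\<omega> 0) = \<zeta> \<and> ennreal t < snd (\<omega> 0)}"
    using emeasure_alive[OF 0, of 0] by (simp add: jump_time_def)
  also have "\<dots> = forward p \<mu> 0 \<zeta> t"
    using emeasure_path_prefix[of 0 "\<lambda>_. \<zeta>" "\<lambda>_. t"] 0 by (simp add: path_weight_def ennreal_mult')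
  finally show ?case .
next
  case (Suc k \<xi> t)
  have meas: "(\<lambda>\<omega>. survival (exit_rate p \<xi>) t (jump_time (Suc k) \<omega>) * indicator {\<omega>\<in>space M. fst (\<omega> (Suc k)) = \<xi>} \<omega>) \<in> borel_measurable M"
    by measurable
  have "(\<integral>\<^sup>+u. survival (exit_rate p \<xi>) t u \<partial>arrival (Suc k) \<xi>)
      = (\<integral>\<^sup>+\<omega>. survival (exit_rate p \<xi>) t (jump_time (Suc k) \<omega>) * indicator {\<omega>\<in>space M. fst (\<omega> (Suc k)) = \<xi>} \<omega> \<partial>M)"
    by (rule nn_integral_arrival) simp
  also have "\<dots> = (\<integral>\<^sup>+\<zeta>. \<integral>\<^sup>+\<omega>. survival (exit_rate p \<xi>) t (jump_time (Suc k) \<omega>) * indicator {\<omega>\<in>space M. fst (\<omega> (Suc k)) = \<xi>} \<omega>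
      * indicator {\<omega>\<in>space M. fst (\<omega> k) = \<zeta>} \<omega> \<partial>M \<partial>count_space \<X>)"
    by (rule nn_integral_split_state[OF meas])
  also have "\<dots> = forward p \<mu> (Suc k) \<xi> t"
    unfolding forward.simps
  proof (rule nn_integral_cong)
    fix \<zeta> assume "\<zeta> \<in> space (count_space \<X>)"
    then have \<zeta>: "\<zeta> \<in> blocking_configs" by simp
    let ?q = "exit_rate p \<zeta>"
    have q: "0 \<le> ?q" by (rule exit_rate_nonneg[OF rates \<zeta>])
    interpret A: finite_measure "arrival k \<zeta>" by (rule finite_measure_arrival)
    interpret P: pair_sigma_finite lborel "arrival k \<zeta>" ..
    have "(\<integral>\<^sup>+\<omega>. survival (exit_rate p \<xi>) t (jump_time (Suc k) \<omega>) * indicator {\<omega>\<in>space M. fst (\<omega> (Suc k)) = \<xi>} \<omega>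
        * indicator {\<omega>\<in>space M. fst (\<omega> k) = \<zeta>} \<omega> \<partial>M)
        = (\<integral>\<^sup>+\<omega>. survival (exit_rate p \<xi>) t (jump_time k \<omega> + snd (\<omega> k)) * indicator {\<omega>\<in>space M. fst (\<omega> k) = \<zeta> \<and> fst (\<omega> (Suc k)) = \<xi>} \<omega> \<partial>M)"
      by (intro nn_integral_cong) (auto simp: indicator_def jump_time_Suc)
    also have "\<dots> = ennreal (jump_prob p \<zeta> \<xi>) * (\<integral>\<^sup>+u. \<integral>\<^sup>+v. survival (exit_rate p \<xi>) t (u + v) \<partial>holding_law ?q \<partial>arrival k \<zeta>)"
      by (rule nn_integral_jump[OF \<zeta> Suc.prems(1)]) measurable
    also have "(\<integral>\<^sup>+u. \<integral>\<^sup>+v. survival (exit_rate p \<xi>) t (u + v) \<partial>holding_law ?q \<partial>arrival k \<zeta>)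
        = (\<integral>\<^sup>+u. \<integral>\<^sup>+w. ennreal ?q * (ennreal (exp (- exit_rate p \<xi> * (t - w))) * survival ?q w u * indicator {0..t} w) \<partial>lborel \<partial>arrival k \<zeta>)"
      by (intro nn_integral_cong survival_convolution q Suc.prems)
    also have "\<dots> = (\<integral>\<^sup>+w. \<integral>\<^sup>+u. ennreal ?q * (ennreal (exp (- exit_rate p \<xi> * (t - w))) * survival ?q w u * indicator {0..t} w) \<partial>arrival k \<zeta> \<partial>lborel)"
      by (rule P.Fubini') measurable
    also have "\<dots> = (\<integral>\<^sup>+w. ennreal ?q * (ennreal (exp (- exit_rate p \<xi> * (t - w))) * (\<integral>\<^sup>+u. survival ?q w u \<partial>arrival k \<zeta>) * indicator {0..t} w) \<partial>lborel)"
      by (intro nn_integral_cong) (simp add: nn_integral_cmult nn_integral_multc)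
    also have "\<dots> = ennreal ?q * (\<integral>\<^sup>+w. ennreal (exp (- exit_rate p \<xi> * (t - w))) * (\<integral>\<^sup>+u. survival ?q w u \<partial>arrival k \<zeta>) * indicator {0..t} w \<partial>lborel)"
      by (rule nn_integral_cmult) measurable
    also have "(\<integral>\<^sup>+w. ennreal (exp (- exit_rate p \<xi> * (t - w))) * (\<integral>\<^sup>+u. survival ?q w u \<partial>arrival k \<zeta>) * indicator {0..t} w \<partial>lborel)
        = (\<integral>\<^sup>+w. ennreal (exp (- exit_rate p \<xi> * (t - w))) * forward p \<mu> k \<zeta> w * indicator {0..t} w \<partial>lborel)"
    proof (rule nn_integral_cong)
      fix w :: real
      show "ennreal (exp (- exit_rate p \<xi> * (t - w))) * (\<integral>\<^sup>+u. survival ?q w u \<partial>arrival k \<zeta>) * indicator {0..t} w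
          = ennreal (exp (- exit_rate p \<xi> * (t - w))) * forward p \<mu> k \<zeta> w * indicator {0..t} w"
        using Suc.IH[OF \<zeta>, of w] by (cases "w \<in> {0..t}") simp_all
    qed
    also have "ennreal (jump_prob p \<zeta> \<xi>) * (ennreal ?q * (\<integral>\<^sup>+w. ennreal (exp (- exit_rate p \<xi> * (t - w))) * forward p \<mu> k \<zeta> w * indicator {0..t} w \<partial>lborel))
        = jump_rates p \<zeta> \<xi> * (\<integral>\<^sup>+w. ennreal (exp (- exit_rate p \<xi> * (t - w))) * forward p \<mu> k \<zeta> w * indicator {0..t} w \<partial>lborel)"
      unfolding exit_rate_jump_prob[OF rates \<zeta> Suc.prems(1), symmetric]
      using q by (simp add: ennreal_mult' mult_ac)
    finally show "(\<integral>\<^sup>+\<omega>. survival (exit_rate p \<xi>) t (jump_time (Suc k) \<omega>) * indicator {\<omega>\<in>space M. fst (\<omega> (Suc k)) = \<xi>} \<omega>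
        * indicator {\<omega>\<in>space M. fst (\<omega> k) = \<zeta>} \<omega> \<partial>M)
        = jump_rates p \<zeta> \<xi> * (\<integral>\<^sup>+w. ennreal (exp (- exit_rate p \<xi> * (t - w))) * forward p \<mu> k \<zeta> w * indicator {0..t} w \<partial>lborel)" .
  qed
  finally show ?case .
qed

lemma jump_time_mono: "k \<le> l \<Longrightarrow> jump_time k \<omega> \<le> jump_time l \<omega>"
  unfolding jump_time_def by (intro sum_mono2) auto

lemma state_at_alt:
  "state_at \<omega> t = (if \<exists>n. ennreal t < jump_time (Suc n) \<omega>
    then Some (fst (\<omega> (LEAST n. ennreal t < jump_time (Suc n) \<omega>))) else None)"
  unfolding state_at_def jump_time_def lessThan_Suc_atMost ..

lemma state_at_Some_iff:
  "state_at \<omega> t = Some \<zeta> \<longleftrightarrow> (\<exists>k. fst (\<omega> k) = \<zeta> \<and> jump_time k \<omega> \<le> ennreal t \<and> ennreal t < jump_time (Suc k) \<omega>)"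
proof
  assume s: "state_at \<omega> t = Some \<zeta>"
  define k where "k = (LEAST n. ennreal t < jump_time (Suc n) \<omega>)"
  from s have ex: "\<exists>n. ennreal t < jump_time (Suc n) \<omega>" and \<zeta>: "fst (\<omega> k) = \<zeta>"
    by (auto simp: state_at_alt k_def split: if_splits)
  have "ennreal t < jump_time (Suc k) \<omega>" unfolding k_def using LeastI_ex[OF ex] .
  moreover have "jump_time k \<omega> \<le> ennreal t"
  proof (cases k)
    case (Suc j)
    then show ?thesis using not_less_Least[of j "\<lambda>n. ennreal t < jump_time (Suc n) \<omega>"] k_def by auto
  qed (simp add: jump_time_def)
  ultimately show "\<exists>k. fst (\<omega> k) = \<zeta> \<and> jump_time k \<omega> \<le> ennreal t \<and> ennreal t < jump_time (Suc k) \<omega>"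
    using \<zeta> by blast
next
  assume "\<exists>k. fst (\<omega> k) = \<zeta> \<and> jump_time k \<omega> \<le> ennreal t \<and> ennreal t < jump_time (Suc k) \<omega>"
  then obtain k where k: "fst (\<omega> k) = \<zeta>" "jump_time k \<omega> \<le> ennreal t" "ennreal t < jump_time (Suc k) \<omega>" by blast
  have "(LEAST n. ennreal t < jump_time (Suc n) \<omega>) = k"
  proof (rule Least_equality)
    fix n assume "ennreal t < jump_time (Suc n) \<omega>"
    then have "jump_time k \<omega> < jump_time (Suc n) \<omega>" using k(2) by simp
    then show "k \<le> n" using jump_time_mono[of "Suc n" k \<omega>] by (metis leD leI not_less_eq_eq)
  qed (rule k(3))
  then show "state_at \<omega> t = Some \<zeta>" using k by (auto simp: state_at_alt)
qed

lemma sets_state_at: "{\<omega>\<in>space M. state_at \<omega> t = Some \<zeta>} \<in> sets M"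
  unfolding state_at_Some_iff by measurable

lemma emeasure_state_at:
  assumes "\<zeta> \<in> blocking_configs" "0 \<le> t"
  shows "emeasure M {\<omega>\<in>space M. state_at \<omega> t = Some \<zeta>} = (\<Sum>k. forward p \<mu> k \<zeta> t)"
proof -
  let ?A = "\<lambda>k. {\<omega>\<in>space M. fst (\<omega> k) = \<zeta> \<and> jump_time k \<omega> \<le> ennreal t \<and> ennreal t < jump_time (Suc k) \<omega>}"
  have "{\<omega>\<in>space M. state_at \<omega> t = Some \<zeta>} = (\<Union>k. ?A k)"
    by (auto simp: state_at_Some_iff)
  moreover have "disjoint_family ?A"
  proof -
    have "False" if "jump_time l \<omega> \<le> ennreal t" "ennreal t < jump_time (Suc k) \<omega>" "k < l" for k l \<omega>
      using jump_time_mono[of "Suc k" l \<omega>] that by (auto dest: order_trans leD)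
    then show ?thesis
      unfolding disjoint_family_on_def by (auto simp: neq_iff)
  qed
  moreover have "range ?A \<subseteq> sets M" by auto
  ultimately have "emeasure M {\<omega>\<in>space M. state_at \<omega> t = Some \<zeta>} = (\<Sum>k. emeasure M (?A k))"
    by (simp add: suminf_emeasure)
  then show ?thesis by (simp add: emeasure_alive[OF assms] survival_arrival_eq_forward[OF assms])
qed

end

section \<open>Stationarity in time and stationarity of the resolvent\<close>

lemma measurable_forward [measurable]: "forward p \<mu> k \<zeta> \<in> borel_measurable borel"
proof (induction k arbitrary: \<zeta>)
  case 0
  show ?case unfolding forward.simps by measurable
next
  case (Suc k)
  note Suc.IH [measurable]
  show ?case
    unfolding forward.simps indicator_def atLeastAtMost_iff
    by (rule borel_measurable_nn_integral_count_space[OF countable_blocking_configs]) measurable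
qed

lemma nn_integral_exp_interval:
  assumes "0 \<le> q" "0 \<le> t"
  shows "ennreal q * (\<integral>\<^sup>+w. ennreal (exp (- q * (t - w))) * indicator {0..t} w \<partial>lborel) = ennreal (1 - exp (- q * t))"
proof -
  have "ennreal q * (\<integral>\<^sup>+w. ennreal (exp (- q * (t - w))) * indicator {0..t} w \<partial>lborel)
      = (\<integral>\<^sup>+w. ennreal (q * exp (- q * (t - w))) * indicator {0..t} w \<partial>lborel)"
    using assms(1) by (subst nn_integral_cmult[symmetric]) (auto simp: ennreal_mult' mult.assoc)
  also have "\<dots> = ennreal (exp (- q * (t - t)) - exp (- q * (t - 0)))"
    using assms by (intro nn_integral_FTC_Icc) (auto intro!: derivative_eq_intros)
  finally show ?thesis by simp
qed

text \<open>If \<open>\<mu> Q = \<mu> q\<close>, then \<open>\<mu>\<close> is a supersolution of the forward equations: inserting the bound for the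
previous partial sum under the integral gives
\<open>\<mu> exp(-q t) + \<mu> (1 - exp(-q t)) = \<mu>\<close>.\<close>

lemma sum_forward_le:
  assumes p: "exclusion_rates p"
    and bal: "\<And>\<zeta>. \<zeta> \<in> \<X> \<Longrightarrow>
      (\<integral>\<^sup>+\<xi>. ennreal (pmf \<mu> \<xi>) * jump_rates p \<xi> \<zeta> \<partial>count_space \<X>)
        = ennreal (pmf \<mu> \<zeta>) * ennreal (exit_rate p \<zeta>)"
    and "\<zeta> \<in> blocking_configs" "0 \<le> t"
  shows "(\<Sum>k<N. forward p \<mu> k \<zeta> t) \<le> ennreal (pmf \<mu> \<zeta>)"
  using assms(3,4)
proof (induction N arbitrary: \<zeta> t)
  case (Suc N \<xi> t)
  let ?q = "exit_rate p \<xi>"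
  let ?e = "\<lambda>w. ennreal (exp (- ?q * (t - w)))"
  have q: "0 \<le> ?q" by (rule exit_rate_nonneg[OF p Suc.prems(1)])
  have inner: "(\<integral>\<^sup>+w. ?e w * (\<Sum>k<N. forward p \<mu> k \<zeta> w) * indicator {0..t} w \<partial>lborel)
      = (\<Sum>k<N. \<integral>\<^sup>+w. ?e w * forward p \<mu> k \<zeta> w * indicator {0..t} w \<partial>lborel)" for \<zeta>
    unfolding sum_distrib_left sum_distrib_right by (rule nn_integral_sum) simp
  have "(\<Sum>k<N. forward p \<mu> (Suc k) \<xi> t)
      = (\<integral>\<^sup>+\<zeta>. jump_rates p \<zeta> \<xi> * (\<integral>\<^sup>+w. ?e w * (\<Sum>k<N. forward p \<mu> k \<zeta> w) * indicator {0..t} w \<partial>lborel) \<partial>count_space \<X>)"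
    unfolding forward.simps inner
    by (subst nn_integral_sum[symmetric]) (simp, simp only: sum_distrib_left)
  also have "\<dots> \<le> (\<integral>\<^sup>+\<zeta>. jump_rates p \<zeta> \<xi> * (\<integral>\<^sup>+w. ennreal (pmf \<mu> \<zeta>) * (?e w * indicator {0..t} w) \<partial>lborel) \<partial>count_space \<X>)"
  proof (intro nn_integral_mono mult_left_mono)
    fix \<zeta> w assume "\<zeta> \<in> space (count_space \<X>)"
    then show "?e w * (\<Sum>k<N. forward p \<mu> k \<zeta> w) * indicator {0..t} w \<le> ennreal (pmf \<mu> \<zeta>) * (?e w * indicator {0..t} w)"
      using Suc.IH[of \<zeta> w] by (cases "w \<in> {0..t}") (auto simp: mult.commute[of "ennreal (pmf \<mu> \<zeta>)"] intro!: mult_left_mono)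
  qed simp
  also have "\<dots> = (\<integral>\<^sup>+\<zeta>. ennreal (pmf \<mu> \<zeta>) * jump_rates p \<zeta> \<xi> * (\<integral>\<^sup>+w. ?e w * indicator {0..t} w \<partial>lborel) \<partial>count_space \<X>)"
    by (intro nn_integral_cong) (simp add: nn_integral_cmult mult_ac)
  also have "\<dots> = ennreal (pmf \<mu> \<xi>) * (ennreal ?q * (\<integral>\<^sup>+w. ?e w * indicator {0..t} w \<partial>lborel))"
    by (subst nn_integral_multc) (simp, simp only: bal[OF Suc.prems(1)] mult.assoc)
  also have "\<dots> = ennreal (pmf \<mu> \<xi>) * ennreal (1 - exp (- ?q * t))"
    by (simp only: nn_integral_exp_interval[OF q Suc.prems(2)])
  finally have "(\<Sum>k<N. forward p \<mu> (Suc k) \<xi> t) \<le> ennreal (pmf \<mu> \<xi>) * ennreal (1 - exp (- ?q * t))" .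
  then have "(\<Sum>k<Suc N. forward p \<mu> k \<xi> t)
      \<le> ennreal (pmf \<mu> \<xi>) * ennreal (exp (- ?q * t)) + ennreal (pmf \<mu> \<xi>) * ennreal (1 - exp (- ?q * t))"
    unfolding sum.lessThan_Suc_shift by (simp add: add_left_mono)
  also have "\<dots> = ennreal (pmf \<mu> \<xi>) * ennreal (exp (- ?q * t) + (1 - exp (- ?q * t)))"
    using q Suc.prems(2) by (subst ennreal_plus) (auto simp: distrib_left)
  finally show ?case by simp
qed simp

text \<open>The Laplace transform at 1 turns convolution with \<open>exp(-q t)\<close> into division by \<open>1 + q\<close>, so it turns
the forward equations into the recursion of \<open>occupation\<close>.\<close>

lemma laplace_forward:
  assumes p: "exclusion_rates p" and "\<zeta> \<in> blocking_configs"
  shows "(\<integral>\<^sup>+t. ennreal (exp (- t)) * forward p \<mu> k \<zeta> t * indicator {0..} t \<partial>lborel)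
    = rate_matrix.occupation \<X> (jump_rates p)
        (exit_rates p) (\<lambda>\<zeta>. ennreal (pmf \<mu> \<zeta>)) k \<zeta>"
proof -
  interpret R: rate_matrix \<X> "jump_rates p" "exit_rates p"
    by (rule rate_matrix_jump_rate[OF p])
  show ?thesis
    using assms(2)
  proof (induction k arbitrary: \<zeta>)
    case 0
    let ?q = "exit_rate p \<zeta>"
    have q: "0 \<le> ?q" by (rule exit_rate_nonneg[OF p 0])
    have "(\<integral>\<^sup>+t. ennreal (exp (- t)) * forward p \<mu> 0 \<zeta> t * indicator {0..} t \<partial>lborel)
        = (\<integral>\<^sup>+t. ennreal (pmf \<mu> \<zeta>) * (ennreal (exp (- (1 + ?q) * t)) * indicator {0..} t) \<partial>lborel)"
      by (intro nn_integral_cong)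
        (simp add: ennreal_mult'[symmetric] exp_add[symmetric] algebra_simps indicator_def)
    also have "\<dots> = ennreal (pmf \<mu> \<zeta>) * ennreal (exp (- (1 + ?q) * 0) / (1 + ?q))"
      using nn_integral_exp_atLeast[of "1 + ?q" 0] q by (subst nn_integral_cmult) auto
    also have "\<dots> = ennreal (pmf \<mu> \<zeta>) / (1 + ennreal ?q)"
      using q by (simp add: divide_ennreal[symmetric] ennreal_times_divide)
    finally show ?case by simp
  next
    case (Suc k \<xi>)
    let ?q = "exit_rate p \<xi>"
    have q: "0 \<le> ?q" by (rule exit_rate_nonneg[OF p Suc.prems])
    let ?f = "\<lambda>\<zeta> t w. ennreal (exp (- t)) * (ennreal (exp (- ?q * (t - w))) * forward p \<mu> k \<zeta> w * indicator {0..t} w) * indicator {0..} t"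
    have meas: "case_prod (?f \<zeta>) \<in> borel_measurable (lborel \<Otimes>\<^sub>M lborel)" for \<zeta>
      unfolding indicator_def atLeastAtMost_iff by measurable
    have mt: "(\<lambda>t. \<integral>\<^sup>+w. ?f \<zeta> t w \<partial>lborel) \<in> borel_measurable lborel" for \<zeta>
      by (rule lborel.borel_measurable_nn_integral[OF meas])
    have inner: "(\<integral>\<^sup>+t. \<integral>\<^sup>+w. ?f \<zeta> t w \<partial>lborel \<partial>lborel) = R.occupation (\<lambda>\<zeta>. ennreal (pmf \<mu> \<zeta>)) k \<zeta> / (1 + ennreal ?q)"
      if \<zeta>: "\<zeta> \<in> blocking_configs" for \<zeta>
    proof -
      have "(\<integral>\<^sup>+t. \<integral>\<^sup>+w. ?f \<zeta> t w \<partial>lborel \<partial>lborel) = (\<integral>\<^sup>+w. \<integral>\<^sup>+t. ?f \<zeta> t w \<partial>lborel \<partial>lborel)"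
        by (rule lborel_pair.Fubini'[symmetric, OF meas])
      also have "\<dots> = (\<integral>\<^sup>+w. (ennreal (exp (- w)) * forward p \<mu> k \<zeta> w * indicator {0..} w) / (1 + ennreal ?q) \<partial>lborel)"
      proof (rule nn_integral_cong)
        fix w :: real
        show "(\<integral>\<^sup>+t. ?f \<zeta> t w \<partial>lborel) = (ennreal (exp (- w)) * forward p \<mu> k \<zeta> w * indicator {0..} w) / (1 + ennreal ?q)"
        proof (cases "0 \<le> w")
          case True
          have "(\<integral>\<^sup>+t. ?f \<zeta> t w \<partial>lborel)
              = (\<integral>\<^sup>+t. (forward p \<mu> k \<zeta> w * ennreal (exp (?q * w))) * (ennreal (exp (- (1 + ?q) * t)) * indicator {w..} t) \<partial>lborel)"
          proof (rule nn_integral_cong)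
            fix t :: real
            have e: "ennreal (exp (- t)) * ennreal (exp (- ?q * (t - w))) = ennreal (exp (?q * w)) * ennreal (exp (- (1 + ?q) * t))"
              by (simp add: ennreal_mult'[symmetric] exp_add[symmetric] algebra_simps)
            have "?f \<zeta> t w = (ennreal (exp (- t)) * ennreal (exp (- ?q * (t - w)))) * (forward p \<mu> k \<zeta> w * indicator {w..} t)"
              using True by (auto simp: indicator_def mult_ac)
            then show "?f \<zeta> t w = (forward p \<mu> k \<zeta> w * ennreal (exp (?q * w))) * (ennreal (exp (- (1 + ?q) * t)) * indicator {w..} t)"
              unfolding e by (simp only: mult_ac)
          qed
          also have "\<dots> = forward p \<mu> k \<zeta> w * ennreal (exp (?q * w)) * ennreal (exp (- (1 + ?q) * w) / (1 + ?q))"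
            using q by (subst nn_integral_cmult) (simp, subst nn_integral_exp_atLeast, simp_all)
          also have "\<dots> = forward p \<mu> k \<zeta> w * ennreal (exp (?q * w) * exp (- (1 + ?q) * w) / (1 + ?q))"
            using q by (simp add: ennreal_mult'[symmetric] mult.assoc)
          also have "exp (?q * w) * exp (- (1 + ?q) * w) = exp (- w)"
            by (simp add: exp_add[symmetric] algebra_simps)
          also have "ennreal (exp (- w) / (1 + ?q)) = ennreal (exp (- w)) / (1 + ennreal ?q)"
            using q by (simp add: divide_ennreal[symmetric])
          finally show ?thesis using True by (simp add: ennreal_times_divide mult.commute)
        next
          case False
          then have "?f \<zeta> t w = 0" for t by simp
          then show ?thesis using False by simp
        qed
      qed
      also have "\<dots> = (\<integral>\<^sup>+w. ennreal (exp (- w)) * forward p \<mu> k \<zeta> w * indicator {0..} w \<partial>lborel) / (1 + ennreal ?q)"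
        by (rule nn_integral_divide) simp
      finally show ?thesis using Suc.IH[OF \<zeta>] by simp
    qed
    have "(\<integral>\<^sup>+t. ennreal (exp (- t)) * forward p \<mu> (Suc k) \<xi> t * indicator {0..} t \<partial>lborel)
        = (\<integral>\<^sup>+t. \<integral>\<^sup>+\<zeta>. jump_rates p \<zeta> \<xi> * (\<integral>\<^sup>+w. ?f \<zeta> t w \<partial>lborel) \<partial>count_space \<X> \<partial>lborel)"
    proof (rule nn_integral_cong)
      fix t :: real
      let ?g = "\<lambda>\<zeta> w. ennreal (exp (- ?q * (t - w))) * forward p \<mu> k \<zeta> w * indicator {0..t} w"
      have "(\<integral>\<^sup>+w. ?f \<zeta> t w \<partial>lborel) = ennreal (exp (- t)) * (\<integral>\<^sup>+w. ?g \<zeta> w \<partial>lborel) * indicator {0..} t" for \<zeta>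
        by (subst nn_integral_multc, measurable, subst nn_integral_cmult, measurable)
      then have "(\<integral>\<^sup>+\<zeta>. jump_rates p \<zeta> \<xi> * (\<integral>\<^sup>+w. ?f \<zeta> t w \<partial>lborel) \<partial>count_space \<X>)
          = (\<integral>\<^sup>+\<zeta>. ennreal (exp (- t)) * (jump_rates p \<zeta> \<xi> * (\<integral>\<^sup>+w. ?g \<zeta> w \<partial>lborel)) * indicator {0..} t \<partial>count_space \<X>)"
        by (simp only: mult_ac)
      also have "\<dots> = ennreal (exp (- t)) * forward p \<mu> (Suc k) \<xi> t * indicator {0..} t"
        unfolding forward.simps by (subst nn_integral_multc, simp, subst nn_integral_cmult) simp_all
      finally show "ennreal (exp (- t)) * forward p \<mu> (Suc k) \<xi> t * indicator {0..} t
          = (\<integral>\<^sup>+\<zeta>. jump_rates p \<zeta> \<xi> * (\<integral>\<^sup>+w. ?f \<zeta> t w \<partial>lborel) \<partial>count_space \<X>)" ..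
    qed
    also have "\<dots> = (\<integral>\<^sup>+\<zeta>. \<integral>\<^sup>+t. jump_rates p \<zeta> \<xi> * (\<integral>\<^sup>+w. ?f \<zeta> t w \<partial>lborel) \<partial>lborel \<partial>count_space \<X>)"
      by (intro nn_integral_count_space_nn_integral countable_blocking_configs borel_measurable_times_ennreal
          borel_measurable_const mt)
    also have "\<dots> = (\<integral>\<^sup>+\<zeta>. jump_rates p \<zeta> \<xi> * (\<integral>\<^sup>+t. \<integral>\<^sup>+w. ?f \<zeta> t w \<partial>lborel \<partial>lborel) \<partial>count_space \<X>)"
      by (intro nn_integral_cong nn_integral_cmult mt)
    also have "\<dots> = (\<integral>\<^sup>+\<zeta>. (R.occupation (\<lambda>\<zeta>. ennreal (pmf \<mu> \<zeta>)) k \<zeta> * jump_rates p \<zeta> \<xi>) / (1 + ennreal ?q) \<partial>count_space \<X>)"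
      by (intro nn_integral_cong) (subst inner, simp, simp add: ennreal_times_divide mult.commute)
    also have "\<dots> = R.occupation (\<lambda>\<zeta>. ennreal (pmf \<mu> \<zeta>)) (Suc k) \<xi>"
      by (simp add: nn_integral_divide)
    finally show ?case .
  qed
qed

lemma laplace_total_forward:
  assumes p: "exclusion_rates p" and "\<zeta> \<in> blocking_configs"
  shows "(\<integral>\<^sup>+t. ennreal (exp (- t)) * (\<Sum>k. forward p \<mu> k \<zeta> t) * indicator {0..} t \<partial>lborel)
    = rates_occupation p (\<lambda>\<zeta>. ennreal (pmf \<mu> \<zeta>)) \<zeta>"
proof -
  interpret R: rate_matrix \<X> "jump_rates p" "exit_rates p"
    by (rule rate_matrix_jump_rate[OF p])
  have "(\<integral>\<^sup>+t. ennreal (exp (- t)) * (\<Sum>k. forward p \<mu> k \<zeta> t) * indicator {0..} t \<partial>lborel)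
      = (\<Sum>k. \<integral>\<^sup>+t. ennreal (exp (- t)) * forward p \<mu> k \<zeta> t * indicator {0..} t \<partial>lborel)"
    by (subst nn_integral_suminf[symmetric]) simp_all
  then show ?thesis
    by (simp add: laplace_forward[OF assms] rates_occupation_def R.total_occupation_def)
qed

lemma nn_integral_exp_1: "(\<integral>\<^sup>+t. ennreal (exp (- t)) * indicator {0::real..} t \<partial>lborel) = 1"
  using nn_integral_exp_atLeast[of 1 0] by simp

theorem blocking_invariant_occupation:
  assumes p: "exclusion_rates p" and inv: "blocking_invariant p \<mu>" and \<zeta>: "\<zeta> \<in> blocking_configs"
  shows "rates_occupation p (\<lambda>\<zeta>. ennreal (pmf \<mu> \<zeta>)) \<zeta> = ennreal (pmf \<mu> \<zeta>)"
proof -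
  obtain M where "blocking_measure \<mu>" "jump_chain_law p \<mu> M"
    and M: "\<And>t \<zeta>. 0 \<le> t \<Longrightarrow> measure M {\<omega> \<in> space M. state_at \<omega> t = Some \<zeta>} = pmf \<mu> \<zeta>"
    using inv unfolding blocking_invariant_def by blast
  then interpret jump_chain p \<mu> M using p by unfold_locales
  have F: "(\<Sum>k. forward p \<mu> k \<zeta> t) = ennreal (pmf \<mu> \<zeta>)" if "0 \<le> t" for t
    using emeasure_state_at[OF \<zeta> that] M[OF that, of \<zeta>] by (simp add: emeasure_eq_measure)
  have "rates_occupation p (\<lambda>\<zeta>. ennreal (pmf \<mu> \<zeta>)) \<zeta>
      = (\<integral>\<^sup>+t. ennreal (pmf \<mu> \<zeta>) * (ennreal (exp (- t)) * indicator {0..} t) \<partial>lborel)"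
    unfolding laplace_total_forward[OF p \<zeta>, symmetric]
    by (intro nn_integral_cong) (auto simp: F indicator_def mult.commute)
  also have "\<dots> = ennreal (pmf \<mu> \<zeta>)"
    by (subst nn_integral_cmult) (auto simp: nn_integral_exp_1)
  finally show ?thesis .
qed

text \<open>By \<open>sum_forward_le\<close> the law at time \<open>t\<close> is at most \<open>\<mu>\<close>, and the Laplace transforms of both agree, so
they are equal at almost every \<open>t\<close>. In particular, non-explosion before \<open>t'\<close> has probability 1 for
arbitrarily large \<open>t'\<close>, hence for every \<open>t\<close>; then the law at time \<open>t\<close> has mass 1 and equals \<open>\<mu>\<close>.\<close>

lemma (in jump_chain) state_at_stationary:
  assumes occ: "\<And>\<zeta>. \<zeta> \<in> \<X> \<Longrightarrow>
      rates_occupation p (\<lambda>\<zeta>. ennreal (pmf \<mu> \<zeta>)) \<zeta> = ennreal (pmf \<mu> \<zeta>)"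
    and t: "0 \<le> t"
  shows "measure M {\<omega>\<in>space M. state_at \<omega> t = Some \<zeta>} = pmf \<mu> \<zeta>"
proof -
  interpret R: rate_matrix \<X> "jump_rates p" "exit_rates p"
    by (rule rate_matrix_jump_rate[OF rates])
  let ?S = \<X>
  let ?m = "\<lambda>\<zeta>. ennreal (pmf \<mu> \<zeta>)"
  let ?F = "\<lambda>\<zeta> t. \<Sum>k. forward p \<mu> k \<zeta> t"
  have bal: "(\<integral>\<^sup>+\<xi>. ?m \<xi> * jump_rates p \<xi> \<zeta> \<partial>count_space ?S) = ?m \<zeta> * ennreal (exit_rate p \<zeta>)"
    if \<zeta>: "\<zeta> \<in> ?S" for \<zeta>
  proof -
    have "?m \<zeta> * (1 + ennreal (exit_rate p \<zeta>)) = ?m \<zeta> + (\<integral>\<^sup>+\<xi>. R.total_occupation ?m \<xi> * jump_rates p \<xi> \<zeta> \<partial>count_space ?S)"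
      using R.total_occupation_equation[OF \<zeta>, of ?m] occ[OF \<zeta>] by (simp add: rates_occupation_def)
    also have "(\<integral>\<^sup>+\<xi>. R.total_occupation ?m \<xi> * jump_rates p \<xi> \<zeta> \<partial>count_space ?S)
        = (\<integral>\<^sup>+\<xi>. ?m \<xi> * jump_rates p \<xi> \<zeta> \<partial>count_space ?S)"
      using occ by (intro nn_integral_cong) (simp add: rates_occupation_def)
    finally show ?thesis by (simp add: distrib_left ennreal_add_left_cancel)
  qed
  have le: "?F \<zeta> t \<le> ?m \<zeta>" if "\<zeta> \<in> ?S" "0 \<le> t" for \<zeta> t
    by (rule suminf_le_const) (auto intro: summableI sum_forward_le[OF rates bal that])
  have eq_AE: "AE t in lborel. \<forall>\<zeta>\<in>?S. 0 \<le> t \<longrightarrow> ?F \<zeta> t = ?m \<zeta>"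
  proof (rule AE_ball_countable'[OF _ countable_blocking_configs])
    fix \<zeta> assume \<zeta>: "\<zeta> \<in> ?S"
    let ?g = "\<lambda>t. ennreal (exp (- t)) * ?F \<zeta> t * indicator {0..} t"
    let ?h = "\<lambda>t. ?m \<zeta> * (ennreal (exp (- t)) * indicator {0::real..} t)"
    have g: "integral\<^sup>N lborel ?g = ?m \<zeta>"
      unfolding laplace_total_forward[OF rates \<zeta>] by (rule occ[OF \<zeta>])
    have h: "integral\<^sup>N lborel ?h = ?m \<zeta>"
      by (subst nn_integral_cmult) (auto simp: nn_integral_exp_1)
    have gh: "?g t \<le> ?h t" for t
      using mult_left_mono[OF le[OF \<zeta>, of t], of "ennreal (exp (- t))"]
      by (cases "0 \<le> t") (simp_all add: mult.commute)
    have "(\<integral>\<^sup>+t. ?h t - ?g t \<partial>lborel) = 0"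
      using g h gh by (subst nn_integral_diff) auto
    then have "AE t in lborel. ?h t - ?g t = 0"
      by (subst (asm) nn_integral_0_iff_AE) auto
    then show "AE t in lborel. 0 \<le> t \<longrightarrow> ?F \<zeta> t = ?m \<zeta>"
    proof eventually_elim
      case (elim t)
      show ?case
      proof
        assume t: "0 \<le> t"
        then have "?m \<zeta> * ennreal (exp (- t)) \<le> ennreal (exp (- t)) * ?F \<zeta> t"
          using elim by (simp add: diff_eq_0_iff_ennreal ennreal_mult_eq_top_iff)
        then have "ennreal (exp (- t)) * ?m \<zeta> = ennreal (exp (- t)) * ?F \<zeta> t"
          using gh[of t] t by (simp add: mult.commute order_antisym)
        then show "?F \<zeta> t = ?m \<zeta>" by (simp add: ennreal_mult_cancel_left)
      qed
    qed
  qed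
  let ?A = "\<lambda>t. {\<omega>\<in>space M. state_at \<omega> t \<noteq> None}"
  have state_S: "\<zeta> \<in> ?S" if "\<omega> \<in> space M" "state_at \<omega> t = Some \<zeta>" for \<omega> t \<zeta>
    using that by (auto simp: state_at_Some_iff space_M)
  have A_UN: "?A t = (\<Union>\<zeta>\<in>?S. {\<omega>\<in>space M. state_at \<omega> t = Some \<zeta>})" for t
    using state_S by auto
  have A_sets: "?A t \<in> sets M" for t
    unfolding A_UN by (intro sets.countable_UN'' countable_blocking_configs sets_state_at)
  have A: "emeasure M (?A t) = (\<integral>\<^sup>+\<zeta>. ?F \<zeta> t \<partial>count_space ?S)" if "0 \<le> t" for t
  proof -
    have "emeasure M (?A t) = (\<integral>\<^sup>+\<zeta>. emeasure M {\<omega>\<in>space M. state_at \<omega> t = Some \<zeta>} \<partial>count_space ?S)"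
      unfolding A_UN
      by (rule emeasure_UN_countable) (auto simp: countable_blocking_configs disjoint_family_on_def sets_state_at)
    then show ?thesis using emeasure_state_at[OF _ that] by (simp cong: nn_integral_cong_simp)
  qed
  \<comment> \<open>A half-line is not a null set, so a time \<open>t' \<ge> t\<close> with full mass
    exists.\<close>
  have "\<not> (AE t' in lborel. \<not> t \<le> t')"
  proof
    assume "AE t' in lborel. \<not> t \<le> t'"
    then have "emeasure lborel {t..} = 0"
      by (subst (asm) AE_iff_measurable[of "{t..}"]) auto
    moreover have "emeasure lborel {t..t + 1} \<le> emeasure lborel {t..}" by (intro emeasure_mono) auto
    ultimately show False by simp
  qed
  moreover have "AE t' in lborel. \<not> t \<le> t'"
    if none: "\<not> (\<exists>t'\<ge>t. \<forall>\<zeta>\<in>?S. 0 \<le> t' \<longrightarrow> ?F \<zeta> t' = ?m \<zeta>)"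
    using eq_AE by eventually_elim (use none in blast)
  ultimately obtain t' where "t \<le> t'" "\<forall>\<zeta>\<in>?S. 0 \<le> t' \<longrightarrow> ?F \<zeta> t' = ?m \<zeta>" by blast
  then have t': "t \<le> t'" "\<forall>\<zeta>\<in>?S. ?F \<zeta> t' = ?m \<zeta>" using t by auto
  have m1: "(\<integral>\<^sup>+\<zeta>. ?m \<zeta> \<partial>count_space ?S) = 1" by (rule nn_integral_pmf_blocking[OF blocking])
  have "emeasure M (?A t') = 1"
    using A[of t'] t t' m1 by (simp cong: nn_integral_cong_simp)
  moreover have "?A t' \<subseteq> ?A t"
  proof
    fix \<omega> assume "\<omega> \<in> ?A t'"
    then have \<omega>: "\<omega> \<in> space M" and "\<exists>n. ennreal t' < jump_time (Suc n) \<omega>"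
      by (auto simp: state_at_alt split: if_splits)
    then have "\<exists>n. ennreal t < jump_time (Suc n) \<omega>"
      using ennreal_leI[OF t'(1)] by (blast intro: le_less_trans)
    then show "\<omega> \<in> ?A t" using \<omega> by (simp add: state_at_alt)
  qed
  ultimately have "1 \<le> emeasure M (?A t)"
    using emeasure_mono[OF _ A_sets, of "?A t'" t] by simp
  then have "(\<integral>\<^sup>+\<zeta>. ?F \<zeta> t \<partial>count_space ?S) = (\<integral>\<^sup>+\<zeta>. ?m \<zeta> \<partial>count_space ?S)"
    unfolding m1 using A[OF t] emeasure_le_1[of "?A t"] by simp
  then have F: "?F \<zeta> t = ?m \<zeta>" if "\<zeta> \<in> ?S" for \<zeta>
    using m1 le[OF _ t] that
    by (intro nn_integral_count_space_eq_imp_eq[where S = ?S and f = "\<lambda>\<zeta>. ?F \<zeta> t" and g = ?m]) auto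
  show ?thesis
  proof (cases "\<zeta> \<in> ?S")
    case True
    have "ennreal (measure M {\<omega>\<in>space M. state_at \<omega> t = Some \<zeta>}) = ?m \<zeta>"
      using emeasure_state_at[OF True t] F[OF True] by (simp add: emeasure_eq_measure)
    then show ?thesis by simp
  next
    case False
    then have "{\<omega>\<in>space M. state_at \<omega> t = Some \<zeta>} = {}" using state_S by blast
    moreover have "pmf \<mu> \<zeta> = 0" using False blocking by (auto simp: blocking_measure_def set_pmf_iff)
    ultimately show ?thesis by (simp only: measure_empty)
  qed
qed

section \<open>Existence of the jump chain\<close>

text \<open>Sampled configurations lie in \<open>\<X>\<close> only almost surely, whereas \<open>path_space\<close> requires all
visited states to lie in \<open>\<X>\<close>. The exceptional ones are redirected to an arbitrary element of \<open>\<X>\<close>.\<close>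

definition into_blocking :: "config \<Rightarrow> config" where
  "into_blocking \<zeta> = (if \<zeta> \<in> \<X> then \<zeta> else (\<lambda>x. 0 < x))"

lemma into_blocking_in: "into_blocking \<zeta> \<in> blocking_configs"
proof -
  have "(\<lambda>x::int. 0 < x) \<in> blocking_level 0"
    by (simp add: blocking_level_def not_le[symmetric] cong: conj_cong)
  then show ?thesis by (auto simp: into_blocking_def blocking_configs_def)
qed

lemma into_blocking_id: "\<zeta> \<in> \<X> \<Longrightarrow> into_blocking \<zeta> = \<zeta>"
  by (simp add: into_blocking_def)

text \<open>The entry at \<open>(n, \<eta>)\<close> holds the next state and the holding time to be used if the chain is in \<open>\<eta>\<close> after
\<open>n\<close> jumps. A given initial segment of a path reads entries with distinct \<open>n\<close>, so independent entries
produce the product form of the finite-dimensional distributions.\<close>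

type_synonym jump_table = "nat \<times> config \<Rightarrow> config \<times> ennreal"

primrec sampled_state :: "nat \<Rightarrow> config \<times> jump_table \<Rightarrow> config" where
  "sampled_state 0 x = into_blocking (fst x)"
| "sampled_state (Suc n) x = into_blocking (fst (snd x (n, sampled_state n x)))"

definition sampled_path :: "config \<times> jump_table \<Rightarrow> path" where
  "sampled_path x n = (sampled_state n x, snd (snd x (n, sampled_state n x)))"

lemma sampled_state_in: "sampled_state n x \<in> blocking_configs"
  by (cases n) (simp_all add: into_blocking_in)

lemma sampled_state_eq_iff:
  "(\<forall>i\<le>n. sampled_state i x = \<eta> i)
    \<longleftrightarrow> into_blocking (fst x) = \<eta> 0 \<and> (\<forall>i<n. into_blocking (fst (snd x (i, \<eta> i))) = \<eta> (Suc i))"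
proof (induction n)
  case (Suc n)
  show ?case
  proof (cases "\<forall>i\<le>n. sampled_state i x = \<eta> i")
    case True
    then show ?thesis using Suc.IH by (auto simp: le_Suc_eq less_Suc_eq)
  next
    case False
    then show ?thesis using Suc.IH by (auto simp: le_Suc_eq less_Suc_eq)
  qed
qed simp

definition jump_kernel :: "rates \<Rightarrow> config \<Rightarrow> config pmf" where
  "jump_kernel p \<eta> = embed_pmf (\<lambda>\<zeta>. if \<zeta> \<in> \<X> then jump_prob p \<eta> \<zeta> else 0)"

lemma pmf_jump_kernel:
  assumes "exclusion_rates p" "\<eta> \<in> blocking_configs"
  shows "pmf (jump_kernel p \<eta>) \<zeta> = (if \<zeta> \<in> \<X> then jump_prob p \<eta> \<zeta> else 0)"
  unfolding jump_kernel_def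
proof (rule pmf_embed_pmf)
  have "(\<integral>\<^sup>+\<zeta>. ennreal (if \<zeta> \<in> \<X> then jump_prob p \<eta> \<zeta> else 0) \<partial>count_space UNIV)
      = (\<integral>\<^sup>+\<zeta>. ennreal (if \<zeta> \<in> \<X> then jump_prob p \<eta> \<zeta> else 0) \<partial>count_space \<X>)"
    by (intro nn_integral_count_space_eq) auto
  then show "(\<integral>\<^sup>+\<zeta>. ennreal (if \<zeta> \<in> \<X> then jump_prob p \<eta> \<zeta> else 0) \<partial>count_space UNIV) = 1"
    using nn_integral_jump_prob[OF assms] by (simp cong: nn_integral_cong_simp)
qed (use jump_prob_nonneg[OF assms] in auto)

lemma emeasure_into_blocking:
  assumes "blocking_measure \<mu>" "\<eta> \<in> blocking_configs"
  shows "emeasure (measure_pmf \<mu>) {\<zeta>. into_blocking \<zeta> = \<eta>} = ennreal (pmf \<mu> \<eta>)"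
proof -
  have "emeasure (measure_pmf \<mu>) {\<zeta>. into_blocking \<zeta> = \<eta>} = emeasure (measure_pmf \<mu>) {\<eta>}"
    using assms by (intro emeasure_eq_AE) (auto simp: AE_measure_pmf_iff blocking_measure_def into_blocking_id subset_iff)
  then show ?thesis by (simp add: emeasure_pmf_single)
qed

theorem jump_chain_law_exists:
  assumes p: "exclusion_rates p" and \<mu>: "blocking_measure \<mu>"
  obtains M where "jump_chain_law p \<mu> M"
proof -
  let ?S = \<X>
  define P where "P = (\<lambda>(n::nat, \<eta>). measure_pmf (jump_kernel p \<eta>) \<Otimes>\<^sub>M holding_law (max 0 (exit_rate p \<eta>)))"
  have P: "P i = measure_pmf (jump_kernel p (snd i)) \<Otimes>\<^sub>M holding_law (max 0 (exit_rate p (snd i)))" for i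
    by (simp add: P_def case_prod_unfold)
  have sets_P: "sets (P i) = sets (count_space UNIV \<Otimes>\<^sub>M borel)" for i
    unfolding P by (intro sets_pair_measure_cong) auto
  have holding: "prob_space (holding_law (max 0 r))" for r by (rule prob_space_holding_law) simp
  have prob_P: "prob_space (P i)" for i
  proof -
    interpret H: prob_space "holding_law (max 0 (exit_rate p (snd i)))" by (rule holding)
    interpret pair_prob_space "measure_pmf (jump_kernel p (snd i))" "holding_law (max 0 (exit_rate p (snd i)))" ..
    show ?thesis unfolding P by (rule prob_space_axioms)
  qed
  interpret P: product_prob_space P UNIV
    by (intro product_prob_spaceI prob_P)
  let ?\<Omega> = "measure_pmf \<mu> \<Otimes>\<^sub>M PiM UNIV P"
  interpret PP: prob_space "PiM UNIV P" by (intro prob_space_PiM prob_P)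
  interpret pair_prob_space "measure_pmf \<mu>" "PiM UNIV P" ..
  have space: "space ?\<Omega> = UNIV"
    by (simp add: space_pair_measure space_PiM sets_eq_imp_space_eq[OF sets_P])
  have coord: "(\<lambda>x. snd x i) \<in> measurable ?\<Omega> (count_space UNIV \<Otimes>\<^sub>M borel)" for i
    unfolding measurable_cong_sets[OF refl sets_P[of i, symmetric]]
    by (rule measurable_compose[OF measurable_snd measurable_component_singleton]) simp
  have into: "into_blocking \<in> measurable (count_space UNIV) (count_space ?S)"
    by (simp add: into_blocking_in)
  have state: "sampled_state n \<in> measurable ?\<Omega> (count_space ?S)"
    and entry: "(\<lambda>x. snd x (n, sampled_state n x)) \<in> measurable ?\<Omega> (count_space UNIV \<Otimes>\<^sub>M borel)" for n
  proof -
    have entryI: "(\<lambda>x. snd x (n, sampled_state n x)) \<in> measurable ?\<Omega> (count_space UNIV \<Otimes>\<^sub>M borel)"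
      if "sampled_state n \<in> measurable ?\<Omega> (count_space ?S)" for n
      by (rule measurable_compose_countable'[OF coord that countable_blocking_configs])
    show st: "sampled_state n \<in> measurable ?\<Omega> (count_space ?S)"
    proof (induction n)
      case 0
      have f: "fst \<in> measurable ?\<Omega> (count_space UNIV)"
        using measurable_fst[of "measure_pmf \<mu>" "PiM UNIV P"] by simp
      show ?case using measurable_compose[OF f into] by simp
    next
      case (Suc n)
      show ?case
        using measurable_compose[OF measurable_compose[OF entryI[OF Suc] measurable_fst] into] by simp
    qed
    show "(\<lambda>x. snd x (n, sampled_state n x)) \<in> measurable ?\<Omega> (count_space UNIV \<Otimes>\<^sub>M borel)"
      by (rule entryI[OF st])
  qed
  have path: "sampled_path \<in> measurable ?\<Omega> path_space"
    unfolding path_space_def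
  proof (rule measurable_PiM_single')
    show "(\<lambda>x. sampled_path x n) \<in> measurable ?\<Omega> (count_space ?S \<Otimes>\<^sub>M borel)" for n
      unfolding sampled_path_def
      by (intro measurable_Pair state measurable_compose[OF entry measurable_snd])
  qed (auto simp: sampled_path_def space_pair_measure sampled_state_in)
  define M where "M = distr ?\<Omega> path_space sampled_path"
  have "measure M {\<omega> \<in> space M. \<forall>i\<le>n. fst (\<omega> i) = \<eta> i \<and> ennreal (s i) < snd (\<omega> i)}
      = pmf \<mu> (\<eta> 0) * (\<Prod>i<n. jump_prob p (\<eta> i) (\<eta> (Suc i))) * (\<Prod>i\<le>n. exp (- exit_rate p (\<eta> i) * s i))"
    if \<eta>s: "\<forall>i\<le>n. \<eta> i \<in> ?S \<and> 0 \<le> s i" for n \<eta> s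
  proof -
    let ?A = "{\<omega> \<in> space path_space. \<forall>i\<le>n. fst (\<omega> i) = \<eta> i \<and> ennreal (s i) < snd (\<omega> i)}"
    have A: "?A \<in> sets path_space"
    proof -
      have comp: "(\<lambda>\<omega>. \<omega> i) \<in> measurable path_space (count_space ?S \<Otimes>\<^sub>M borel)" for i
        unfolding path_space_def by (rule measurable_component_singleton) simp
      have "?A = (\<Inter>i\<in>{..n}. (\<lambda>\<omega>. \<omega> i) -` ({\<eta> i} \<times> {ennreal (s i)<..}) \<inter> space path_space)"
        by (auto simp: mem_Times_iff)
      also have "\<dots> \<in> sets path_space"
        using \<eta>s by (intro sets.finite_INT measurable_sets[OF comp] pair_measureI) auto
      finally show ?thesis .
    qed
    define C where "C i = (if i < n then {\<zeta>. into_blocking \<zeta> = \<eta> (Suc i)} else UNIV)" for i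
    let ?B = "\<lambda>i. C i \<times> {ennreal (s i)<..}"
    \<comment> \<open>Only the table entries \<open>(i, \<eta> i)\<close> are read along the prescribed
      path; at the last one only the holding time is prescribed.\<close>
    let ?J = "(\<lambda>i. (i, \<eta> i)) ` {..n}"
    let ?D = "{f \<in> space (PiM UNIV P). \<forall>j\<in>?J. f j \<in> ?B (fst j)}"
    have J: "inj_on (\<lambda>i. (i, \<eta> i)) {..n}" by (auto simp: inj_on_def)
    have B: "?B i \<in> sets (P j)" for i j
      unfolding sets_P by (intro pair_measureI) auto
    have D_INT: "?D = (\<Inter>j\<in>?J. (\<lambda>f. f j) -` ?B (fst j) \<inter> space (PiM UNIV P))" by auto
    have pre: "sampled_path -` ?A \<inter> space ?\<Omega> = {\<zeta>. into_blocking \<zeta> = \<eta> 0} \<times> ?D"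
    proof -
      have "x \<in> sampled_path -` ?A \<longleftrightarrow> x \<in> {\<zeta>. into_blocking \<zeta> = \<eta> 0} \<times> ?D" for x
      proof -
        have "x \<in> sampled_path -` ?A \<longleftrightarrow> (\<forall>i\<le>n. sampled_state i x = \<eta> i) \<and> (\<forall>i\<le>n. ennreal (s i) < snd (snd x (i, \<eta> i)))"
          using measurable_space[OF path, of x] by (auto simp: space sampled_path_def)
        also have "\<dots> \<longleftrightarrow> x \<in> {\<zeta>. into_blocking \<zeta> = \<eta> 0} \<times> ?D"
        proof -
          have "z \<in> ?B i \<longleftrightarrow> (i < n \<longrightarrow> into_blocking (fst z) = \<eta> (Suc i)) \<and> ennreal (s i) < snd z" for z i
            by (auto simp: C_def mem_Times_iff)
          moreover have "f \<in> ?D \<longleftrightarrow> (\<forall>i\<le>n. f (i, \<eta> i) \<in> ?B i)" for f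
            by (auto simp: space_PiM sets_eq_imp_space_eq[OF sets_P] space_pair_measure simp del: mem_Sigma_iff)
          ultimately show ?thesis
            unfolding sampled_state_eq_iff mem_Times_iff by (auto simp del: mem_Sigma_iff)
        qed
        finally show ?thesis .
      qed
      then show ?thesis by (auto simp: space)
    qed
    have D: "emeasure (PiM UNIV P) ?D = (\<Prod>i\<le>n. emeasure (P (i, \<eta> i)) (?B i))"
      using P.emeasure_PiM_Collect[of ?J "\<lambda>j. ?B (fst j)"] B by (simp add: prod.reindex[OF J])
    have PB: "emeasure (P (i, \<eta> i)) (?B i)
        = ennreal ((if i < n then jump_prob p (\<eta> i) (\<eta> (Suc i)) else 1) * exp (- exit_rate p (\<eta> i) * s i))"
      if "i \<le> n" for i
    proof -
      interpret H: prob_space "holding_law (max 0 (exit_rate p (\<eta> i)))" by (rule holding)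
      have \<eta>i: "\<eta> i \<in> ?S" "0 \<le> s i" using \<eta>s that by auto
      have "emeasure (measure_pmf (jump_kernel p (\<eta> i))) (C i) = ennreal (if i < n then jump_prob p (\<eta> i) (\<eta> (Suc i)) else 1)"
      proof (cases "i < n")
        case True
        have "blocking_measure (jump_kernel p (\<eta> i))"
          using pmf_jump_kernel[OF p \<eta>i(1)] by (auto simp: blocking_measure_def set_pmf_iff split: if_splits)
        moreover have "\<eta> (Suc i) \<in> ?S" using \<eta>s True by auto
        ultimately show ?thesis
          using emeasure_into_blocking pmf_jump_kernel[OF p \<eta>i(1)] True by (simp add: C_def)
      qed (simp add: C_def measure_pmf.emeasure_space_1[simplified])
      moreover have "emeasure (holding_law (exit_rate p (\<eta> i))) {ennreal (s i)<..} = ennreal (exp (- exit_rate p (\<eta> i) * s i))"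
        by (rule holding_law_tail[OF exit_rate_nonneg[OF p \<eta>i(1)] \<eta>i(2)])
      ultimately show ?thesis
        using exit_rate_nonneg[OF p \<eta>i(1)] unfolding P snd_conv
        by (subst H.emeasure_pair_measure_Times) (simp_all add: max_def ennreal_mult'')
    qed
    have K: "0 \<le> (if i < n then jump_prob p (\<eta> i) (\<eta> (Suc i)) else 1)" if "i \<le> n" for i
      using jump_prob_nonneg[OF p, of "\<eta> i"] \<eta>s that by auto
    have "emeasure M ?A = emeasure ?\<Omega> ({\<zeta>. into_blocking \<zeta> = \<eta> 0} \<times> ?D)"
      unfolding M_def by (subst emeasure_distr[OF path A]) (simp only: pre)
    also have "\<dots> = emeasure (measure_pmf \<mu>) {\<zeta>. into_blocking \<zeta> = \<eta> 0} * emeasure (PiM UNIV P) ?D"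
    proof (rule sigma_finite_measure.emeasure_pair_measure_Times)
      show "sigma_finite_measure (PiM UNIV P)"
        by (intro prob_space_imp_sigma_finite prob_space_PiM prob_P)
      show "?D \<in> sets (PiM UNIV P)"
        unfolding D_INT using B
        by (intro sets.finite_INT measurable_sets[OF measurable_component_singleton]) auto
    qed simp
    also have "\<dots> = ennreal (pmf \<mu> (\<eta> 0)) * (\<Prod>i\<le>n. ennreal ((if i < n then jump_prob p (\<eta> i) (\<eta> (Suc i)) else 1) * exp (- exit_rate p (\<eta> i) * s i)))"
      unfolding D using emeasure_into_blocking[OF \<mu>, of "\<eta> 0"] \<eta>s
      by (intro arg_cong2[where f = "(*)"] prod.cong PB) auto
    also have "\<dots> = ennreal (pmf \<mu> (\<eta> 0) * (\<Prod>i\<le>n. (if i < n then jump_prob p (\<eta> i) (\<eta> (Suc i)) else 1) * exp (- exit_rate p (\<eta> i) * s i)))"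
      using K by (subst prod_ennreal) (auto simp: ennreal_mult')
    also have "(\<Prod>i\<le>n. (if i < n then jump_prob p (\<eta> i) (\<eta> (Suc i)) else 1) * exp (- exit_rate p (\<eta> i) * s i))
        = (\<Prod>i<n. jump_prob p (\<eta> i) (\<eta> (Suc i))) * (\<Prod>i\<le>n. exp (- exit_rate p (\<eta> i) * s i))"
    proof -
      have "(\<Prod>i\<le>n. if i < n then jump_prob p (\<eta> i) (\<eta> (Suc i)) else 1) = (\<Prod>i<n. jump_prob p (\<eta> i) (\<eta> (Suc i)))"
        unfolding lessThan_Suc_atMost[symmetric] by simp
      then show ?thesis by (simp only: prod.distrib)
    qed
    finally have e: "emeasure M ?A = ennreal (pmf \<mu> (\<eta> 0) * ((\<Prod>i<n. jump_prob p (\<eta> i) (\<eta> (Suc i))) * (\<Prod>i\<le>n. exp (- exit_rate p (\<eta> i) * s i))))" .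
    have "0 \<le> (\<Prod>i<n. jump_prob p (\<eta> i) (\<eta> (Suc i)))" "0 \<le> (\<Prod>i\<le>n. exp (- exit_rate p (\<eta> i) * s i))"
      using jump_prob_nonneg[OF p] \<eta>s by (auto intro!: prod_nonneg)
    then show ?thesis
      using e by (simp add: M_def measure_def mult.assoc)
  qed
  moreover have "prob_space M"
    unfolding M_def by (rule prob_space_distr[OF path])
  moreover have "sets M = sets path_space" by (simp add: M_def)
  ultimately have "jump_chain_law p \<mu> M" by (simp add: jump_chain_law_def)
  then show thesis by (rule that)
qed

section \<open>The comparison theorem\<close>

theorem theorem1p1:
  fixes a abar :: "int \<Rightarrow> real"
  assumes "exclusion_rates (simple_rates a)"
    and "exclusion_rates (simple_rates abar)"
    and "\<And>x y. 0 < x \<Longrightarrow> x \<le> y \<Longrightarrow> a x \<ge> abar y"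
    and "\<And>x y. y \<le> x \<Longrightarrow> x < 0 \<Longrightarrow> a y \<le> abar x"
    and "\<exists>\<mu>. blocking_invariant (simple_rates abar) \<mu>"
  shows "\<exists>\<mu>. blocking_invariant (simple_rates a) \<mu>"
proof -
  obtain \<mu> where \<mu>: "blocking_invariant (simple_rates abar) \<mu>" using assms(5) by blast
  then have "blocking_measure \<mu>" by (simp add: blocking_invariant_def)
  then obtain \<nu> where \<nu>: "blocking_measure \<nu>"
    "\<And>\<zeta>. \<zeta> \<in> \<X> \<Longrightarrow>
      rates_occupation (simple_rates a) (\<lambda>\<zeta>. ennreal (pmf \<nu> \<zeta>)) \<zeta> = ennreal (pmf \<nu> \<zeta>)"
    using invariant_occupation_transfer[OF assms(1-4) _ blocking_invariant_occupation[OF assms(2) \<mu>]] by blast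
  obtain M where M: "jump_chain_law (simple_rates a) \<nu> M"
    using jump_chain_law_exists[OF assms(1) \<nu>(1)] .
  interpret jump_chain "simple_rates a" \<nu> M
    using assms(1) \<nu>(1) M by unfold_locales
  have "blocking_invariant (simple_rates a) \<nu>"
    unfolding blocking_invariant_def using \<nu>(1) M state_at_stationary[OF \<nu>(2)] by blast
  then show ?thesis ..
qed

end
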